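(* Let $s\ge1$, let $q\in \mathrm{GL}_n(R_{\pi})$ be symmetric and let $L=(L^{1},\ldots,L^{n})$ be a torsion symbol of the second kind. (1) There exists a unique $\pi$-connection $\Delta^{\mathrm{LC}}=(\delta_1^{\mathrm{LC}},\ldots,\delta_n^{\mathrm{LC}})$ of degree $s$ on $\mathrm{GL}_n$ that is metric with respect to $q$ and symmetric with respect to $L$. (2) If $\Gamma_{ijk}^{\mathrm{LC}}$ and $L_{ijk}$ are the corresponding Christoffel symbols and torsion symbols of the first kind, then in $\mathcal A$ $$\Gamma_{ijk}^{\mathrm{LC}} \equiv -\tfrac{1}{2}(\delta_{i}^{(s)}q_{jk}+\delta_{j}^{(s)}q_{ik}-\delta_{k}^{(s)}q_{ij})+\tfrac{1}{2}(L_{kij}(1)+L_{ijk}(1)-L_{jki}(1)) \ \ \mathrm{mod}\ \mathcal M.$$ (3) If $m\geq 1$ is an integer such that $L_{ij}^{k}(1)\equiv \delta_i^{(s)}q_{jk}\equiv 0$ mod $\pi^{m}$ in $R_{\pi}$ for all $i,j,k\in\{1,\ldots,n\}$, then $\Gamma_{ijk}^{\mathrm{LC}}\equiv 0$ mod $(\pi^{m},\mathcal P)$ in $\mathcal A$ for all $i,j,k$.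
   Context: $p$ odd prime; $R$ the $p$-adic completion of the ring of integers of the maximal unramified extension of $\mathbb Q_p$; $\pi$ a prime element of a finite Galois extension of $\mathbb Q_p$, $R_\pi=R[\pi]$. Fix $n\ge1$ and higher $\pi$-derivations $\delta_1^{(s)},\ldots,\delta_n^{(s)}$ of degree $s$ on $R_\pi$ (maps $\delta$ with $\delta(1)=0$, $\delta(x+y)=\delta x+\delta y+\frac p\pi C^{(s)}_p(x,y)$, $\delta(xy)=x^{p^s}\delta y+y^{p^s}\delta x+\pi\delta x\delta y$, $C^{(s)}_p(X,Y)=(X^{p^s}+Y^{p^s}-(X+Y)^{p^s})/p$), with associated higher $\pi$-Frobenius lifts $\phi_i^{(s)}(a)=a^{p^s}+\pi\delta^{(s)}_ia$ (ring endomorphisms). Let $x$ be an $n\times n$ matrix of indeterminates, $\mathcal A=R_\pi[x,\det(x)^{-1}]^{\widehat{\ }}$ ($p$-adic completion), $\mathcal P$ the ideal of $\mathcal A$ generated by the entries of $x-1$, $\mathcal M=(\pi,\mathcal P)$; $F(1)$ is the image of $F$ under $x\mapsto1$. $X^{(p^s)}$ denotes entrywise $p^s$-th power. A $\pi$-connection of degree $s$ on $\mathrm{GL}_n$ is an $n$-tuple of higher $\pi$-derivations $(\delta_i^{(s)})^G$ of degree $s$ on $\mathcal A$ extending $\delta_i^{(s)}$, with associated lifts $(\phi_i^{(s)})^G$. Its Christoffel symbols of the second kind are $\Gamma^{k}_{ij}:=(\Gamma_i)_{jk}$ where $\Gamma_i^t:=(x^{(p^s)})^{-1}(\delta_i^{(s)})^Gx$;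 set $\Lambda_i:=(x^{(p^s)})^{-1}(\phi_i^{(s)})^G(x)$, $\Lambda=(\Lambda_1,\ldots,\Lambda_n)$. Let $(\phi_{i,0}^{(s)})^G$ be the lift on $\mathcal A$ extending $\phi_i^{(s)}$ with $x\mapsto x^{(p^s)}$, and $\mathcal H_q:\mathcal A\to\mathcal A$ the $R_\pi$-algebra map with $\mathcal H_q(x)=x^tqx$. The connection is metric w.r.t. $q$ if $(\phi_i^{(s)})^G\circ\mathcal H_q=\mathcal H_q\circ(\phi_{i,0}^{(s)})^G$ for all $i$. A torsion symbol of the second kind is an $n$-tuple $L=(L^1,\ldots,L^n)$ of matrices $L^k\in\mathrm{Mat}_n(\widehat{R_\pi[y]})$ with $L^k_{ij}+L^k_{ji}=0$, where $y=(y_1,\ldots,y_n)$ is an $n$-tuple of $n\times n$ matrices of indeterminates and the hat is $p$-adic completion; $L^k_{ij}(\Lambda)$ (resp. $L^k_{ij}(1)$) is obtained by substituting $y_i\mapsto\Lambda_i$ (resp. $y_i\mapsto 1$). The connection is symmetric w.r.t. $L$ if $\Gamma^k_{ij}-\Gamma^k_{ji}=L^k_{ij}(\Lambda)$ for all $i,j,k$. First kind symbols: $\Gamma_{ijk}:=\sum_m\Gamma^m_{ij}q_{mk}^{p^s}$, $L_{ijk}:=\sum_mL^m_{ij}q_{mk}^{p^s}$, with $L_{ijk}(1)=\sum_m L^m_{ij}(1)q_{mk}^{p^s}$. *)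

theory Defs
  imports "HOL-Analysis.Analysis" "HOL-Library.Poly_Mapping"
    "HOL-Computational_Algebra.Polynomial"
begin

section \<open>The base ring\<close>

text \<open>
  All extensions of the \<open>p\<close>-adic numbers live in an ambient algebraically closed field, complete
  for an absolute value \<open>av\<close> that extends the \<open>p\<close>-adic one (for instance the field of complex
  \<open>p\<close>-adic numbers). Completions of its subrings are realised as closures.
\<close>

locale padic_ambient =
  fixes p :: nat and av :: "'k::{alg_closed_field, field_char_0} \<Rightarrow> real"
  assumes prime_p: "prime p"
    and av_nonneg: "0 \<le> av x"
    and av_eq_0_iff: "av x = 0 \<longleftrightarrow> x = 0"
    and av_mult: "av (x * y) = av x * av y"
    and av_add_le: "av (x + y) \<le> max (av x) (av y)"
    and av_p: "av (of_nat p) = 1 / real p"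
    and av_complete: "(\<forall>e>0. \<exists>N. \<forall>m\<ge>N. \<forall>n\<ge>N. av (X m - X n) < e) \<Longrightarrow>
                        \<exists>l. (\<lambda>n. av (X n - l)) \<longlonglongrightarrow> 0"

definition av_closure :: "('k::field \<Rightarrow> real) \<Rightarrow> 'k set \<Rightarrow> 'k set" where
  "av_closure av S = {x. \<forall>e>0. \<exists>y\<in>S. av (x - y) < e}"

definition is_subfield :: "'k::field set \<Rightarrow> bool" where
  "is_subfield K \<longleftrightarrow> 1 \<in> K \<and> (\<forall>x\<in>K. \<forall>y\<in>K. x - y \<in> K \<and> x * y \<in> K \<and> x / y \<in> K)"

definition Q_p :: "('k::field_char_0 \<Rightarrow> real) \<Rightarrow> 'k set" where
  "Q_p av = av_closure av \<rat>"

definition integers :: "('k::field \<Rightarrow> real) \<Rightarrow> 'k set \<Rightarrow> 'k set" where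
  "integers av K = {x \<in> K. av x \<le> 1}"

definition finite_ext_Q_p :: "('k::field_char_0 \<Rightarrow> real) \<Rightarrow> 'k set \<Rightarrow> bool" where
  "finite_ext_Q_p av K \<longleftrightarrow> is_subfield K \<and> Q_p av \<subseteq> K \<and>
     (\<exists>B. finite B \<and> B \<subseteq> K \<and> K = {\<Sum>b\<in>B. c b * b | c. \<forall>b\<in>B. c b \<in> Q_p av})"

definition Q_p_automorphism :: "('k::field_char_0 \<Rightarrow> real) \<Rightarrow> 'k set \<Rightarrow> ('k \<Rightarrow> 'k) \<Rightarrow> bool" where
  "Q_p_automorphism av K \<sigma> \<longleftrightarrow> bij_betw \<sigma> K K \<and> (\<forall>x\<in>Q_p av. \<sigma> x = x) \<and>
     (\<forall>x\<in>K. \<forall>y\<in>K. \<sigma> (x + y) = \<sigma> x + \<sigma> y \<and> \<sigma> (x * y) = \<sigma> x * \<sigma> y)"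

definition finite_galois_ext_Q_p :: "('k::field_char_0 \<Rightarrow> real) \<Rightarrow> 'k set \<Rightarrow> bool" where
  "finite_galois_ext_Q_p av K \<longleftrightarrow> finite_ext_Q_p av K \<and>
     {x \<in> K. \<forall>\<sigma>. Q_p_automorphism av K \<sigma> \<longrightarrow> \<sigma> x = x} = Q_p av"

definition prime_element :: "('k::field_char_0 \<Rightarrow> real) \<Rightarrow> 'k set \<Rightarrow> 'k \<Rightarrow> bool" where
  "prime_element av K \<pi> \<longleftrightarrow> {x \<in> K. av x < 1} = (\<lambda>y. \<pi> * y) ` integers av K"

text \<open>Residue fields of finite extensions are finite, hence no separability condition is needed.\<close>

definition finite_unramified :: "nat \<Rightarrow> ('k::field_char_0 \<Rightarrow> real) \<Rightarrow> 'k set \<Rightarrow> bool" where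
  "finite_unramified p av K \<longleftrightarrow> finite_ext_Q_p av K \<and> prime_element av K (of_nat p)"

text \<open>The maximal unramified extension, as the compositum of all finite unramified ones.\<close>

definition Q_p_ur :: "nat \<Rightarrow> ('k::field_char_0 \<Rightarrow> real) \<Rightarrow> 'k set" where
  "Q_p_ur p av = \<Inter>{F. is_subfield F \<and> (\<forall>K. finite_unramified p av K \<longrightarrow> K \<subseteq> F)}"

definition R_ring :: "nat \<Rightarrow> ('k::field_char_0 \<Rightarrow> real) \<Rightarrow> 'k set" where
  "R_ring p av = av_closure av (integers av (Q_p_ur p av))"

definition adjoin :: "'k::field set \<Rightarrow> 'k \<Rightarrow> 'k set" where
  "adjoin S \<pi> = {poly f \<pi> | f. \<forall>i. coeff f i \<in> S}"

definition is_ring_hom :: "('a::comm_ring_1 \<Rightarrow> 'b::comm_ring_1) \<Rightarrow> bool" where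
  "is_ring_hom h \<longleftrightarrow> h 1 = 1 \<and> (\<forall>x y. h (x + y) = h x + h y) \<and> (\<forall>x y. h (x * y) = h x * h y)"

text \<open>
  The type \<open>'r\<close> is the ring \<open>R[\<pi>]\<close>, identified through \<open>emb\<close> with a subring of the ambient field.
\<close>

locale R_pi_ring = padic_ambient p av
  for p :: nat and av :: "'k::{alg_closed_field, field_char_0} \<Rightarrow> real" +
  fixes emb :: "'r::idom \<Rightarrow> 'k" and \<pi> :: 'r
  assumes odd_p: "odd p"
    and emb_hom: "is_ring_hom emb"
    and emb_inj: "inj emb"
    and emb_prime: "\<exists>K. finite_galois_ext_Q_p av K \<and> prime_element av K (emb \<pi>)"
    and emb_range: "range emb = adjoin (R_ring p av) (emb \<pi>)"


section \<open>Higher \<pi>-derivations\<close>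

text \<open>\<open>C_poly p s\<close> is \<open>(X\<^sup>N + Y\<^sup>N - (X + Y)\<^sup>N) / p\<close> with \<open>N = p\<^sup>s\<close>; the division by \<open>p\<close> takes
  place in the integers (\<open>p\<close> divides the inner binomial coefficients), so that the formula makes
  sense in every commutative ring.\<close>

definition C_poly :: "nat \<Rightarrow> nat \<Rightarrow> 'a::comm_ring_1 \<Rightarrow> 'a \<Rightarrow> 'a" where
  "C_poly p s X Y = - (\<Sum>k\<in>{0<..<p ^ s}. of_nat ((p ^ s choose k) div p) * X ^ k * Y ^ (p ^ s - k))"

text \<open>The argument \<open>\<rho>\<close> stands for \<open>p / \<pi>\<close>.\<close>

definition higher_pi_derivation ::
  "nat \<Rightarrow> nat \<Rightarrow> 'a::comm_ring_1 \<Rightarrow> 'a \<Rightarrow> ('a \<Rightarrow> 'a) \<Rightarrow> bool" where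
  "higher_pi_derivation p s \<pi> \<rho> \<delta> \<longleftrightarrow> \<delta> 1 = 0 \<and>
     (\<forall>x y. \<delta> (x + y) = \<delta> x + \<delta> y + \<rho> * C_poly p s x y) \<and>
     (\<forall>x y. \<delta> (x * y) = x ^ (p ^ s) * \<delta> y + y ^ (p ^ s) * \<delta> x + \<pi> * \<delta> x * \<delta> y)"

definition p_over_pi :: "nat \<Rightarrow> 'r::idom \<Rightarrow> 'r" where
  "p_over_pi p \<pi> = (THE c. \<pi> * c = of_nat p)"

definition frob :: "nat \<Rightarrow> nat \<Rightarrow> 'a::comm_ring_1 \<Rightarrow> ('a \<Rightarrow> 'a) \<Rightarrow> 'a \<Rightarrow> 'a" where
  "frob p s \<pi> \<delta> a = a ^ (p ^ s) + \<pi> * \<delta> a"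

definition half :: "'a::comm_ring_1" where
  "half = (THE h. 2 * h = 1)"

definition gen_ideal :: "'a::comm_ring_1 set \<Rightarrow> 'a set" where
  "gen_ideal S = module.span (*) S"


section \<open>Adic completion\<close>

text \<open>
  \<open>('p, 'b) pcompl\<close> is the completion of \<open>'b\<close> at the number \<open>p = CARD('p)\<close>, that is, the inverse
  limit of the rings \<open>'b / (p\<^sup>n)\<close>: an element is given by a sequence \<open>X\<close> with
  \<open>X (n + 1) \<equiv> X n\<close> modulo \<open>p\<^sup>n\<close>, where \<open>X n\<close> matters modulo \<open>p\<^sup>n\<close> only.
  If \<open>p\<close> is a unit of \<open>'b\<close>, the inverse limit is the zero ring, which is not of class
  \<open>comm_ring_1\<close>; only in that irrelevant case is \<open>p\<close> replaced by \<open>0\<close>.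
\<close>

definition pgen :: "'p::finite itself \<Rightarrow> 'b::comm_ring_1" where
  "pgen _ = (if of_nat CARD('p) dvd (1::'b) then 0 else of_nat CARD('p))"

definition coherent :: "'p::finite itself \<Rightarrow> (nat \<Rightarrow> 'b::comm_ring_1) \<Rightarrow> bool" where
  "coherent P X \<longleftrightarrow> (\<forall>n. pgen P ^ n dvd X (Suc n) - X n)"

definition pcompl_rel ::
  "'p::finite itself \<Rightarrow> (nat \<Rightarrow> 'b::comm_ring_1) \<Rightarrow> (nat \<Rightarrow> 'b) \<Rightarrow> bool" where
  "pcompl_rel P X Y \<longleftrightarrow> coherent P X \<and> coherent P Y \<and> (\<forall>n. pgen P ^ n dvd X n - Y n)"

lemma pgen_not_unit: "\<not> pgen P dvd (1::'b::comm_ring_1)"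
  by (auto simp: pgen_def)

lemma part_equivp_pcompl_rel: "part_equivp (pcompl_rel P :: (nat \<Rightarrow> 'b::comm_ring_1) \<Rightarrow> _)"
proof (rule part_equivpI)
  show "\<exists>X :: nat \<Rightarrow> 'b. pcompl_rel P X X"
    by (rule exI[of _ "\<lambda>_. 0"]) (simp add: pcompl_rel_def coherent_def)
  show "symp (pcompl_rel P :: (nat \<Rightarrow> 'b) \<Rightarrow> _)"
    unfolding symp_def pcompl_rel_def by (metis dvd_minus_iff minus_diff_eq)
  show "transp (pcompl_rel P :: (nat \<Rightarrow> 'b) \<Rightarrow> _)"
  proof (rule transpI)
    fix X Y Z :: "nat \<Rightarrow> 'b"
    assume XY: "pcompl_rel P X Y" and YZ: "pcompl_rel P Y Z"
    have "pgen P ^ n dvd X n - Z n" for n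
    proof -
      have "pgen P ^ n dvd (X n - Y n) + (Y n - Z n)"
        using XY YZ by (intro dvd_add) (auto simp: pcompl_rel_def)
      then show ?thesis by simp
    qed
    then show "pcompl_rel P X Z" using XY YZ by (auto simp: pcompl_rel_def)
  qed
qed

lemma dvd_diff_add:
  fixes c :: "'b::comm_ring_1"
  assumes "c dvd a - a'" "c dvd b - b'"
  shows "c dvd (a + b) - (a' + b')"
proof -
  have "(a + b) - (a' + b') = (a - a') + (b - b')" by simp
  then show ?thesis using dvd_add[OF assms] by (simp only:)
qed

lemma dvd_diff_mult:
  fixes c :: "'b::comm_ring_1"
  assumes "c dvd a - a'" "c dvd b - b'"
  shows "c dvd a * b - a' * b'"
proof -
  have "a * b - a' * b' = (a - a') * b + a' * (b - b')" by (simp add: algebra_simps)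
  then show ?thesis using dvd_add[OF dvd_mult2[OF assms(1), of b] dvd_mult[OF assms(2), of a']]
    by (simp only:)
qed

lemma dvd_diff_uminus:
  fixes c :: "'b::comm_ring_1"
  assumes "c dvd a - a'"
  shows "c dvd - a - (- a')"
proof -
  have "- a - (- a') = - (a - a')" by simp
  then show ?thesis using assms by (simp only: dvd_minus_iff)
qed

lemma pcompl_rel_const: "pcompl_rel P (\<lambda>_. c) (\<lambda>_. c)"
  by (simp add: pcompl_rel_def coherent_def)

typedef (overloaded) ('p, 'b) pcompl =
  "{c. \<exists>X :: nat \<Rightarrow> 'b::comm_ring_1. pcompl_rel TYPE('p::finite) X X \<and>
      c = Collect (pcompl_rel TYPE('p) X)}"
proof -
  have "pcompl_rel TYPE('p) (\<lambda>_. 0 :: 'b) (\<lambda>_. 0)"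
    by (rule pcompl_rel_const)
  then show ?thesis by blast
qed

definition abs_pcompl :: "(nat \<Rightarrow> 'b::comm_ring_1) \<Rightarrow> ('p::finite, 'b) pcompl" where
  "abs_pcompl X = Abs_pcompl (Collect (pcompl_rel TYPE('p) X))"

definition rep_pcompl :: "('p::finite, 'b::comm_ring_1) pcompl \<Rightarrow> nat \<Rightarrow> 'b" where
  "rep_pcompl a = (SOME X. X \<in> Rep_pcompl a)"

lemma Quotient3_pcompl:
  "Quotient3 (pcompl_rel TYPE('p::finite)) abs_pcompl
     (rep_pcompl :: ('p, 'b::comm_ring_1) pcompl \<Rightarrow> _)"
proof -
  interpret quot_type "pcompl_rel TYPE('p) :: (nat \<Rightarrow> 'b) \<Rightarrow> _" Abs_pcompl
    "Rep_pcompl :: ('p, 'b) pcompl \<Rightarrow> _"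
  proof
    show "\<exists>X. pcompl_rel TYPE('p) X X \<and> Rep_pcompl y = Collect (pcompl_rel TYPE('p) X)"
      for y :: "('p, 'b) pcompl"
      using Rep_pcompl[of y] by simp
    show "Rep_pcompl (Abs_pcompl c :: ('p, 'b) pcompl) = c"
      if "\<exists>X. pcompl_rel TYPE('p) X X \<and> c = Collect (pcompl_rel TYPE('p) X)" for c
      using that by (intro Abs_pcompl_inverse) simp
  qed (rule part_equivp_pcompl_rel Rep_pcompl_inverse Rep_pcompl_inject)+
  have "abs = (abs_pcompl :: _ \<Rightarrow> ('p, 'b) pcompl)" "rep = (rep_pcompl :: ('p, 'b) pcompl \<Rightarrow> _)"
    by (auto simp: fun_eq_iff abs_def rep_def abs_pcompl_def rep_pcompl_def)
  then show ?thesis using Quotient by simp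
qed

lemmas abs_rep_pcompl = Quotient3_abs_rep[OF Quotient3_pcompl]
  and rep_pcompl_refl = Quotient3_rep_reflp[OF Quotient3_pcompl]
  and pcompl_rel_rep_abs = rep_abs_rsp_left[OF Quotient3_pcompl]

lemma abs_pcompl_eqI:
  "pcompl_rel TYPE('p::finite) X Y \<Longrightarrow> (abs_pcompl X :: ('p, 'b::comm_ring_1) pcompl) = abs_pcompl Y"
  by (rule Quotient3_rel_abs[OF Quotient3_pcompl])

lemma pcompl_rel_add:
  "pcompl_rel P X X' \<Longrightarrow> pcompl_rel P Y Y' \<Longrightarrow> pcompl_rel P (\<lambda>n. X n + Y n) (\<lambda>n. X' n + Y' n)"
  unfolding pcompl_rel_def coherent_def by (intro conjI allI dvd_diff_add; simp)

lemma pcompl_rel_mult: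
  "pcompl_rel P X X' \<Longrightarrow> pcompl_rel P Y Y' \<Longrightarrow> pcompl_rel P (\<lambda>n. X n * Y n) (\<lambda>n. X' n * Y' n)"
  unfolding pcompl_rel_def coherent_def by (intro conjI allI dvd_diff_mult; simp)

lemma pcompl_rel_uminus: "pcompl_rel P X X' \<Longrightarrow> pcompl_rel P (\<lambda>n. - X n) (\<lambda>n. - X' n)"
  unfolding pcompl_rel_def coherent_def by (intro conjI allI dvd_diff_uminus; simp)

lemmas pcompl_rel_intros = pcompl_rel_const pcompl_rel_add pcompl_rel_mult pcompl_rel_uminus

instantiation pcompl :: (finite, comm_ring_1) comm_ring_1
begin

definition zero_pcompl :: "('a, 'b) pcompl" where
  "zero_pcompl = abs_pcompl (\<lambda>_. 0)"

definition one_pcompl :: "('a, 'b) pcompl" where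
  "one_pcompl = abs_pcompl (\<lambda>_. 1)"

definition plus_pcompl :: "('a, 'b) pcompl \<Rightarrow> ('a, 'b) pcompl \<Rightarrow> ('a, 'b) pcompl" where
  "plus_pcompl x y = abs_pcompl (\<lambda>n. rep_pcompl x n + rep_pcompl y n)"

definition times_pcompl :: "('a, 'b) pcompl \<Rightarrow> ('a, 'b) pcompl \<Rightarrow> ('a, 'b) pcompl" where
  "times_pcompl x y = abs_pcompl (\<lambda>n. rep_pcompl x n * rep_pcompl y n)"

definition uminus_pcompl :: "('a, 'b) pcompl \<Rightarrow> ('a, 'b) pcompl" where
  "uminus_pcompl x = abs_pcompl (\<lambda>n. - rep_pcompl x n)"

definition minus_pcompl :: "('a, 'b) pcompl \<Rightarrow> ('a, 'b) pcompl \<Rightarrow> ('a, 'b) pcompl" where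
  "minus_pcompl x y = x + (- y)"

lemma abs_pcompl_add:
  assumes "pcompl_rel TYPE('a) X X" "pcompl_rel TYPE('a) Y Y"
  shows "(abs_pcompl X :: ('a, 'b) pcompl) + abs_pcompl Y = abs_pcompl (\<lambda>n. X n + Y n)"
  unfolding plus_pcompl_def
  by (rule abs_pcompl_eqI, rule pcompl_rel_add; rule pcompl_rel_rep_abs; rule assms)

lemma abs_pcompl_mult:
  assumes "pcompl_rel TYPE('a) X X" "pcompl_rel TYPE('a) Y Y"
  shows "(abs_pcompl X :: ('a, 'b) pcompl) * abs_pcompl Y = abs_pcompl (\<lambda>n. X n * Y n)"
  unfolding times_pcompl_def
  by (rule abs_pcompl_eqI, rule pcompl_rel_mult; rule pcompl_rel_rep_abs; rule assms)

lemma abs_pcompl_uminus: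
  assumes "pcompl_rel TYPE('a) X X"
  shows "- (abs_pcompl X :: ('a, 'b) pcompl) = abs_pcompl (\<lambda>n. - X n)"
  unfolding uminus_pcompl_def
  by (rule abs_pcompl_eqI, rule pcompl_rel_uminus, rule pcompl_rel_rep_abs, rule assms)

instance
proof
  fix a b c :: "('a, 'b) pcompl"
  obtain X Y Z where abc: "a = abs_pcompl X" "b = abs_pcompl Y" "c = abs_pcompl Z"
    and refl: "pcompl_rel TYPE('a) X X" "pcompl_rel TYPE('a) Y Y" "pcompl_rel TYPE('a) Z Z"
    using abs_rep_pcompl[symmetric] rep_pcompl_refl by blast
  note ops = abs_pcompl_add abs_pcompl_mult abs_pcompl_uminus zero_pcompl_def one_pcompl_def
    pcompl_rel_intros refl
  show "a * b * c = a * (b * c)"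
    by (simp add: abc ops mult.assoc)
  show "a * b = b * a"
    by (simp add: abc ops mult.commute)
  show "1 * a = a"
    by (simp add: abc ops)
  show "a + b + c = a + (b + c)"
    by (simp add: abc ops add.assoc)
  show "a + b = b + a"
    by (simp add: abc ops add.commute)
  show "0 + a = a"
    by (simp add: abc ops)
  show "- a + a = 0"
    by (simp add: abc ops)
  show "a - b = a + (- b)"
    by (rule minus_pcompl_def)
  show "(a + b) * c = a * c + b * c"
    by (simp add: abc ops distrib_right)
  show "(0::('a, 'b) pcompl) \<noteq> 1"
  proof
    assume "(0::('a, 'b) pcompl) = 1"
    then have "pcompl_rel TYPE('a) (\<lambda>_. 0::'b) (\<lambda>_. 1)"
      using Quotient3_rel[OF Quotient3_pcompl, of "\<lambda>_. 0" "\<lambda>_. 1"] pcompl_rel_const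
      unfolding zero_pcompl_def one_pcompl_def by blast
    then have "pgen TYPE('a) ^ 1 dvd (0::'b) - 1" unfolding pcompl_rel_def by blast
    then show False using pgen_not_unit[of "TYPE('a)", where 'b = 'b] by simp
  qed
qed

end

definition to_pcompl :: "'b::comm_ring_1 \<Rightarrow> ('p::finite, 'b) pcompl" where
  "to_pcompl b = abs_pcompl (\<lambda>_. b)"


section \<open>Polynomial rings and the coordinate ring of the general linear group\<close>

type_synonym ('v, 'r) mpoly = "('v \<Rightarrow>\<^sub>0 nat) \<Rightarrow>\<^sub>0 'r"

definition mconst :: "'r::comm_ring_1 \<Rightarrow> ('v, 'r) mpoly" where
  "mconst a = Poly_Mapping.single 0 a"

definition mvar :: "'v \<Rightarrow> ('v, 'r::comm_ring_1) mpoly" where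
  "mvar v = Poly_Mapping.single (Poly_Mapping.single v 1) 1"

definition xpoly :: "('n::finite \<times> 'n, 'r::comm_ring_1) mpoly ^ 'n ^ 'n" where
  "xpoly = (\<chi> i j. mvar (i, j))"


definition msubst :: "('v \<Rightarrow> 'r) \<Rightarrow> ('v, 'r::comm_ring_1) mpoly \<Rightarrow> 'r" where
  "msubst c f = (\<Sum>m\<in>Poly_Mapping.keys f. Poly_Mapping.lookup f m * (\<Prod>v\<in>Poly_Mapping.keys m. c v ^ Poly_Mapping.lookup m v))"

lemma msubst_superset:
  assumes "finite S" "Poly_Mapping.keys f \<subseteq> S"
  shows "msubst c f = (\<Sum>m\<in>S. Poly_Mapping.lookup f m * (\<Prod>v\<in>Poly_Mapping.keys m. c v ^ Poly_Mapping.lookup m v))"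
  unfolding msubst_def
  by (rule sum.mono_neutral_left) (use assms in \<open>auto simp: in_keys_iff\<close>)

lemma msubst_add: "msubst c (f + g) = msubst c f + msubst c g"
proof -
  let ?S = "Poly_Mapping.keys f \<union> Poly_Mapping.keys g"
  have "Poly_Mapping.keys (f + g) \<subseteq> ?S" by (rule Poly_Mapping.keys_add)
  then show ?thesis
    by (simp add: msubst_superset[of ?S] lookup_add distrib_right sum.distrib)
qed

lemma msubst_single:
  "msubst c (Poly_Mapping.single m a) = a * (\<Prod>v\<in>Poly_Mapping.keys m. c v ^ Poly_Mapping.lookup m v)"
  by (subst msubst_superset[of "{m}"]) auto

lemma msubst_0 [simp]: "msubst c 0 = 0"
  by (simp add: msubst_def)

lemma msubst_1 [simp]: "msubst c 1 = 1"
  using msubst_single[of c 0 1] by simp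

lemma msubst_sum: "msubst c (sum f A) = (\<Sum>x\<in>A. msubst c (f x))"
  by (induction A rule: infinite_finite_induct) (auto simp: msubst_add)

lemma mpoly_sum_single:
  "f = (\<Sum>m\<in>Poly_Mapping.keys f. Poly_Mapping.single m (Poly_Mapping.lookup f m))"
  by (rule poly_mapping_eqI) (auto simp: lookup_sum lookup_single when_def in_keys_iff)

lemma monomial_add:
  fixes c :: "'v \<Rightarrow> 'r::comm_ring_1"
  shows "(\<Prod>v\<in>Poly_Mapping.keys (m + m'). c v ^ Poly_Mapping.lookup (m + m') v) =
    (\<Prod>v\<in>Poly_Mapping.keys m. c v ^ Poly_Mapping.lookup m v) * (\<Prod>v\<in>Poly_Mapping.keys m'. c v ^ Poly_Mapping.lookup m' v)"
proof -
  let ?S = "Poly_Mapping.keys m \<union> Poly_Mapping.keys m'"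
  have *: "(\<Prod>v\<in>Poly_Mapping.keys k. c v ^ Poly_Mapping.lookup k v) = (\<Prod>v\<in>?S. c v ^ Poly_Mapping.lookup k v)"
    if "Poly_Mapping.keys k \<subseteq> ?S" for k :: "'v \<Rightarrow>\<^sub>0 nat"
    by (rule prod.mono_neutral_left) (use that in \<open>auto simp: in_keys_iff\<close>)
  show ?thesis
    using *[OF Poly_Mapping.keys_add] *[OF Un_upper1] *[OF Un_upper2]
    by (simp only: lookup_add power_add prod.distrib)
qed

lemma msubst_mult: "msubst c (f * g) = msubst c f * msubst c g"
proof -
  have "msubst c (f * g) = msubst c ((\<Sum>m\<in>Poly_Mapping.keys f. Poly_Mapping.single m (Poly_Mapping.lookup f m)) *
      (\<Sum>m\<in>Poly_Mapping.keys g. Poly_Mapping.single m (Poly_Mapping.lookup g m)))"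
    by (rule arg_cong[where f = "msubst c"], rule arg_cong2[where f = "(*)"]; rule mpoly_sum_single)
  also have "\<dots> = msubst c f * msubst c g"
    unfolding msubst_def[of c f] msubst_def[of c g] sum_product
    by (simp add: mult_single msubst_sum msubst_single monomial_add ac_simps)
  finally show ?thesis .
qed

lemma msubst_prod: "msubst c (prod f A) = (\<Prod>x\<in>A. msubst c (f x))"
  by (induction A rule: infinite_finite_induct) (auto simp: msubst_mult)

lemma msubst_power: "msubst c (f ^ k) = msubst c f ^ k"
  by (induction k) (auto simp: msubst_mult)

lemma msubst_of_int: "msubst c (of_int k) = of_int k"
  using msubst_single[of c 0 "of_int k"] by simp

lemma msubst_det: "msubst c (det A) = det (map_matrix (msubst c) A)"
  by (simp add: det_def msubst_sum msubst_mult msubst_prod msubst_of_int map_matrix_def)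

lemma det_xpoly_power_nonzero: "det (xpoly :: ('n::finite \<times> 'n, 'r::comm_ring_1) mpoly ^ 'n ^ 'n) ^ m \<noteq> 0"
proof
  let ?x = "xpoly :: ('n \<times> 'n, 'r) mpoly ^ 'n ^ 'n"
  let ?c = "\<lambda>(i, j). if i = j then 1 else (0::'r)"
  assume "det ?x ^ m = 0"
  moreover have "map_matrix (msubst ?c) ?x = mat 1"
    by (simp add: map_matrix_def xpoly_def mvar_def msubst_single mat_def vec_eq_iff)
  then have "msubst ?c (det ?x ^ m) = 1"
    by (simp add: msubst_power msubst_det)
  ultimately show False by simp
qed

text \<open>A pair \<open>(f, k)\<close> stands for the fraction \<open>f / d\<^sup>k\<close>.\<close>

definition loc_rel :: "'a::comm_ring_1 \<Rightarrow> 'a \<times> nat \<Rightarrow> 'a \<times> nat \<Rightarrow> bool" where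
  "loc_rel d = (\<lambda>(f, k) (g, l). \<exists>m. d ^ m * (d ^ l * f - d ^ k * g) = 0)"

lemma equivp_loc_rel: "equivp (loc_rel d)"
proof (rule equivpI)
  show "reflp (loc_rel d)" by (auto simp: reflp_def loc_rel_def)
  show "symp (loc_rel d)"
  proof (rule sympI)
    fix a b assume "loc_rel d a b"
    then obtain m where "d ^ m * (d ^ snd b * fst a - d ^ snd a * fst b) = 0"
      by (auto simp: loc_rel_def split: prod.splits)
    then have "d ^ m * (d ^ snd a * fst b - d ^ snd b * fst a) = 0"
      by (simp add: right_diff_distrib)
    then show "loc_rel d b a" by (auto simp: loc_rel_def split: prod.splits)
  qed
  show "transp (loc_rel d)"
  proof (rule transpI)
    fix a b c assume "loc_rel d a b" "loc_rel d b c"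
    then obtain m m' where m: "d ^ m * (d ^ snd b * fst a - d ^ snd a * fst b) = 0"
      and m': "d ^ m' * (d ^ snd c * fst b - d ^ snd b * fst c) = 0"
      by (auto simp: loc_rel_def split: prod.splits)
    have "d ^ (m + m' + snd b) * (d ^ snd c * fst a - d ^ snd a * fst c) =
        d ^ m' * d ^ snd c * (d ^ m * (d ^ snd b * fst a - d ^ snd a * fst b)) +
        d ^ m * d ^ snd a * (d ^ m' * (d ^ snd c * fst b - d ^ snd b * fst c))"
      by (simp add: power_add algebra_simps)
    then have "d ^ (m + m' + snd b) * (d ^ snd c * fst a - d ^ snd a * fst c) = 0"
      using m m' by simp
    then show "loc_rel d a c" by (auto simp: loc_rel_def split: prod.splits)
  qed
qed

lemma loc_rel_add:
  assumes "loc_rel d (f, k) (f', k')" "loc_rel d (g, l) (g', l')"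
  shows "loc_rel d (d ^ l * f + d ^ k * g, k + l) (d ^ l' * f' + d ^ k' * g', k' + l')"
proof -
  from assms obtain m m' where m: "d ^ m * (d ^ k' * f - d ^ k * f') = 0"
    and m': "d ^ m' * (d ^ l' * g - d ^ l * g') = 0" by (auto simp: loc_rel_def)
  have "d ^ (m + m') * (d ^ (k' + l') * (d ^ l * f + d ^ k * g)
        - d ^ (k + l) * (d ^ l' * f' + d ^ k' * g')) =
      d ^ m' * d ^ l * d ^ l' * (d ^ m * (d ^ k' * f - d ^ k * f')) +
      d ^ m * d ^ k * d ^ k' * (d ^ m' * (d ^ l' * g - d ^ l * g'))"
    by (simp add: power_add algebra_simps)
  then show ?thesis using m m' by (auto simp: loc_rel_def)
qed

lemma loc_rel_mult:
  assumes "loc_rel d (f, k) (f', k')" "loc_rel d (g, l) (g', l')"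
  shows "loc_rel d (f * g, k + l) (f' * g', k' + l')"
proof -
  from assms obtain m m' where m: "d ^ m * (d ^ k' * f - d ^ k * f') = 0"
    and m': "d ^ m' * (d ^ l' * g - d ^ l * g') = 0" by (auto simp: loc_rel_def)
  have "d ^ (m + m') * (d ^ (k' + l') * (f * g) - d ^ (k + l) * (f' * g')) =
      d ^ m' * d ^ l' * g * (d ^ m * (d ^ k' * f - d ^ k * f')) +
      d ^ m * d ^ k * f' * (d ^ m' * (d ^ l' * g - d ^ l * g'))"
    by (simp add: power_add algebra_simps)
  then show ?thesis using m m' by (auto simp: loc_rel_def)
qed

lemma loc_rel_uminus:
  assumes "loc_rel d (f, k) (f', k')"
  shows "loc_rel d (- f, k) (- f', k')"
proof -
  from assms obtain m where m: "d ^ m * (d ^ k' * f - d ^ k * f') = 0" by (auto simp: loc_rel_def)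
  have "d ^ m * (d ^ k' * (- f) - d ^ k * (- f')) = - (d ^ m * (d ^ k' * f - d ^ k * f'))"
    by (simp add: algebra_simps)
  then have "d ^ m * (d ^ k' * (- f) - d ^ k * (- f')) = 0" using m by simp
  then show ?thesis by (auto simp: loc_rel_def)
qed

lemma loc_rel_eq: "d ^ l * f = d ^ k * g \<Longrightarrow> loc_rel d (f, k) (g, l)"
  by (auto simp: loc_rel_def)

quotient_type (overloaded) ('n, 'r) gl_coord =
  "('n::finite \<times> 'n, 'r::comm_ring_1) mpoly \<times> nat" / "loc_rel (det xpoly)"
  by (rule equivp_loc_rel)

instantiation gl_coord :: (finite, comm_ring_1) comm_ring_1
begin

lift_definition zero_gl_coord :: "('a, 'b) gl_coord" is "(0, 0)" .

lift_definition one_gl_coord :: "('a, 'b) gl_coord" is "(1, 0)" .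

lift_definition plus_gl_coord :: "('a, 'b) gl_coord \<Rightarrow> ('a, 'b) gl_coord \<Rightarrow> ('a, 'b) gl_coord"
  is "\<lambda>(f, k) (g, l). (det xpoly ^ l * f + det xpoly ^ k * g, k + l)"
  by (clarsimp simp del: split_paired_All) (rule loc_rel_add)

lift_definition times_gl_coord :: "('a, 'b) gl_coord \<Rightarrow> ('a, 'b) gl_coord \<Rightarrow> ('a, 'b) gl_coord"
  is "\<lambda>(f, k) (g, l). (f * g, k + l)"
  by (clarsimp simp del: split_paired_All) (rule loc_rel_mult)

lift_definition uminus_gl_coord :: "('a, 'b) gl_coord \<Rightarrow> ('a, 'b) gl_coord"
  is "\<lambda>(f, k). (- f, k)"
  by (clarsimp simp del: split_paired_All) (rule loc_rel_uminus)

definition minus_gl_coord :: "('a, 'b) gl_coord \<Rightarrow> ('a, 'b) gl_coord \<Rightarrow> ('a, 'b) gl_coord" where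
  "minus_gl_coord x y = x + (- y)"

instance
proof
  fix a b c :: "('a, 'b) gl_coord"
  have "\<exists>f k. x = abs_gl_coord (f, k)" for x :: "('a, 'b) gl_coord"
    using gl_coord.abs_induct[of "\<lambda>x. \<exists>f k. x = abs_gl_coord (f, k)" x] by auto
  then obtain f k g l h m where
    abc: "a = abs_gl_coord (f, k)" "b = abs_gl_coord (g, l)" "c = abs_gl_coord (h, m)"
    by metis
  note eqs = abc plus_gl_coord.abs_eq times_gl_coord.abs_eq uminus_gl_coord.abs_eq
    zero_gl_coord.abs_eq one_gl_coord.abs_eq gl_coord.abs_eq_iff prod.case
  show "a * b * c = a * (b * c)"
    unfolding eqs by (rule loc_rel_eq) (simp add: ac_simps)
  show "a * b = b * a"
    unfolding eqs by (rule loc_rel_eq) (simp add: ac_simps)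
  show "1 * a = a"
    unfolding eqs by (rule loc_rel_eq) simp
  show "a + b + c = a + (b + c)"
    unfolding eqs by (rule loc_rel_eq) (simp add: power_add algebra_simps)
  show "a + b = b + a"
    unfolding eqs by (rule loc_rel_eq) (simp add: power_add algebra_simps)
  show "0 + a = a"
    unfolding eqs by (rule loc_rel_eq) simp
  show "- a + a = 0"
    unfolding eqs by (rule loc_rel_eq) simp
  show "a - b = a + (- b)"
    by (rule minus_gl_coord_def)
  show "(a + b) * c = a * c + b * c"
    unfolding eqs by (rule loc_rel_eq) (simp add: power_add algebra_simps)
  show "(0::('a, 'b) gl_coord) \<noteq> 1"
    unfolding eqs using det_xpoly_power_nonzero[where 'n = 'a and 'r = 'b]
    by (auto simp: loc_rel_def)
qed

end

definition to_gl_coord :: "('n::finite \<times> 'n, 'r::comm_ring_1) mpoly \<Rightarrow> ('n, 'r) gl_coord" where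
  "to_gl_coord f = abs_gl_coord (f, 0)"

text \<open>The ring \<open>\<A>\<close> is \<open>('p, 'n, 'r) gl_alg\<close>; the entries of \<open>yvar i\<close> are those of the matrix
  \<open>y\<^sub>i\<close> of indeterminates.\<close>

type_synonym ('p, 'n, 'r) gl_alg = "('p, ('n, 'r) gl_coord) pcompl"

type_synonym ('p, 'n, 'r) y_alg = "('p, ('n \<times> 'n \<times> 'n, 'r) mpoly) pcompl"

definition gl_const :: "'r::comm_ring_1 \<Rightarrow> ('p::finite, 'n::finite, 'r) gl_alg" where
  "gl_const a = to_pcompl (to_gl_coord (mconst a))"

definition gl_x :: "('p::finite, 'n::finite, 'r::comm_ring_1) gl_alg ^ 'n ^ 'n" where
  "gl_x = map_matrix (\<lambda>f. to_pcompl (to_gl_coord f)) xpoly"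

definition yconst :: "'r::comm_ring_1 \<Rightarrow> ('p::finite, 'n::finite, 'r) y_alg" where
  "yconst a = to_pcompl (mconst a)"

definition yvar :: "'n::finite \<Rightarrow> ('p::finite, 'n, 'r::comm_ring_1) y_alg ^ 'n ^ 'n" where
  "yvar i = (\<chi> j k. to_pcompl (mvar (i, j, k)))"

text \<open>The ring map that is given by \<open>\<sigma>\<close> on constants and sends the indeterminates to the given
  matrices. It is unique if the target is separated for the \<open>p\<close>-adic topology, since ring maps are
  \<open>p\<close>-adically continuous.\<close>

definition gl_subst ::
  "('r::comm_ring_1 \<Rightarrow> 'a::comm_ring_1) \<Rightarrow> 'a ^ 'n ^ 'n \<Rightarrow> ('p::finite, 'n::finite, 'r) gl_alg \<Rightarrow> 'a" where
  "gl_subst \<sigma> M = (THE h. is_ring_hom h \<and> (\<forall>a. h (gl_const a) = \<sigma> a) \<and> map_matrix h gl_x = M)"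

definition y_subst ::
  "('r::comm_ring_1 \<Rightarrow> 'a::comm_ring_1) \<Rightarrow> ('n \<Rightarrow> 'a ^ 'n ^ 'n) \<Rightarrow> ('p::finite, 'n::finite, 'r) y_alg \<Rightarrow> 'a" where
  "y_subst \<sigma> M = (THE h. is_ring_hom h \<and> (\<forall>a. h (yconst a) = \<sigma> a) \<and>
     (\<forall>i. map_matrix h (yvar i) = M i))"


section \<open>Connections\<close>

definition entrywise_power :: "'a::comm_ring_1 ^ 'n ^ 'n \<Rightarrow> nat \<Rightarrow> 'a ^ 'n ^ 'n" where
  "entrywise_power A N = map_matrix (\<lambda>a. a ^ N) A"

definition pi_connection ::
  "nat \<Rightarrow> 'r::idom \<Rightarrow> ('n::finite \<Rightarrow> 'r \<Rightarrow> 'r) \<Rightarrow>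
   ('n \<Rightarrow> ('p::finite, 'n, 'r) gl_alg \<Rightarrow> ('p, 'n, 'r) gl_alg) \<Rightarrow> bool" where
  "pi_connection s \<pi> \<delta> \<Delta> \<longleftrightarrow> (\<forall>i.
     higher_pi_derivation CARD('p) s (gl_const \<pi>) (gl_const (p_over_pi CARD('p) \<pi>)) (\<Delta> i) \<and>
     (\<forall>a. \<Delta> i (gl_const a) = gl_const (\<delta> i a)))"

definition conn_frob ::
  "nat \<Rightarrow> 'r::idom \<Rightarrow> ('n::finite \<Rightarrow> ('p::finite, 'n, 'r) gl_alg \<Rightarrow> ('p, 'n, 'r) gl_alg) \<Rightarrow>
   'n \<Rightarrow> ('p, 'n, 'r) gl_alg \<Rightarrow> ('p, 'n, 'r) gl_alg" where
  "conn_frob s \<pi> \<Delta> i = frob CARD('p) s (gl_const \<pi>) (\<Delta> i)"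

definition Gamma_mat ::
  "nat \<Rightarrow> ('n::finite \<Rightarrow> ('p::finite, 'n, 'r::idom) gl_alg \<Rightarrow> ('p, 'n, 'r) gl_alg) \<Rightarrow>
   'n \<Rightarrow> ('p, 'n, 'r) gl_alg ^ 'n ^ 'n" where
  "Gamma_mat s \<Delta> i = transpose
     (matrix_inv (entrywise_power gl_x (CARD('p) ^ s)) ** map_matrix (\<Delta> i) gl_x)"

text \<open>\<open>Gamma2 s \<Delta> k i j\<close> has the upper index \<open>k\<close> first.\<close>

definition Gamma2 ::
  "nat \<Rightarrow> ('n::finite \<Rightarrow> ('p::finite, 'n, 'r::idom) gl_alg \<Rightarrow> ('p, 'n, 'r) gl_alg) \<Rightarrow>
   'n \<Rightarrow> 'n \<Rightarrow> 'n \<Rightarrow> ('p, 'n, 'r) gl_alg" where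
  "Gamma2 s \<Delta> k i j = Gamma_mat s \<Delta> i $ j $ k"

definition Gamma1 ::
  "nat \<Rightarrow> 'r ^ 'n ^ 'n \<Rightarrow> ('n::finite \<Rightarrow> ('p::finite, 'n, 'r::idom) gl_alg \<Rightarrow> ('p, 'n, 'r) gl_alg) \<Rightarrow>
   'n \<Rightarrow> 'n \<Rightarrow> 'n \<Rightarrow> ('p, 'n, 'r) gl_alg" where
  "Gamma1 s q \<Delta> i j k = (\<Sum>m\<in>UNIV. Gamma2 s \<Delta> m i j * gl_const (q $ m $ k) ^ (CARD('p) ^ s))"

definition Lambda_mat ::
  "nat \<Rightarrow> 'r::idom \<Rightarrow> ('n::finite \<Rightarrow> ('p::finite, 'n, 'r) gl_alg \<Rightarrow> ('p, 'n, 'r) gl_alg) \<Rightarrow>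
   'n \<Rightarrow> ('p, 'n, 'r) gl_alg ^ 'n ^ 'n" where
  "Lambda_mat s \<pi> \<Delta> i =
     matrix_inv (entrywise_power gl_x (CARD('p) ^ s)) ** map_matrix (conn_frob s \<pi> \<Delta> i) gl_x"

definition phi0 ::
  "nat \<Rightarrow> 'r::idom \<Rightarrow> ('r \<Rightarrow> 'r) \<Rightarrow> ('p::finite, 'n::finite, 'r) gl_alg \<Rightarrow> ('p, 'n, 'r) gl_alg" where
  "phi0 s \<pi> d = gl_subst (\<lambda>a. gl_const (frob CARD('p) s \<pi> d a))
     (entrywise_power gl_x (CARD('p) ^ s))"

definition H_map ::
  "'r::idom ^ 'n ^ 'n \<Rightarrow> ('p::finite, 'n::finite, 'r) gl_alg \<Rightarrow> ('p, 'n, 'r) gl_alg" where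
  "H_map q = gl_subst gl_const (transpose gl_x ** map_matrix gl_const q ** gl_x)"

definition metric_conn ::
  "nat \<Rightarrow> 'r::idom \<Rightarrow> ('n::finite \<Rightarrow> 'r \<Rightarrow> 'r) \<Rightarrow> 'r ^ 'n ^ 'n \<Rightarrow>
   ('n \<Rightarrow> ('p::finite, 'n, 'r) gl_alg \<Rightarrow> ('p, 'n, 'r) gl_alg) \<Rightarrow> bool" where
  "metric_conn s \<pi> \<delta> q \<Delta> \<longleftrightarrow> (\<forall>i. conn_frob s \<pi> \<Delta> i \<circ> H_map q = H_map q \<circ> phi0 s \<pi> (\<delta> i))"

definition torsion_symbol ::
  "('n::finite \<Rightarrow> ('p::finite, 'n, 'r::idom) y_alg ^ 'n ^ 'n) \<Rightarrow> bool" where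
  "torsion_symbol L \<longleftrightarrow> (\<forall>k i j. L k $ i $ j + L k $ j $ i = 0)"

definition symmetric_conn ::
  "nat \<Rightarrow> 'r::idom \<Rightarrow> ('n::finite \<Rightarrow> ('p::finite, 'n, 'r) y_alg ^ 'n ^ 'n) \<Rightarrow>
   ('n \<Rightarrow> ('p, 'n, 'r) gl_alg \<Rightarrow> ('p, 'n, 'r) gl_alg) \<Rightarrow> bool" where
  "symmetric_conn s \<pi> L \<Delta> \<longleftrightarrow> (\<forall>i j k.
     Gamma2 s \<Delta> k i j - Gamma2 s \<Delta> k j i = y_subst gl_const (Lambda_mat s \<pi> \<Delta>) (L k $ i $ j))"

text \<open>\<open>L2_at_1 L k i j\<close> and \<open>L1_at_1 s q L i j k\<close> are the values at \<open>y\<^sub>1 = \<dots> = y\<^sub>n = 1\<close>, in \<open>R[\<pi>]\<close>,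
  of the torsion symbols of the second and of the first kind.\<close>

definition L2_at_1 ::
  "('n::finite \<Rightarrow> ('p::finite, 'n, 'r::idom) y_alg ^ 'n ^ 'n) \<Rightarrow> 'n \<Rightarrow> 'n \<Rightarrow> 'n \<Rightarrow> 'r" where
  "L2_at_1 L k i j = y_subst (\<lambda>a. a) (\<lambda>_. mat 1) (L k $ i $ j)"

definition L1_at_1 ::
  "nat \<Rightarrow> 'r ^ 'n ^ 'n \<Rightarrow> ('n::finite \<Rightarrow> ('p::finite, 'n, 'r::idom) y_alg ^ 'n ^ 'n) \<Rightarrow>
   'n \<Rightarrow> 'n \<Rightarrow> 'n \<Rightarrow> 'r" where
  "L1_at_1 s q L i j k = (\<Sum>m\<in>UNIV. L2_at_1 L m i j * (q $ m $ k) ^ (CARD('p) ^ s))"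

definition x_minus_1_entries :: "('p::finite, 'n::finite, 'r::idom) gl_alg set" where
  "x_minus_1_entries = {(gl_x - mat 1) $ i $ j | i j. True}"

text \<open>The ideal generated by \<open>c\<close> and by the ideal \<open>\<P>\<close>; for \<open>c = \<pi>\<close> this is \<open>\<M>\<close>.\<close>

definition ideal_with_P :: "'r::idom \<Rightarrow> ('p::finite, 'n::finite, 'r) gl_alg set" where
  "ideal_with_P c = gen_ideal (insert (gl_const c) x_minus_1_entries)"

definition levi_civita ::
  "nat \<Rightarrow> 'r::idom \<Rightarrow> ('n::finite \<Rightarrow> 'r \<Rightarrow> 'r) \<Rightarrow> 'r ^ 'n ^ 'n \<Rightarrow>
   ('n \<Rightarrow> ('p::finite, 'n, 'r) y_alg ^ 'n ^ 'n) \<Rightarrow>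
   ('n \<Rightarrow> ('p, 'n, 'r) gl_alg \<Rightarrow> ('p, 'n, 'r) gl_alg) \<Rightarrow> bool" where
  "levi_civita s \<pi> \<delta> q L \<Delta> \<longleftrightarrow>
     pi_connection s \<pi> \<delta> \<Delta> \<and> metric_conn s \<pi> \<delta> q \<Delta> \<and> symmetric_conn s \<pi> L \<Delta>"

end

theory Submission
  imports Defs
begin

text \<open>
  A \<open>\<pi>\<close>-connection is determined by the matrices \<open>G\<^sub>i = \<Gamma>\<^sub>i\<^sup>t\<close>, and these can be prescribed
  arbitrarily: since \<open>\<A>\<close> is \<open>p\<close>-adically complete and \<open>\<pi>\<close>-torsion free, a Frobenius lift is
  determined (with \<open>N = p\<^sup>s\<close>) by \<open>x \<mapsto> x\<^bsup>(N)\<^esup> (1 + \<pi> G\<^sub>i)\<close>. After division by \<open>\<pi>\<close> the metric condition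
  fixes the symmetric part of \<open>Z\<^sub>i\<^sub>j\<^sub>k = (G\<^sub>i\<^sup>t B)\<^sub>j\<^sub>k\<close> in \<open>j, k\<close> and the symmetry condition its
  antisymmetric part in \<open>i, j\<close>, both up to terms that depend on \<open>G\<close> only through \<open>\<pi> G\<close>. Solving
  for \<open>Z\<close> as for the classical Levi-Civita connection turns the two conditions into a fixed point
  equation for a \<open>\<pi>\<close>-adic contraction. The congruences follow by evaluating this equation at
  \<open>x = 1\<close>.

  The contraction argument needs that \<open>R[\<pi>]\<close> is \<open>p\<close>-adically complete and that \<open>\<pi>\<close> divides \<open>p\<close>
  and \<open>p\<close> divides a power of \<open>\<pi>\<close>. This follows from the description of \<open>R\<close> as the closure of the
  ring generated by the Teichmueller representatives, i.e. by the \<open>z\<close> with \<open>z\<^sup>q = z\<close> for some power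
  \<open>q\<close> of \<open>p\<close>: expansions with Teichmueller digits show that the integers of the given extension lie
  in the \<open>R\<close>-span of \<open>1, \<pi>, \<dots>, \<pi>\<^sup>e\<^sup>-\<^sup>1\<close>.
\<close>

section \<open>Powers modulo a prime\<close>

text \<open>The obstacle is that both conditions are nonlinear in \<open>G\<close>: the metric
  equation is quadratic, and the torsion term is an arbitrary p-adically convergent series in
  \<Lambda>. A change of \<open>G\<close> modulo \<pi>^k changes \<Lambda>, and hence the torsion
  term, only modulo \<pi>^(k+1). The metric equation can be divided by \<pi> because a Frobenius
  lift is the N-th power map modulo \<pi>, so that its two sides agree modulo \<pi> for every
  \<open>G\<close>; after the division the quadratic terms still carry a factor \<pi>. The linear
  problem that remains costs a division by 2, a unit as p is odd, and by \<open>B\<close>, which is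
  invertible because the determinant of an entrywise N-th power is the N-th power of the determinant
  modulo p. The same gain of one factor \<pi> raises the exponent step by step in the congruence
  modulo \<pi>^m. The facts on R[\<pi>] rest on two properties of finite-dimensional spaces over
  Q_p: they are closed, and their integers have finitely many residues. The second makes some power
  of Frobenius fix the residue of a given integer, which produces the Teichmueller representatives
  as limits.\<close>

lemma prime_dvd_choose_prime_power:
  assumes "prime p" "0 < k" "k < p ^ s"
  shows "p dvd (p ^ s choose k)"
proof (rule ccontr)
  assume not_dvd: "\<not> p dvd (p ^ s choose k)"
  have "k * (p ^ s choose k) = p ^ s * ((p ^ s - 1) choose (k - 1))"
    using assms times_binomial_minus1_eq[of k "p ^ s"] by simp
  then have "p ^ s dvd k * (p ^ s choose k)" by simp
  moreover have "coprime (p ^ s) (p ^ s choose k)"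
    using assms(1) not_dvd by (simp add: prime_imp_coprime)
  ultimately have "p ^ s dvd k" by (simp add: coprime_dvd_mult_left_iff)
  then show False using assms by (auto dest: dvd_imp_le)
qed

text \<open>The quotients are formed from the integer binomial coefficients, so the identity is
  multiplied by p to make sense in any commutative ring. In this form it expresses the additivity of
  the p^s-th power map modulo p.\<close>

lemma C_poly_eq:
  fixes a b :: "'a::comm_ring_1"
  assumes "prime p"
  shows "of_nat p * C_poly p s a b = a ^ (p ^ s) + b ^ (p ^ s) - (a + b) ^ (p ^ s)"
proof -
  let ?N = "p ^ s"
  let ?f = "\<lambda>k. of_nat (?N choose k) * a ^ k * b ^ (?N - k)"
  have N: "?N > 0" using assms by (simp add: prime_gt_0_nat)
  have "(a + b) ^ ?N = (\<Sum>k\<le>?N. ?f k)" by (rule binomial_ring)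
  also have "{..?N} = insert 0 (insert ?N {0<..<?N})" using N by auto
  also have "(\<Sum>k\<in>\<dots>. ?f k) = b ^ ?N + (a ^ ?N + (\<Sum>k\<in>{0<..<?N}. ?f k))"
    using N by simp
  also have "(\<Sum>k\<in>{0<..<?N}. ?f k) = - (of_nat p * C_poly p s a b)"
    unfolding C_poly_def mult_minus_right minus_minus sum_distrib_left
  proof (rule sum.cong)
    fix k assume "k \<in> {0<..<?N}"
    then have "p dvd (?N choose k)" using assms prime_dvd_choose_prime_power by auto
    then have "(of_nat (?N choose k) :: 'a) = of_nat p * of_nat ((?N choose k) div p)"
      by (metis dvd_mult_div_cancel of_nat_mult)
    then show "?f k = of_nat p * (of_nat ((?N choose k) div p) * a ^ k * b ^ (?N - k))"
      by (simp add: mult.assoc)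
  qed simp
  finally show ?thesis by simp
qed

section \<open>The ambient valued field\<close>

context padic_ambient
begin

abbreviation P :: 'k where "P \<equiv> of_nat p"

lemma p_gt_1: "1 < p" using prime_p by (rule prime_gt_1_nat)

lemma p_nonzero [simp]: "p \<noteq> 0" "0 < p"
  using p_gt_1 by auto

lemma av_0 [simp]: "av 0 = 0" by (simp add: av_eq_0_iff)

lemma av_1 [simp]: "av 1 = 1"
proof -
  have "av 1 * av 1 = av 1" using av_mult[of 1 1] by simp
  then show ?thesis using av_eq_0_iff[of 1] by simp
qed

lemma av_minus [simp]: "av (- x) = av x"
proof -
  have "av (- 1) * av (- 1) = 1" using av_mult[of "- 1" "- 1"] by simp
  then have "(av (- 1))\<^sup>2 = 1" by (simp add: power2_eq_square)
  then have "av (- 1) = 1" using av_nonneg[of "- 1"] by (auto simp: power2_eq_1_iff)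
  then show ?thesis using av_mult[of "- 1" x] by simp
qed

lemma av_diff_commute: "av (x - y) = av (y - x)"
  using av_minus[of "x - y"] by simp

lemma av_diff_le: "av (x - y) \<le> max (av x) (av y)"
  using av_add_le[of x "- y"] by simp

lemma av_add_bound: "av x \<le> c \<Longrightarrow> av y \<le> c \<Longrightarrow> av (x + y) \<le> c"
  using av_add_le[of x y] by simp

lemma av_diff_bound: "av x \<le> c \<Longrightarrow> av y \<le> c \<Longrightarrow> av (x - y) \<le> c"
  using av_diff_le[of x y] by simp

lemma av_add_less: "av x < c \<Longrightarrow> av y < c \<Longrightarrow> av (x + y) < c"
  using av_add_le[of x y] by simp

lemma av_diff_trans_less: "av (x - y) < c \<Longrightarrow> av (y - z) < c \<Longrightarrow> av (x - z) < c"
  using av_add_less[of "x - y" c "y - z"] by simp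

lemma av_diff_trans: "av (x - y) \<le> c \<Longrightarrow> av (y - z) \<le> c \<Longrightarrow> av (x - z) \<le> c"
  using av_add_bound[of "x - y" c "y - z"] by simp

lemma av_near_bound: "av (x - y) \<le> c \<Longrightarrow> av y \<le> c \<Longrightarrow> av x \<le> c"
  using av_add_bound[of "x - y" c y] by simp

lemma av_near_less: "av (x - y) < c \<Longrightarrow> av y < c \<Longrightarrow> av x < c"
  using av_add_less[of "x - y" c y] by simp

text \<open>Ultrametric triangles are isosceles: a perturbation strictly smaller than
  \<open>x\<close> cannot change its absolute value.\<close>

lemma av_eq_of_near: "av (x - y) < av x \<Longrightarrow> av y = av x"
  using av_add_le[of "x - y" y] av_diff_le[of x "x - y"] by (auto simp: max_def split: if_splits)

lemma av_power: "av (x ^ n) = av x ^ n"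
  by (induction n) (auto simp: av_mult)

lemma av_power_le_1: "av x \<le> 1 \<Longrightarrow> av (x ^ n) \<le> 1"
  by (simp add: av_power av_nonneg power_le_one)

lemma av_mult_le_1: "av x \<le> 1 \<Longrightarrow> av y \<le> 1 \<Longrightarrow> av (x * y) \<le> 1"
  by (simp add: av_mult av_nonneg mult_le_one)

lemma av_inverse: "av (inverse x) = inverse (av x)"
proof (cases "x = 0")
  case False
  then have "av x * av (inverse x) = 1" using av_mult[of x "inverse x"] by simp
  then show ?thesis by (metis inverse_unique)
qed simp

lemma av_divide: "av (x / y) = av x / av y"
  by (simp add: divide_inverse av_mult av_inverse)

lemma av_of_nat_le: "av (of_nat n) \<le> 1"
  by (induction n) (auto intro: av_add_bound)

lemma av_of_int_le: "av (of_int n) \<le> 1"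
  by (cases n rule: int_cases2) (use av_of_nat_le in auto)

lemma av_sum_bound: "0 \<le> c \<Longrightarrow> (\<And>i. i \<in> I \<Longrightarrow> av (f i) \<le> c) \<Longrightarrow> av (sum f I) \<le> c"
  by (induction I rule: infinite_finite_induct) (auto intro: av_add_bound)

lemma P_nonzero [simp]: "P \<noteq> 0"
  using p_gt_1 by simp

lemma av_P_power: "av (P ^ n) = (1 / p) ^ n"
  by (simp add: av_power av_p)

lemma inv_p_less_1: "1 / real p < 1" "0 < 1 / real p"
  using p_gt_1 by auto

lemma p_powers_tendsto_0: "(\<lambda>n. (1 / real p) ^ n) \<longlonglongrightarrow> 0"
  using inv_p_less_1 by (intro LIMSEQ_power_zero) simp

lemma small_p_power: "0 < e \<Longrightarrow> \<exists>n. (1 / real p) ^ n < e"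
  using inv_p_less_1 by (intro real_arch_pow_inv)

lemma p_power_bound: "\<exists>n. av (P ^ n * x) \<le> 1"
proof (cases "x = 0")
  case False
  then have "0 < av x" using av_nonneg[of x] av_eq_0_iff[of x] by linarith
  then obtain n where "(1 / real p) ^ n < 1 / av x" using small_p_power[of "1 / av x"] by auto
  then have "av (P ^ n * x) \<le> 1"
    using \<open>0 < av x\<close> unfolding av_mult av_P_power by (simp add: field_simps)
  then show ?thesis ..
qed simp

text \<open>By Bezout some multiple u n differs from 1 by a multiple of p, so it has absolute value
  1; neither factor exceeds 1, so both equal 1.\<close>

lemma av_of_int_prime_to_p:
  assumes "\<not> int p dvd n"
  shows "av (of_int n) = 1"
proof -
  have "coprime n (int p)"
    using assms prime_p by (metis coprime_commute prime_imp_coprime prime_int_nat_transfer prime_nat_int_transfer)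
  then obtain u v where uv: "u * n + v * int p = 1" by (metis bezout_int coprime_imp_gcd_eq_1)
  have "(1::'k) = of_int (u * n + v * int p)" using uv by simp
  then have 1: "(1::'k) - of_int u * of_int n = of_int v * P" by (simp add: algebra_simps)
  have "av (of_int v * P) \<le> 1 * (1 / p)"
    unfolding av_mult av_p by (intro mult_right_mono av_of_int_le) simp
  then have "av (of_int v * P) < 1" using inv_p_less_1(1) by linarith
  then have "av (1 - of_int u * of_int n) < av 1" using 1 by simp
  then have "av (of_int u) * av (of_int n) = 1"
    using av_eq_of_near av_mult by (metis av_1)
  moreover have "av (of_int u) * av (of_int n) \<le> 1 * av (of_int n)"
    by (intro mult_right_mono av_of_int_le av_nonneg)
  ultimately show ?thesis using av_of_int_le[of n] by linarith
qed

subsection \<open>Limits and closed sets\<close>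

definition conv :: "(nat \<Rightarrow> 'k) \<Rightarrow> 'k \<Rightarrow> bool" where
  "conv X l \<longleftrightarrow> (\<lambda>n. av (X n - l)) \<longlonglongrightarrow> 0"

lemma conv_iff: "conv X l \<longleftrightarrow> (\<forall>e>0. \<exists>N. \<forall>n\<ge>N. av (X n - l) < e)"
  by (simp add: conv_def lim_sequentially dist_real_def av_nonneg)

lemma convD: "conv X l \<Longrightarrow> 0 < e \<Longrightarrow> \<exists>N. \<forall>n\<ge>N. av (X n - l) < e"
  by (simp add: conv_iff)

lemma convI_bound: "(\<And>n. av (X n - l) \<le> b n) \<Longrightarrow> b \<longlonglongrightarrow> 0 \<Longrightarrow> conv X l"
  unfolding conv_def by (rule Lim_null_comparison[of _ b]) (auto simp: av_nonneg)

lemma conv_const [simp]: "conv (\<lambda>_. c) c"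
  by (simp add: conv_def)

lemma conv_unique:
  assumes "conv X l" "conv X l'"
  shows "l = l'"
proof (rule ccontr)
  assume "l \<noteq> l'"
  then have "0 < av (l - l')" using av_nonneg[of "l - l'"] av_eq_0_iff[of "l - l'"] by auto
  from convD[OF assms(1) this] convD[OF assms(2) this] obtain N N' where
    *: "\<forall>n\<ge>N. av (X n - l) < av (l - l')" "\<forall>n\<ge>N'. av (X n - l') < av (l - l')"
    by blast
  then have "av (l - l') < av (l - l')"
    using av_diff_trans_less[of l "X (max N N')" "av (l - l')" l'] by (simp add: av_diff_commute)
  then show False by simp
qed

lemma conv_add:
  assumes "conv X l" "conv Y m"
  shows "conv (\<lambda>n. X n + Y n) (l + m)"
proof (rule convI_bound)
  show "(\<lambda>n. av (X n - l) + av (Y n - m)) \<longlonglongrightarrow> 0"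
    using tendsto_add[OF assms[unfolded conv_def]] by simp
  show "av (X n + Y n - (l + m)) \<le> av (X n - l) + av (Y n - m)" for n
    using av_add_le[of "X n - l" "Y n - m"] av_nonneg[of "X n - l"] av_nonneg[of "Y n - m"]
    by (simp add: algebra_simps max_def split: if_splits)
qed

lemma conv_cmult: "conv X l \<Longrightarrow> conv (\<lambda>n. c * X n) (c * l)"
  unfolding conv_def right_diff_distrib[symmetric] av_mult
  using tendsto_mult_left[of "\<lambda>n. av (X n - l)" 0 sequentially "av c"] by simp

lemma conv_cmult_right: "conv X l \<Longrightarrow> conv (\<lambda>n. X n * c) (l * c)"
  using conv_cmult[of X l c] by (simp add: mult.commute)

lemma conv_sum:
  "(\<And>i. i \<in> I \<Longrightarrow> conv (X i) (l i)) \<Longrightarrow> conv (\<lambda>n. \<Sum>i\<in>I. X i n) (\<Sum>i\<in>I. l i)"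
  by (induction I rule: infinite_finite_induct) (auto intro: conv_add)

lemma conv_offset: "conv X l \<Longrightarrow> conv (\<lambda>n. X (n + k)) l"
  unfolding conv_def by (rule LIMSEQ_ignore_initial_segment[of "\<lambda>n. av (X n - l)"])

text \<open>By the ultrametric inequality a difference over many steps is no larger than the largest
  single step, so consecutive differences tending to 0 make the sequence Cauchy.\<close>

lemma conv_exists:
  assumes "(\<lambda>n. av (X (Suc n) - X n)) \<longlonglongrightarrow> 0"
  shows "\<exists>l. conv X l"
  unfolding conv_def
proof (rule av_complete, intro allI impI)
  fix e :: real assume "0 < e"
  then obtain N where N: "\<And>n. n \<ge> N \<Longrightarrow> av (X (Suc n) - X n) < e"
    using assms by (auto simp: lim_sequentially dist_real_def av_nonneg)
  have step: "av (X n - X N) < e" if "n \<ge> N" for n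
    using that
  proof (induction rule: dec_induct)
    case base
    then show ?case using \<open>0 < e\<close> by simp
  next
    case (step n)
    then show ?case using N[of n] av_diff_trans_less[of "X (Suc n)" "X n" e "X N"] by simp
  qed
  have "av (X m - X n) < e" if "m \<ge> N" "n \<ge> N" for m n
    using step[OF that(1)] step[OF that(2)] av_diff_trans_less[of "X m" "X N" e "X n"]
    by (simp add: av_diff_commute)
  then show "\<exists>N. \<forall>m\<ge>N. \<forall>n\<ge>N. av (X m - X n) < e" by blast
qed

definition av_closed :: "'k set \<Rightarrow> bool" where
  "av_closed S \<longleftrightarrow> av_closure av S \<subseteq> S"

lemma closure_subset: "S \<subseteq> av_closure av S"
  by (force simp: av_closure_def)

lemma closure_mono: "S \<subseteq> T \<Longrightarrow> av_closure av S \<subseteq> av_closure av T"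
  by (force simp: av_closure_def)

lemma closed_closure: "av_closed (av_closure av S)"
  unfolding av_closed_def
proof
  fix x assume x: "x \<in> av_closure av (av_closure av S)"
  show "x \<in> av_closure av S" unfolding av_closure_def
  proof (clarify)
    fix e :: real assume "0 < e"
    then obtain y where "y \<in> av_closure av S" "av (x - y) < e" using x by (auto simp: av_closure_def)
    then obtain z where "z \<in> S" "av (y - z) < e" using \<open>0 < e\<close> by (auto simp: av_closure_def)
    then show "\<exists>y\<in>S. av (x - y) < e"
      using \<open>av (x - y) < e\<close> av_diff_trans_less by blast
  qed
qed

lemma closedI: "(\<And>x. (\<And>e. 0 < e \<Longrightarrow> \<exists>y\<in>S. av (x - y) < e) \<Longrightarrow> x \<in> S) \<Longrightarrow> av_closed S"
  by (auto simp: av_closed_def av_closure_def)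

lemma closedD: "av_closed S \<Longrightarrow> (\<And>e. 0 < e \<Longrightarrow> \<exists>y\<in>S. av (x - y) < e) \<Longrightarrow> x \<in> S"
  by (auto simp: av_closed_def av_closure_def)

lemma closed_conv:
  assumes "av_closed S" "conv X l" "\<And>n. X n \<in> S"
  shows "l \<in> S"
proof (rule closedD[OF assms(1)])
  fix e :: real assume "0 < e"
  then show "\<exists>y\<in>S. av (l - y) < e"
    using convD[OF assms(2)] assms(3) by (metis av_diff_commute order_refl)
qed

text \<open>The geometric rate later bounds the consecutive differences of the approximants, and
  with them their coordinates.\<close>

lemma closure_conv:
  assumes "x \<in> av_closure av S"
  shows "\<exists>X. conv X x \<and> (\<forall>n. X n \<in> S) \<and> (\<forall>n. av (x - X n) < (1 / real p) ^ n)"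
proof -
  have "\<forall>n. \<exists>y\<in>S. av (x - y) < (1 / real p) ^ n"
    using assms inv_p_less_1 by (auto simp: av_closure_def)
  then obtain X where X: "\<And>n. X n \<in> S" "\<And>n. av (x - X n) < (1 / real p) ^ n" by metis
  then have "conv X x"
    by (intro convI_bound[OF _ p_powers_tendsto_0]) (simp add: av_diff_commute less_imp_le)
  then show ?thesis using X by blast
qed

subsection \<open>Subrings and subfields\<close>

definition subring :: "'k set \<Rightarrow> bool" where
  "subring S \<longleftrightarrow> 1 \<in> S \<and> (\<forall>x\<in>S. \<forall>y\<in>S. x - y \<in> S \<and> x * y \<in> S)"

lemma subringD:
  assumes "subring S"
  shows "1 \<in> S" "0 \<in> S" "x \<in> S \<Longrightarrow> y \<in> S \<Longrightarrow> x - y \<in> S" "x \<in> S \<Longrightarrow> y \<in> S \<Longrightarrow> x * y \<in> S"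
    "x \<in> S \<Longrightarrow> - x \<in> S" "x \<in> S \<Longrightarrow> y \<in> S \<Longrightarrow> x + y \<in> S"
proof -
  show 0: "0 \<in> S" using assms unfolding subring_def by (metis diff_self)
  show m: "- x \<in> S" if "x \<in> S" for x using assms 0 that unfolding subring_def by (metis diff_0)
  show "x + y \<in> S" if "x \<in> S" "y \<in> S"
    using assms m[OF that(2)] that(1) unfolding subring_def by (metis diff_minus_eq_add)
qed (use assms in \<open>auto simp: subring_def\<close>)

lemma subring_power: "subring S \<Longrightarrow> x \<in> S \<Longrightarrow> x ^ n \<in> S"
  by (induction n) (auto intro: subringD)

lemma subring_of_nat: "subring S \<Longrightarrow> of_nat n \<in> S"
  by (induction n) (auto intro: subringD)

lemma subring_of_int: "subring S \<Longrightarrow> of_int n \<in> S"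
  by (cases n rule: int_cases2) (auto intro: subringD subring_of_nat)

lemma subring_sum: "subring S \<Longrightarrow> (\<And>i. i \<in> I \<Longrightarrow> f i \<in> S) \<Longrightarrow> sum f I \<in> S"
  by (induction I rule: infinite_finite_induct) (auto intro: subringD)

lemma subring_C_poly: "subring S \<Longrightarrow> x \<in> S \<Longrightarrow> y \<in> S \<Longrightarrow> C_poly p s x y \<in> S"
  unfolding C_poly_def by (intro subringD(5) subring_sum subringD(4) subring_of_nat subring_power)

lemma subfield_iff: "is_subfield K \<longleftrightarrow> subring K \<and> (\<forall>x\<in>K. inverse x \<in> K)"
proof
  assume "is_subfield K"
  then show "subring K \<and> (\<forall>x\<in>K. inverse x \<in> K)"
    unfolding is_subfield_def subring_def by (metis inverse_eq_divide)
next
  assume "subring K \<and> (\<forall>x\<in>K. inverse x \<in> K)"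
  then show "is_subfield K" unfolding is_subfield_def subring_def by (simp add: divide_inverse)
qed

lemma subfield_Rats: "is_subfield (K::'k set) \<Longrightarrow> \<rat> \<subseteq> K"
proof
  fix x :: 'k assume "is_subfield K" "x \<in> \<rat>"
  then obtain a b where "x = of_int a / of_int b" by (metis Rats_cases')
  then show "x \<in> K" using \<open>is_subfield K\<close> subring_of_int
    by (metis is_subfield_def subfield_iff)
qed

lemma subring_unit_ball: "subring {x. av x \<le> 1}"
  by (auto simp: subring_def intro: av_diff_bound av_mult_le_1)

lemma subring_Int: "subring S \<Longrightarrow> subring T \<Longrightarrow> subring (S \<inter> T)"
  by (auto simp: subring_def)

lemma subring_integers: "is_subfield K \<Longrightarrow> subring (integers av K)"
  using subring_Int[OF _ subring_unit_ball, of K] by (simp add: subfield_iff integers_def Int_def)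

lemma closed_unit_ball: "av_closed {x. av x \<le> 1}"
proof (rule closedI)
  fix x assume "\<And>e. 0 < e \<Longrightarrow> \<exists>y\<in>{x. av x \<le> 1}. av (x - y) < e"
  then obtain y where "av y \<le> 1" "av (x - y) < 1" by (metis mem_Collect_eq zero_less_one)
  then show "x \<in> {x. av x \<le> 1}" using av_near_bound[of x y 1] by simp
qed

lemma conv_bounded:
  assumes "conv X l"
  shows "\<exists>C>0. \<forall>n. av (X n) \<le> C"
proof -
  have "Bseq (\<lambda>n. av (X n - l))"
    using assms unfolding conv_def by (intro convergent_imp_Bseq) (auto simp: convergent_def)
  then obtain C where C: "0 < C" "\<And>n. av (X n - l) \<le> C" by (auto simp: Bseq_def av_nonneg)
  have "av (X n) \<le> C + av l" for n
    using av_near_bound[of "X n" l "C + av l"] C(2)[of n] C(1) av_nonneg[of l] by simp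
  then show ?thesis using C(1) av_nonneg[of l] by (intro exI[of _ "C + av l"]) auto
qed

lemma conv_mult:
  assumes "conv X l" "conv Y m"
  shows "conv (\<lambda>n. X n * Y n) (l * m)"
proof -
  obtain C where C: "C > 0" "\<And>n. av (X n) \<le> C" using conv_bounded[OF assms(1)] by blast
  show ?thesis
  proof (rule convI_bound)
    show "(\<lambda>n. C * av (Y n - m) + av m * av (X n - l)) \<longlonglongrightarrow> 0"
      using tendsto_add[OF tendsto_mult_left[OF assms(2)[unfolded conv_def], of C]
        tendsto_mult_left[OF assms(1)[unfolded conv_def], of "av m"]] by simp
    fix n
    have "X n * Y n - l * m = X n * (Y n - m) + m * (X n - l)" by (simp add: algebra_simps)
    moreover have "av (X n * (Y n - m)) \<le> C * av (Y n - m)"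
      unfolding av_mult by (intro mult_right_mono C av_nonneg)
    moreover have "av (u + v) \<le> av u + av v" for u v
      using av_add_le[of u v] av_nonneg[of u] av_nonneg[of v] by (simp add: max_def split: if_splits)
    ultimately show "av (X n * Y n - l * m) \<le> C * av (Y n - m) + av m * av (X n - l)"
      by (smt (verit) av_mult)
  qed
qed

lemma conv_power: "conv X l \<Longrightarrow> conv (\<lambda>n. X n ^ k) (l ^ k)"
  by (induction k) (auto intro: conv_mult)

lemma conv_uminus: "conv X l \<Longrightarrow> conv (\<lambda>n. - X n) (- l)"
  using conv_cmult[of X l "- 1"] by simp

lemma conv_diff: "conv X l \<Longrightarrow> conv Y m \<Longrightarrow> conv (\<lambda>n. X n - Y n) (l - m)"
  using conv_add[of X l "\<lambda>n. - Y n" "- m"] conv_uminus by simp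

lemma closureI_conv: "conv X l \<Longrightarrow> (\<And>n. X n \<in> S) \<Longrightarrow> l \<in> av_closure av S"
  using closed_conv[OF closed_closure] closure_subset by blast

lemma subring_closure:
  assumes "subring S"
  shows "subring (av_closure av S)"
  unfolding subring_def
proof (intro conjI ballI)
  show "1 \<in> av_closure av S" using assms closure_subset by (auto simp: subring_def)
  fix x y assume "x \<in> av_closure av S" "y \<in> av_closure av S"
  then obtain X Y where XY: "conv X x" "conv Y y" "\<And>n. X n \<in> S" "\<And>n. Y n \<in> S"
    using closure_conv by metis
  show "x - y \<in> av_closure av S"
    by (rule closureI_conv[OF conv_diff[OF XY(1,2)]]) (intro subringD[OF assms] XY)
  show "x * y \<in> av_closure av S"
    by (rule closureI_conv[OF conv_mult[OF XY(1,2)]]) (intro subringD[OF assms] XY)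
qed

lemma conv_inverse:
  assumes "conv X l" "l \<noteq> 0"
  shows "conv (\<lambda>n. inverse (X n)) (inverse l)"
  unfolding conv_iff
proof (intro allI impI)
  fix e :: real assume "0 < e"
  have l: "0 < av l" using assms(2) av_nonneg[of l] av_eq_0_iff[of l] by linarith
  then have "0 < min (av l) (e * av l * av l)" using \<open>0 < e\<close> by simp
  then obtain N where N: "\<forall>n\<ge>N. av (X n - l) < min (av l) (e * av l * av l)"
    using convD[OF assms(1)] by blast
  have "av (inverse (X n) - inverse l) < e" if "n \<ge> N" for n
  proof -
    have *: "av (l - X n) < av l" "av (X n - l) < e * av l * av l"
      using N that by (auto simp: av_diff_commute)
    then have X: "av (X n) = av l" using av_eq_of_near by blast
    then have "X n \<noteq> 0" using l by auto
    then have "inverse (X n) - inverse l = (l - X n) / (X n * l)"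
      using assms(2) by (simp add: field_simps)
    then have "av (inverse (X n) - inverse l) = av (X n - l) / (av l * av l)"
      using X by (simp add: av_divide av_mult av_diff_commute)
    also have "\<dots> < e" using *(2) l by (simp add: pos_divide_less_eq mult.assoc)
    finally show ?thesis .
  qed
  then show "\<exists>N. \<forall>n\<ge>N. av (inverse (X n) - inverse l) < e" by blast
qed

lemma subfield_closure:
  assumes "is_subfield S"
  shows "is_subfield (av_closure av S)"
  unfolding subfield_iff
proof (intro conjI ballI)
  show "subring (av_closure av S)" using assms subring_closure by (simp add: subfield_iff)
  fix x assume x: "x \<in> av_closure av S"
  then obtain X where X: "conv X x" "\<And>n. X n \<in> S" using closure_conv by metis
  show "inverse x \<in> av_closure av S"
  proof (cases "x = 0")
    case False
    show ?thesis
      by (rule closureI_conv[OF conv_inverse[OF X(1) False]]) (use assms X in \<open>auto simp: subfield_iff\<close>)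
  qed (use x in simp)
qed

lemma subfield_Q_p: "is_subfield (Q_p av)" and closed_Q_p: "av_closed (Q_p av)"
proof -
  have "is_subfield (\<rat> :: 'k set)" by (simp add: is_subfield_def)
  then show "is_subfield (Q_p av)" unfolding Q_p_def by (rule subfield_closure)
  show "av_closed (Q_p av)" unfolding Q_p_def by (rule closed_closure)
qed

subsection \<open>Finite-dimensional spaces over the \<open>p\<close>-adic numbers\<close>

definition Q_p_span :: "'k set \<Rightarrow> 'k set" where
  "Q_p_span B = {\<Sum>b\<in>B. c b * b | c. \<forall>b\<in>B. c b \<in> Q_p av}"

lemmas Q_p_ring = subringD[OF subfield_Q_p[unfolded subfield_iff, THEN conjunct1]]

lemma Q_p_inverse: "x \<in> Q_p av \<Longrightarrow> inverse x \<in> Q_p av"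
  using subfield_Q_p by (simp add: subfield_iff)

lemma Q_p_spanI: "(\<And>b. b \<in> B \<Longrightarrow> c b \<in> Q_p av) \<Longrightarrow> (\<Sum>b\<in>B. c b * b) \<in> Q_p_span B"
  by (auto simp: Q_p_span_def)

lemma Q_p_span_diff:
  assumes "v \<in> Q_p_span B" "w \<in> Q_p_span B"
  shows "v - w \<in> Q_p_span B"
proof -
  from assms obtain c d where "v = (\<Sum>b\<in>B. c b * b)" "w = (\<Sum>b\<in>B. d b * b)"
    "\<forall>b\<in>B. c b \<in> Q_p av" "\<forall>b\<in>B. d b \<in> Q_p av" by (auto simp: Q_p_span_def)
  then have "v - w = (\<Sum>b\<in>B. (c b - d b) * b)" "\<And>b. b \<in> B \<Longrightarrow> c b - d b \<in> Q_p av"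
    by (auto simp: left_diff_distrib sum_subtractf intro: Q_p_ring(3))
  then show ?thesis using Q_p_spanI[of B "\<lambda>b. c b - d b"] by simp
qed

lemma Q_p_span_smult:
  assumes "v \<in> Q_p_span B" "a \<in> Q_p av"
  shows "a * v \<in> Q_p_span B"
proof -
  from assms obtain c where "v = (\<Sum>b\<in>B. c b * b)" "\<forall>b\<in>B. c b \<in> Q_p av"
    by (auto simp: Q_p_span_def)
  then have "a * v = (\<Sum>b\<in>B. (a * c b) * b)" "\<And>b. b \<in> B \<Longrightarrow> a * c b \<in> Q_p av"
    using assms(2) by (auto simp: sum_distrib_left mult.assoc intro: Q_p_ring(4))
  then show ?thesis using Q_p_spanI[of B "\<lambda>b. a * c b"] by simp
qed

lemma Q_p_span_0: "0 \<in> Q_p_span B"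
  using Q_p_spanI[of B "\<lambda>_. 0"] Q_p_ring(2) by simp

lemma Q_p_span_uminus: "v \<in> Q_p_span B \<Longrightarrow> - v \<in> Q_p_span B"
  using Q_p_span_diff[OF Q_p_span_0] by fastforce

lemma Q_p_span_add: "v \<in> Q_p_span B \<Longrightarrow> w \<in> Q_p_span B \<Longrightarrow> v + w \<in> Q_p_span B"
  using Q_p_span_diff[of v B "- w"] Q_p_span_uminus by simp

lemma Q_p_span_sum: "(\<And>i. i \<in> I \<Longrightarrow> f i \<in> Q_p_span B) \<Longrightarrow> sum f I \<in> Q_p_span B"
  by (induction I rule: infinite_finite_induct) (auto intro: Q_p_span_0 Q_p_span_add)

lemma Q_p_span_base:
  assumes "finite B" "b \<in> B"
  shows "b \<in> Q_p_span B"
proof -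
  have "(\<Sum>a\<in>B. (if a = b then 1 else 0) * a) = (\<Sum>a\<in>B. if a = b then a else 0)"
    by (rule sum.cong) auto
  also have "\<dots> = b" using assms by simp
  finally show ?thesis
    using Q_p_spanI[of B "\<lambda>a. if a = b then 1 else 0"] Q_p_ring(1,2) by simp
qed

section \<open>Bounded coordinates and closedness of finite-dimensional spaces\<close>

text \<open>A quantitative substitute for the equivalence of norms. Only some representation has to
  be bounded, so \<open>B\<close> may be linearly dependent; this keeps the induction on
  \<open>B\<close> free of a choice of basis.\<close>

definition bounded_coeffs :: "'k set \<Rightarrow> real \<Rightarrow> bool" where
  "bounded_coeffs B C \<longleftrightarrow> (\<forall>v\<in>Q_p_span B. \<exists>c. v = (\<Sum>b\<in>B. c b * b) \<and>
     (\<forall>b\<in>B. c b \<in> Q_p av \<and> av (c b) \<le> C * av v))"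

text \<open>A limit of points of the span is written as a telescoping series. The differences have
  coordinates of size at most C p^(-n), which can be summed in the closed field
  \<open>Q_p av\<close>.\<close>

lemma closed_Q_p_span_if_bounded_coeffs:
  assumes "bounded_coeffs B C" "0 < C"
  shows "av_closed (Q_p_span B)"
  unfolding av_closed_def
proof
  fix x assume "x \<in> av_closure av (Q_p_span B)"
  then obtain X where X: "conv X x" "\<And>n. X n \<in> Q_p_span B" "\<And>n. av (x - X n) < (1 / real p) ^ n"
    using closure_conv by metis
  have D: "X (Suc n) - X n \<in> Q_p_span B" for n by (intro Q_p_span_diff X)
  have D_av: "av (X (Suc n) - X n) \<le> (1 / real p) ^ n" for n
  proof -
    have "(1 / real p) ^ Suc n \<le> (1 / real p) ^ n"
      using inv_p_less_1 by (intro power_decreasing) auto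
    then have "av (x - X (Suc n)) \<le> (1 / real p) ^ n" "av (x - X n) \<le> (1 / real p) ^ n"
      using X(3)[of n] X(3)[of "Suc n"] by linarith+
    then show ?thesis
      using av_diff_trans[of "X (Suc n)" x _ "X n"] by (simp add: av_diff_commute)
  qed
  obtain c where c: "\<And>n. X (Suc n) - X n = (\<Sum>b\<in>B. c n b * b)"
    "\<And>n b. b \<in> B \<Longrightarrow> c n b \<in> Q_p av"
    "\<And>n b. b \<in> B \<Longrightarrow> av (c n b) \<le> C * av (X (Suc n) - X n)"
  proof -
    have "\<forall>n. \<exists>c. X (Suc n) - X n = (\<Sum>b\<in>B. c b * b) \<and>
        (\<forall>b\<in>B. c b \<in> Q_p av \<and> av (c b) \<le> C * av (X (Suc n) - X n))"
      using assms(1) D unfolding bounded_coeffs_def by blast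
    from choice[OF this] show ?thesis using that by blast
  qed
  obtain c0 where c0: "X 0 = (\<Sum>b\<in>B. c0 b * b)" "\<And>b. b \<in> B \<Longrightarrow> c0 b \<in> Q_p av"
    using X(2)[of 0] by (auto simp: Q_p_span_def)
  \<comment> \<open>Coordinates of \<open>X n\<close> are built up from those of the differences:
    representations need not be unique, so coordinates chosen separately for each \<open>X n\<close>
    need not converge.\<close>
  define d where "d n b = c0 b + (\<Sum>k<n. c k b)" for n b
  have d_Q: "d n b \<in> Q_p av" if "b \<in> B" for n b
    unfolding d_def by (induction n) (use that c c0 in \<open>auto intro: Q_p_ring simp: add.assoc[symmetric]\<close>)
  have X_d: "X n = (\<Sum>b\<in>B. d n b * b)" for n
  proof (induction n)
    case (Suc n)
    have "X (Suc n) = X n + (\<Sum>b\<in>B. c n b * b)" using c(1)[of n] by (simp add: algebra_simps)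
    then show ?case unfolding Suc by (simp add: d_def distrib_right sum.distrib add.assoc)
  qed (simp add: c0 d_def)
  have "\<exists>l. conv (\<lambda>n. d n b) l" if "b \<in> B" for b
  proof (rule conv_exists)
    show "(\<lambda>n. av (d (Suc n) b - d n b)) \<longlonglongrightarrow> 0"
    proof (rule Lim_null_comparison)
      show "(\<lambda>n. C * (1 / real p) ^ n) \<longlonglongrightarrow> 0"
        using tendsto_mult_left[OF p_powers_tendsto_0, of C] by simp
      have "av (c n b) \<le> C * (1 / real p) ^ n" for n
        using c(3)[OF that, of n] mult_left_mono[OF D_av[of n], of C] assms(2) by linarith
      then show "\<forall>\<^sub>F n in sequentially. norm (av (d (Suc n) b - d n b)) \<le> C * (1 / real p) ^ n"
        by (simp add: d_def av_nonneg)
    qed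
  qed
  then obtain l where l: "\<And>b. b \<in> B \<Longrightarrow> conv (\<lambda>n. d n b) (l b)" by metis
  have "conv X (\<Sum>b\<in>B. l b * b)"
    unfolding X_d by (rule conv_sum, rule conv_cmult_right, rule l)
  then have "x = (\<Sum>b\<in>B. l b * b)" using X(1) conv_unique by blast
  moreover have "l b \<in> Q_p av" if "b \<in> B" for b
    by (rule closed_conv[OF closed_Q_p l[OF that] d_Q[OF that]])
  ultimately show "x \<in> Q_p_span B" using Q_p_spanI by blast
qed

lemma Q_p_span_insert:
  assumes "finite B" "b \<notin> B"
  shows "Q_p_span (insert b B) = {c * b + w | c w. c \<in> Q_p av \<and> w \<in> Q_p_span B}"
proof (intro equalityI subsetI)
  fix v assume "v \<in> Q_p_span (insert b B)"
  then obtain c where "v = (\<Sum>a\<in>insert b B. c a * a)" "\<forall>a\<in>insert b B. c a \<in> Q_p av"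
    by (auto simp: Q_p_span_def)
  then show "v \<in> {c * b + w | c w. c \<in> Q_p av \<and> w \<in> Q_p_span B}"
    using assms Q_p_spanI[of B c] by auto
next
  fix v assume "v \<in> {c * b + w | c w. c \<in> Q_p av \<and> w \<in> Q_p_span B}"
  then obtain c d where c: "c \<in> Q_p av" "\<forall>a\<in>B. d a \<in> Q_p av" "v = c * b + (\<Sum>a\<in>B. d a * a)"
    by (auto simp: Q_p_span_def)
  have "v = (\<Sum>a\<in>insert b B. (d(b := c)) a * a)"
    using assms c(3) by (auto intro!: sum.cong)
  moreover have "(\<Sum>a\<in>insert b B. (d(b := c)) a * a) \<in> Q_p_span (insert b B)"
    by (rule Q_p_spanI) (use c in auto)
  ultimately show "v \<in> Q_p_span (insert b B)" by simp
qed

text \<open>Closedness and bounded coordinates alternate: the span of \<open>B\<close> is closed by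
  the previous lemma, so a vector outside it has positive distance from it, and this distance bounds
  the coefficient of the new vector.\<close>

lemma bounded_coeffs_exists: "finite B \<Longrightarrow> \<exists>C>0. bounded_coeffs B C"
proof (induction B rule: finite_induct)
  case empty
  then show ?case by (auto simp: bounded_coeffs_def Q_p_span_def intro: exI[of _ 1])
next
  case (insert b B)
  then obtain C where C: "0 < C" "bounded_coeffs B C" by blast
  note span_insert = Q_p_span_insert[OF insert.hyps]
  have ext: "(\<Sum>a\<in>insert b B. (d(b := c)) a * a) = c * b + (\<Sum>a\<in>B. d a * a)" for d c
    using insert.hyps by (auto intro!: sum.cong)
  show ?case
  proof (cases "b \<in> Q_p_span B")
    case True
    \<comment> \<open>A vector already in the span gets the coefficient 0, and the old constant
      still works.\<close>
    have "bounded_coeffs (insert b B) C"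
      unfolding bounded_coeffs_def
    proof
      fix v assume "v \<in> Q_p_span (insert b B)"
      then have "v \<in> Q_p_span B"
        unfolding span_insert using True Q_p_span_smult Q_p_span_add by blast
      then obtain d where d: "v = (\<Sum>a\<in>B. d a * a)"
        "\<And>a. a \<in> B \<Longrightarrow> d a \<in> Q_p av \<and> av (d a) \<le> C * av v"
        using C(2) unfolding bounded_coeffs_def by blast
      show "\<exists>c. v = (\<Sum>b\<in>insert b B. c b * b) \<and>
          (\<forall>b\<in>insert b B. c b \<in> Q_p av \<and> av (c b) \<le> C * av v)"
        by (rule exI[of _ "d(b := 0)"], unfold ext)
          (use d C(1) Q_p_ring(2) in \<open>auto simp: av_nonneg\<close>)
    qed
    then show ?thesis using C(1) by blast
  next
    case False
    then obtain e where e: "0 < e" "\<And>w. w \<in> Q_p_span B \<Longrightarrow> e \<le> av (b - w)"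
      using closedD[OF closed_Q_p_span_if_bounded_coeffs[OF C(2,1)], of b] by (meson not_le)
    \<comment> \<open>The first summand bounds the coefficient of \<open>b\<close>, the second the
      coefficients of the remainder \<open>w\<close>, whose absolute value is at most (1 + av b / e)
      av v.\<close>
    define C' where "C' = 1 / e + C * (1 + av b / e)"
    have b: "0 \<le> av b / e" using e(1) av_nonneg by simp
    have C': "1 / e \<le> C'" "C * (1 + av b / e) \<le> C'" "0 < C'"
      using b C(1) e(1) by (auto simp: C'_def add_pos_nonneg)
    have "bounded_coeffs (insert b B) C'"
      unfolding bounded_coeffs_def
    proof
      fix v assume "v \<in> Q_p_span (insert b B)"
      then obtain c w where v: "v = c * b + w" "c \<in> Q_p av" "w \<in> Q_p_span B"
        unfolding span_insert by blast
      have c_le: "av c \<le> 1 / e * av v"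
      proof (cases "c = 0")
        case False
        \<comment> \<open>The point -w/c of the span has distance at least \<open>e\<close> from
          \<open>b\<close>; multiplying by \<open>c\<close> gives the bound.\<close>
        have "- (inverse c * w) \<in> Q_p_span B"
          using v Q_p_inverse by (intro Q_p_span_uminus Q_p_span_smult) auto
        then have "e \<le> av (b + inverse c * w)" using e(2) by fastforce
        then have "e * av c \<le> av (b + inverse c * w) * av c" by (intro mult_right_mono av_nonneg)
        also have "\<dots> = av (c * b + w)"
        proof -
          have "(b + inverse c * w) * c = c * b + (inverse c * c) * w" by (simp add: algebra_simps)
          then show ?thesis using False unfolding av_mult[symmetric] by simp
        qed
        finally show ?thesis using e(1) v(1) by (simp add: field_simps)
      qed (use e(1) in \<open>simp add: av_nonneg\<close>)
      have "av (c * b) \<le> av b / e * av v"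
        using mult_right_mono[OF c_le av_nonneg[of b]] by (simp add: av_mult mult.commute)
      moreover have "0 \<le> av b / e * av v" by (intro mult_nonneg_nonneg b av_nonneg)
      ultimately have "av (v - c * b) \<le> (1 + av b / e) * av v"
        using av_diff_le[of v "c * b"] av_nonneg[of v] by (auto simp: distrib_right)
      then have w_le: "av w \<le> (1 + av b / e) * av v" using v(1) by simp
      obtain d where d: "w = (\<Sum>a\<in>B. d a * a)"
        "\<And>a. a \<in> B \<Longrightarrow> d a \<in> Q_p av \<and> av (d a) \<le> C * av w"
        using C(2) v(3) unfolding bounded_coeffs_def by blast
      have "av (d a) \<le> C' * av v" if "a \<in> B" for a
      proof -
        have "av (d a) \<le> C * ((1 + av b / e) * av v)"
          using d(2)[OF that] mult_left_mono[OF w_le, of C] C(1) by linarith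
        also have "\<dots> \<le> C' * av v"
          using mult_right_mono[OF C'(2) av_nonneg[of v]] by (simp add: mult.assoc)
        finally show ?thesis .
      qed
      moreover have "av c \<le> C' * av v"
        using c_le mult_right_mono[OF C'(1) av_nonneg[of v]] by linarith
      ultimately show "\<exists>c. v = (\<Sum>b\<in>insert b B. c b * b) \<and>
          (\<forall>b\<in>insert b B. c b \<in> Q_p av \<and> av (c b) \<le> C' * av v)"
        by (intro exI[of _ "d(b := c)"], unfold ext) (use d v in auto)
    qed
    then show ?thesis using C'(3) by blast
  qed
qed

lemma closed_Q_p_span: "finite B \<Longrightarrow> av_closed (Q_p_span B)"
  using bounded_coeffs_exists closed_Q_p_span_if_bounded_coeffs by blast

lemma finite_ext_iff:
  "finite_ext_Q_p av K \<longleftrightarrow> is_subfield K \<and> Q_p av \<subseteq> K \<and> (\<exists>B. finite B \<and> B \<subseteq> K \<and> K = Q_p_span B)"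
  by (simp add: finite_ext_Q_p_def Q_p_span_def)

lemma closed_finite_ext: "finite_ext_Q_p av K \<Longrightarrow> av_closed K"
  unfolding finite_ext_iff using closed_Q_p_span by blast

subsection \<open>Residues\<close>

text \<open>A rational number close to \<open>c\<close> has a denominator prime to p, which can be
  inverted modulo p^J. The bound m < p^J leaves only finitely many approximations, as the finiteness
  of residues requires.\<close>

lemma Q_p_integer_approx:
  assumes "c \<in> Q_p av" "av c \<le> 1"
  shows "\<exists>m<p ^ J. av (c - of_nat m) \<le> (1 / real p) ^ J"
proof -
  have pos: "0 < (1 / real p) ^ J" using inv_p_less_1 by simp
  obtain y where y: "y \<in> \<rat>" "av (c - y) < (1 / real p) ^ J"
    using assms(1) pos unfolding Q_p_def av_closure_def by blast
  have pJ: "(1 / real p) ^ J \<le> 1" using inv_p_less_1 by (intro power_le_one) auto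
  then have "av y \<le> 1"
    using av_near_bound[of y c 1] y(2) assms(2) by (simp add: av_diff_commute)
  obtain a b where ab: "b > 0" "coprime a b" "y = of_int a / of_int b"
    using y(1) by (metis Rats_cases')
  have av_multiple: "av (of_int (int p ^ j * k)) \<le> (1 / real p) ^ j" for j k
    using mult_left_mono[OF av_of_int_le[of k], of "(1 / real p) ^ j"] 
    by (simp add: av_mult av_P_power)
  have "\<not> int p dvd b"
  proof
    assume b: "int p dvd b"
    then have "\<not> int p dvd a"
      using ab(2) prime_p by (metis coprime_common_divisor not_prime_unit prime_nat_int_transfer)
    then have "av y = 1 / av (of_int b)" using ab by (simp add: av_divide av_of_int_prime_to_p)
    moreover have "av (of_int b) < 1"
    proof -
      obtain k where "b = int p ^ 1 * k" using b by auto
      then have "av (of_int b) \<le> 1 / real p" using av_multiple[of 1 k] by simp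
      then show ?thesis using inv_p_less_1(1) by linarith
    qed
    moreover have "0 < av (of_int b)"
      using ab(1) av_nonneg[of "of_int b"] av_eq_0_iff[of "of_int b"] by force
    ultimately have "1 < av y" by simp
    then show False using \<open>av y \<le> 1\<close> by simp
  qed
  then have av_b: "av (of_int b) = 1" by (rule av_of_int_prime_to_p)
  have "coprime b (int p ^ J)"
    using \<open>\<not> int p dvd b\<close> prime_p
    by (metis coprime_commute coprime_power_right_iff prime_imp_coprime prime_nat_int_transfer)
  then obtain u v where "u * b + v * int p ^ J = 1" by (metis bezout_int coprime_imp_gcd_eq_1)
  then have uv: "1 - b * u = int p ^ J * v" by (simp add: algebra_simps)
  \<comment> \<open>\<open>u\<close> inverts the denominator \<open>b\<close> modulo p^J, so
    \<open>m\<close> is the residue of a / b.\<close>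
  define m where "m = nat ((a * u) mod int p ^ J)"
  have p0: "0 < int p ^ J" using p_gt_1 by simp
  have m: "int m = (a * u) mod int p ^ J" using p0 by (simp add: m_def)
  then have "int m < int p ^ J" using p0 by simp
  then have "m < p ^ J" by (metis of_nat_less_iff of_nat_power)
  have y_eq: "y - of_int (a * u) = of_int a * of_int (int p ^ J * v) / of_int b"
    using ab(1) unfolding ab(3) uv[symmetric] by (simp add: field_simps)
  have "av (y - of_int (a * u)) \<le> 1 * (1 / real p) ^ J"
    unfolding y_eq av_divide av_mult[of "of_int a"] av_b div_by_1
    by (intro mult_mono av_of_int_le av_multiple av_nonneg) simp
  moreover have "av (of_int (a * u) - of_nat m) \<le> (1 / real p) ^ J"
  proof -
    have "a * u - int m = int p ^ J * ((a * u) div int p ^ J)"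
      unfolding m by (simp add: minus_mod_eq_mult_div)
    then have "of_int (a * u) - of_nat m = (of_int (int p ^ J * ((a * u) div int p ^ J)) :: 'k)"
      by (metis of_int_diff of_int_of_nat_eq)
    then show ?thesis using av_multiple by presburger
  qed
  ultimately have "av (c - of_nat m) \<le> (1 / real p) ^ J"
    using y(2) av_diff_trans[of c y] av_diff_trans[of y "of_int (a * u)"] by simp
  then show ?thesis using \<open>m < p ^ J\<close> by blast
qed

text \<open>Finiteness of the residue set, expressed without a quotient by a function with finitely
  many values that separates residue classes: it records the coordinates, made integral by a power
  of p, up to an error of absolute value at most p^(-J).\<close>

lemma finite_residues:
  assumes "finite B"
  shows "\<exists>F :: 'k \<Rightarrow> 'k \<Rightarrow> nat. finite (F ` integers av (Q_p_span B)) \<and>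
    (\<forall>v\<in>integers av (Q_p_span B). \<forall>w\<in>integers av (Q_p_span B). F v = F w \<longrightarrow> av (v - w) < 1)"
proof -
  obtain C where C: "0 < C" "bounded_coeffs B C" using bounded_coeffs_exists[OF assms] by blast
  define D where "D = 1 + (\<Sum>b\<in>B. av b)"
  have D: "av b \<le> D" if "b \<in> B" for b
    using member_le_sum[of b B av] that assms by (simp add: D_def av_nonneg)
  have "0 < D" by (simp add: D_def add_pos_nonneg sum_nonneg av_nonneg)
  have av_p: "0 < real p" using p_gt_1 by simp
  \<comment> \<open>The coordinates are bounded by \<open>C\<close>, so p^k makes them integral;
    \<open>J\<close> is then so large that agreement up to p^(-J) outweighs both the factor p^k and
    the size \<open>D\<close> of the vectors in \<open>B\<close>.\<close>
  obtain k where k: "(1 / real p) ^ k < 1 / C" using small_p_power[of "1 / C"] C(1) by auto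
  obtain J where J: "(1 / real p) ^ J < 1 / (real p ^ k * D)"
    using small_p_power[of "1 / (real p ^ k * D)"] \<open>0 < D\<close> av_p by auto
  define approx :: "'k \<Rightarrow> ('k \<Rightarrow> 'k) \<Rightarrow> ('k \<Rightarrow> nat) \<Rightarrow> bool" where
    "approx v c m \<longleftrightarrow> v = (\<Sum>b\<in>B. c b * b) \<and>
      (\<forall>b\<in>B. m b < p ^ J \<and> av (P ^ k * c b - of_nat (m b)) \<le> (1 / real p) ^ J) \<and>
      (\<forall>b. b \<notin> B \<longrightarrow> m b = 0)" for v c m
  have "\<exists>g. approx v (fst g) (snd g)"
    if "v \<in> integers av (Q_p_span B)" for v
  proof -
    from that obtain c where c: "v = (\<Sum>b\<in>B. c b * b)" "\<And>b. b \<in> B \<Longrightarrow> c b \<in> Q_p av"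
      "\<And>b. b \<in> B \<Longrightarrow> av (c b) \<le> C * av v"
      using C(2) unfolding bounded_coeffs_def integers_def by blast
    have "av (P ^ k * c b) \<le> 1" if b: "b \<in> B" for b
    proof -
      have "C * av v \<le> C" using that C(1) \<open>v \<in> _\<close> by (simp add: integers_def)
      then have "av (c b) \<le> C" using c(3)[OF b] by linarith
      then have "(1 / real p) ^ k * av (c b) \<le> 1 / C * C"
        using k by (intro mult_mono) (auto simp: av_nonneg C(1) less_imp_le)
      then show ?thesis using C(1) by (simp add: av_mult av_P_power)
    qed
    moreover have "P ^ k * c b \<in> Q_p av" if "b \<in> B" for b
      using subfield_Q_p c(2)[OF that]
      by (intro Q_p_ring subring_power subring_of_nat) (auto simp: subfield_iff)
    ultimately have "\<forall>b\<in>B. \<exists>m. m < p ^ J \<and> av (P ^ k * c b - of_nat m) \<le> (1 / real p) ^ J"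
      using Q_p_integer_approx by blast
    then obtain m where "\<forall>b\<in>B. m b < p ^ J \<and> av (P ^ k * c b - of_nat (m b)) \<le> (1 / real p) ^ J"
      by metis
    then show ?thesis using c(1)
      by (intro exI[of _ "(c, \<lambda>b. if b \<in> B then m b else 0)"]) (auto simp: approx_def)
  qed
  then have "\<forall>v\<in>integers av (Q_p_span B). \<exists>g. approx v (fst g) (snd g)" by blast
  from bchoice[OF this] obtain g where
    g: "\<forall>v\<in>integers av (Q_p_span B). approx v (fst (g v)) (snd (g v))" ..
  define c F where "c v = fst (g v)" and "F v = snd (g v)" for v
  have cF: "\<And>v. v \<in> integers av (Q_p_span B) \<Longrightarrow> v = (\<Sum>b\<in>B. c v b * b)"
    "\<And>v b. v \<in> integers av (Q_p_span B) \<Longrightarrow> b \<in> B \<Longrightarrow>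
       F v b < p ^ J \<and> av (P ^ k * c v b - of_nat (F v b)) \<le> (1 / real p) ^ J"
    "\<And>v b. v \<in> integers av (Q_p_span B) \<Longrightarrow> b \<notin> B \<Longrightarrow> F v b = 0"
    using g by (auto simp: approx_def c_def F_def)
  have "F ` integers av (Q_p_span B) \<subseteq> {f. \<forall>b. (b \<in> B \<longrightarrow> f b \<in> {..<p ^ J}) \<and> (b \<notin> B \<longrightarrow> f b = 0)}"
    using cF(2,3) by auto
  moreover have "finite {f. \<forall>b. (b \<in> B \<longrightarrow> f b \<in> {..<p ^ J}) \<and> (b \<notin> B \<longrightarrow> f b = (0::nat))}"
    by (rule finite_set_of_finite_funs[OF assms]) simp
  ultimately have "finite (F ` integers av (Q_p_span B))" using finite_subset by blast
  moreover have "av (v - w) < 1"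
    if v: "v \<in> integers av (Q_p_span B)" and w: "w \<in> integers av (Q_p_span B)" and "F v = F w" for v w
  proof -
    have "av ((c v b - c w b) * b) \<le> real p ^ k * (1 / real p) ^ J * D" if b: "b \<in> B" for b
    proof -
      have "av (P ^ k * c v b - P ^ k * c w b) \<le> (1 / real p) ^ J"
        using cF(2)[OF v b] cF(2)[OF w b] \<open>F v = F w\<close>
        using av_diff_trans[of "P ^ k * c v b" "of_nat (F v b)" _ "P ^ k * c w b"]
        by (simp add: av_diff_commute)
      then have "av (c v b - c w b) \<le> real p ^ k * (1 / real p) ^ J"
      proof -
        have "real p ^ k * ((1 / real p) ^ k * av (c v b - c w b)) \<le> real p ^ k * (1 / real p) ^ J"
          using \<open>av (P ^ k * c v b - P ^ k * c w b) \<le> (1 / real p) ^ J\<close>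
          unfolding right_diff_distrib[symmetric] av_mult av_P_power by (intro mult_left_mono) auto
        then show ?thesis using av_p by (simp add: power_one_over)
      qed
      then show ?thesis unfolding av_mult by (intro mult_mono D b av_nonneg) auto
    qed
    then have "av (\<Sum>b\<in>B. (c v b - c w b) * b) \<le> real p ^ k * (1 / real p) ^ J * D"
      using \<open>0 < D\<close> by (intro av_sum_bound) auto
    also have "\<dots> < 1" using J \<open>0 < D\<close> av_p by (simp add: field_simps)
    finally show ?thesis
      using cF(1)[OF v] cF(1)[OF w] by (simp add: left_diff_distrib sum_subtractf)
  qed
  ultimately show ?thesis by blast
qed

section \<open>The p-power map on residues and Teichmueller limits\<close>

lemma av_C_poly_le:
  assumes "av d \<le> 1" "av b \<le> 1"
  shows "av (C_poly p f d b) \<le> av d"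
  unfolding C_poly_def av_minus
proof (rule av_sum_bound[OF av_nonneg])
  fix k assume "k \<in> {0<..<p ^ f}"
  then obtain j where j: "k = Suc j" by (cases k) auto
  have "av (of_nat ((p ^ f choose k) div p) * d ^ j * b ^ (p ^ f - k)) * av d \<le> 1 * av d"
    using assms by (intro mult_right_mono av_nonneg av_mult_le_1 av_of_nat_le av_power_le_1)
  then show "av (of_nat ((p ^ f choose k) div p) * d ^ k * b ^ (p ^ f - k)) \<le> av d"
    unfolding j by (simp add: av_mult mult_ac)
qed

text \<open>With d = a - b the difference of the powers is d^(p^f) - p C(d, b). The first term
  contains d at least twice because f > 0, the second gains the factor 1/p, so both shrink by the
  factor \<open>t\<close>.\<close>

lemma av_power_diff_le:
  assumes "av a \<le> 1" "av b \<le> 1" "av (a - b) \<le> t" "1 / real p \<le> t" "0 < f"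
  shows "av (a ^ (p ^ f) - b ^ (p ^ f)) \<le> t * av (a - b)"
proof -
  define d where "d = a - b"
  have d: "av d \<le> 1" using assms by (simp add: d_def av_diff_bound)
  have "a ^ (p ^ f) - b ^ (p ^ f) = d ^ (p ^ f) - P * C_poly p f d b"
    unfolding C_poly_eq[OF prime_p] by (simp add: d_def)
  moreover have "av (d ^ (p ^ f)) \<le> t * av d"
  proof -
    have "p ^ 1 \<le> p ^ f" using p_gt_1 assms(5) by (intro power_increasing) auto
    then have "2 \<le> p ^ f" using p_gt_1 by simp
    then have "av d ^ (p ^ f) \<le> av d ^ 2" using d av_nonneg by (intro power_decreasing) auto
    also have "\<dots> \<le> t * av d"
      using assms(3) by (simp add: d_def power2_eq_square mult_right_mono av_nonneg)
    finally show ?thesis by (simp add: av_power)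
  qed
  moreover have "av (P * C_poly p f d b) \<le> t * av d"
    unfolding av_mult av_p
    by (intro mult_mono assms av_C_poly_le d av_nonneg) (use assms(4) inv_p_less_1 in linarith)
  ultimately show ?thesis using av_diff_bound unfolding d_def by simp
qed

text \<open>Pigeonhole: the powers x^(p^n) meet only finitely many residue classes, so two of them
  agree. Raising to the power p^n is injective on residues, which moves the coincidence down to
  \<open>x\<close> itself.\<close>

lemma frobenius_residue:
  assumes "finite_ext_Q_p av K" "x \<in> integers av K"
  shows "\<exists>f>0. av (x ^ (p ^ f) - x) < 1"
proof -
  obtain B where B: "finite B" "K = Q_p_span B" using assms(1) by (auto simp: finite_ext_iff)
  obtain F :: "'k \<Rightarrow> 'k \<Rightarrow> nat" where F: "finite (F ` integers av K)"
    "\<And>v w. v \<in> integers av K \<Longrightarrow> w \<in> integers av K \<Longrightarrow> F v = F w \<Longrightarrow> av (v - w) < 1"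
    using finite_residues[OF B(1)] unfolding B(2) by blast
  have ring: "subring (integers av K)" using assms(1) subring_integers by (simp add: finite_ext_iff)
  have pw: "x ^ n \<in> integers av K" for n by (rule subring_power[OF ring assms(2)])
  have "\<not> inj (\<lambda>n. F (x ^ (p ^ n)))"
  proof
    assume "inj (\<lambda>n. F (x ^ (p ^ n)))"
    moreover have "finite (range (\<lambda>n. F (x ^ (p ^ n))))"
      using F(1) by (rule finite_subset[rotated]) (use pw in auto)
    ultimately show False using finite_imageD infinite_UNIV_nat by blast
  qed
  then obtain a b where ab: "F (x ^ (p ^ a)) = F (x ^ (p ^ b))" "a \<noteq> b" by (auto simp: inj_def)
  obtain n m where "F (x ^ (p ^ n)) = F (x ^ (p ^ m))" "n < m"
  proof (cases "a < b")
    case False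
    then show ?thesis using that[of b a] ab by simp
  qed (use that[of a b] ab in blast)
  then have less: "av (x ^ (p ^ n) - x ^ (p ^ m)) < 1" using F(2) pw by blast
  define f where "f = m - n"
  define y where "y = x ^ (p ^ f)"
  have f: "0 < f" using \<open>n < m\<close> by (simp add: f_def)
  have x1: "av x \<le> 1" "av y \<le> 1" using assms(2) pw[of "p ^ f"] by (auto simp: integers_def y_def)
  have "y ^ (p ^ n) = x ^ (p ^ m)"
    using \<open>n < m\<close> by (simp add: y_def f_def flip: power_mult power_add)
  \<comment> \<open>The p^n-th power map is additive modulo p, so the p^n-th power of x - y has
    absolute value less than 1.\<close>
  then have "(x - y) ^ (p ^ n) = (x ^ (p ^ n) - x ^ (p ^ m)) + P * C_poly p n (x - y) y"
    unfolding C_poly_eq[OF prime_p] by simp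
  moreover have "av (P * C_poly p n (x - y) y) < 1"
  proof -
    have "av (C_poly p n (x - y) y) \<le> 1"
      using subring_C_poly[OF subring_unit_ball] x1 av_diff_bound by simp
    then have "1 / p * av (C_poly p n (x - y) y) \<le> 1 / p * 1" by (intro mult_left_mono) auto
    then show ?thesis using inv_p_less_1(1) unfolding av_mult av_p by linarith
  qed
  ultimately have "av ((x - y) ^ (p ^ n)) < 1" using less av_add_less by presburger
  then have "av (x - y) ^ (p ^ n) < 1" by (simp add: av_power)
  then have "av (x - y) < 1" by (meson not_le one_le_power)
  then show ?thesis using f unfolding y_def by (metis av_diff_commute)
qed

text \<open>Zero and the roots of unity of order prime to p.\<close>

definition teich :: "'k set" where
  "teich = {z. \<exists>f>0. z ^ (p ^ f) = z}"

text \<open>The q-th power map contracts distances between congruent elements, so its iterates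
  converge to a fixed point. The convergence is part of the conclusion because it places
  \<open>w\<close> in any closed ring that contains \<open>x\<close>.\<close>

lemma teichmueller_limit:
  assumes "av x \<le> 1" "0 < f" "av (x ^ (p ^ f) - x) < 1"
  shows "\<exists>w. w ^ (p ^ f) = w \<and> av (x - w) < 1 \<and> conv (\<lambda>n. x ^ ((p ^ f) ^ n)) w"
proof -
  let ?q = "p ^ f"
  \<comment> \<open>The contraction factor must dominate both the initial distance and 1/p, the two
    sources of gain in \<open>av_power_diff_le\<close>.\<close>
  define t where "t = max (1 / real p) (av (x ^ ?q - x))"
  have t: "1 / real p \<le> t" "t < 1" "0 < t" "av (x ^ ?q - x) \<le> t"
    using assms(3) inv_p_less_1 unfolding t_def by linarith+
  have step: "av (x ^ (?q ^ Suc n) - x ^ (?q ^ n)) \<le> t ^ Suc n" for n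
  proof (induction n)
    case (Suc n)
    have "t ^ Suc n \<le> t" using t by (simp add: power_le_one mult_left_le)
    have "x ^ (?q ^ Suc (Suc n)) - x ^ (?q ^ Suc n) = (x ^ (?q ^ Suc n)) ^ ?q - (x ^ (?q ^ n)) ^ ?q"
      by (simp add: mult.commute flip: power_mult)
    also have "av \<dots> \<le> t * av (x ^ (?q ^ Suc n) - x ^ (?q ^ n))"
      using assms t order_trans[OF Suc \<open>t ^ Suc n \<le> t\<close>]
      by (intro av_power_diff_le av_power_le_1) auto
    also have "\<dots> \<le> t * t ^ Suc n" using Suc t by (intro mult_left_mono) auto
    finally show ?case by simp
  qed (use t in simp)
  have near: "av (x ^ (?q ^ n) - x) \<le> t" for n
  proof (induction n)
    case (Suc n)
    have "t ^ Suc n \<le> t" using t by (simp add: power_le_one mult_left_le)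
    then show ?case using Suc step[of n] av_diff_trans by (meson order_trans)
  qed (use t in simp)
  have "\<exists>w. conv (\<lambda>n. x ^ (?q ^ n)) w"
  proof (rule conv_exists, rule Lim_null_comparison)
    show "(\<lambda>n. t ^ Suc n) \<longlonglongrightarrow> 0" using t by (intro LIMSEQ_Suc LIMSEQ_power_zero) simp
    show "\<forall>\<^sub>F n in sequentially. norm (av (x ^ (?q ^ Suc n) - x ^ (?q ^ n))) \<le> t ^ Suc n"
      using step by (simp add: av_nonneg del: power_Suc)
  qed
  then obtain w where w: "conv (\<lambda>n. x ^ (?q ^ n)) w" by blast
  have "conv (\<lambda>n. (x ^ (?q ^ n)) ^ ?q) (w ^ ?q)" by (rule conv_power[OF w])
  then have "conv (\<lambda>n. x ^ (?q ^ (n + 1))) (w ^ ?q)" by (simp add: mult.commute flip: power_mult)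
  then have "w ^ ?q = w" using conv_unique conv_offset[OF w, of 1] by blast
  obtain n where "av (x ^ (?q ^ n) - w) < 1" using convD[OF w, of 1] by auto
  moreover have "av (x - x ^ (?q ^ n)) < 1"
    using near[of n] t(2) by (simp add: av_diff_commute)
  ultimately have "av (x - w) < 1" using av_diff_trans_less[of x "x ^ (?q ^ n)" 1 w] by simp
  then show ?thesis using w \<open>w ^ ?q = w\<close> by blast
qed

lemma finite_ext_teichmueller:
  assumes "finite_ext_Q_p av K" "x \<in> integers av K"
  shows "\<exists>w\<in>teich \<inter> K. av (x - w) < 1"
proof -
  obtain f where f: "0 < f" "av (x ^ (p ^ f) - x) < 1" using frobenius_residue[OF assms] by blast
  obtain w where w: "w ^ (p ^ f) = w" "av (x - w) < 1" "conv (\<lambda>n. x ^ ((p ^ f) ^ n)) w"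
    using teichmueller_limit[OF _ f] assms(2) by (auto simp: integers_def)
  have "subring K" using assms(1) by (simp add: finite_ext_iff subfield_iff)
  then have "w \<in> K"
    using closed_conv[OF closed_finite_ext[OF assms(1)] w(3)] subring_power assms(2)
    by (auto simp: integers_def)
  then show ?thesis using w f(1) by (auto simp: teich_def)
qed

end

text \<open>Separatedness and completeness by divisibility alone, without a topology. The limit
  agrees with \<open>X n\<close> modulo the same power p^n, as in the inverse limit of the
  quotients.\<close>

definition padic_complete :: "nat \<Rightarrow> 'a::comm_ring_1 itself \<Rightarrow> bool" where
  "padic_complete p _ \<longleftrightarrow> (\<forall>a::'a. (\<forall>n. of_nat p ^ n dvd a) \<longrightarrow> a = 0) \<and>
     (\<forall>X::nat \<Rightarrow> 'a. (\<forall>n. of_nat p ^ n dvd X (Suc n) - X n) \<longrightarrow> (\<exists>l. \<forall>n. of_nat p ^ n dvd l - X n))"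

context R_pi_ring
begin

subsection \<open>Teichmueller representatives and the maximal unramified extension\<close>

lemma q_ge_2: "0 < f \<Longrightarrow> 2 \<le> p ^ f"
  using p_gt_1 power_increasing[of 1 f p] by simp

lemma power_p_iterate: "(z::'k) ^ (p ^ f) = z \<Longrightarrow> z ^ (p ^ (f * k)) = z"
  by (induction k) (simp_all add: power_add power_mult)

lemma teich_mult:
  assumes "z \<in> teich" "w \<in> teich"
  shows "z * w \<in> teich"
proof -
  from assms obtain f g where fg: "0 < f" "0 < g" "z ^ (p ^ f) = z" "w ^ (p ^ g) = w"
    by (auto simp: teich_def)
  then have "(z * w) ^ (p ^ (f * g)) = z * w"
    using power_p_iterate[OF fg(3), of g] power_p_iterate[OF fg(4), of f]
    by (simp add: power_mult_distrib mult.commute)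
  then show ?thesis using fg unfolding teich_def by (intro CollectI exI[of _ "f * g"]) simp
qed

lemma teich_1: "1 \<in> teich" and teich_minus_1: "- 1 \<in> teich"
  using odd_p p_gt_1 by (auto simp: teich_def intro!: exI[of _ "1::nat"])

lemma av_teich:
  assumes "z \<in> teich" "z \<noteq> 0"
  shows "av z = 1"
proof -
  obtain f where f: "0 < f" "z ^ (p ^ f) = z" using assms by (auto simp: teich_def)
  obtain n where n: "p ^ f = Suc (Suc n)" using q_ge_2[OF f(1)] by (metis add_2_eq_Suc le_Suc_ex)
  have "av z ^ (p ^ f) = av z" using f(2) av_power by metis
  then have "av z * av z ^ Suc n = av z" unfolding n by simp
  then have "av z ^ Suc n = 1" using assms(2) by (simp add: av_eq_0_iff)
  from power_eq_1_iff[OF this] show ?thesis using av_nonneg[of z] by simp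
qed

text \<open>These sums form a ring because the representatives are closed under multiplication and
  include -1 (p is odd). The inductive form allows proofs that add one representative at a
  time.\<close>

inductive_set teich_sums :: "'k set" where
  zero: "0 \<in> teich_sums"
| add: "t \<in> teich \<Longrightarrow> x \<in> teich_sums \<Longrightarrow> t + x \<in> teich_sums"

lemma teich_in_sums: "t \<in> teich \<Longrightarrow> t \<in> teich_sums"
  using teich_sums.add[OF _ teich_sums.zero] by fastforce

lemma teich_sums_add: "x \<in> teich_sums \<Longrightarrow> y \<in> teich_sums \<Longrightarrow> x + y \<in> teich_sums"
  by (induction rule: teich_sums.induct) (auto intro: teich_sums.add simp: add.assoc)

lemma teich_sums_mult_teich: "x \<in> teich_sums \<Longrightarrow> t \<in> teich \<Longrightarrow> t * x \<in> teich_sums"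
  by (induction rule: teich_sums.induct)
    (auto intro: teich_sums.intros teich_mult simp: distrib_left)

lemma teich_sums_mult: "x \<in> teich_sums \<Longrightarrow> y \<in> teich_sums \<Longrightarrow> x * y \<in> teich_sums"
  by (induction rule: teich_sums.induct)
    (auto intro: teich_sums.zero teich_sums_add teich_sums_mult_teich simp: distrib_right)

lemma subring_teich_sums: "subring teich_sums"
  unfolding subring_def
proof (intro conjI ballI)
  fix x y assume x: "x \<in> teich_sums" "y \<in> teich_sums"
  then have "x + (- 1) * y \<in> teich_sums"
    by (intro teich_sums_add teich_sums_mult_teich teich_minus_1)
  then show "x - y \<in> teich_sums" by simp
  show "x * y \<in> teich_sums" using x by (rule teich_sums_mult)
qed (intro teich_in_sums teich_1)

lemmas teich_sums_ring = subringD[OF subring_teich_sums]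

lemma av_teich_sums: "x \<in> teich_sums \<Longrightarrow> av x \<le> 1"
proof (induction rule: teich_sums.induct)
  case (add t x)
  then show ?case using av_teich[of t] by (cases "t = 0") (auto intro: av_add_bound)
qed simp

text \<open>The quotient by p must lie in \<open>teich_sums\<close> again; a bound on
  \<open>av (a - b)\<close> does not give that directly, and passing from such a bound to
  divisibility in \<open>W\<close> is the purpose of \<open>teich_sums_div_P\<close>.\<close>

definition cong_p :: "'k \<Rightarrow> 'k \<Rightarrow> bool" where
  "cong_p a b \<longleftrightarrow> (\<exists>z\<in>teich_sums. a - b = P * z)"

lemma cong_p_refl: "cong_p a a"
  using teich_sums_ring(2) by (auto simp: cong_p_def)

lemma cong_p_trans: "cong_p a b \<Longrightarrow> cong_p b c \<Longrightarrow> cong_p a c"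
proof -
  assume "cong_p a b" "cong_p b c"
  then obtain y z where yz: "y \<in> teich_sums" "z \<in> teich_sums" "a - b = P * y" "b - c = P * z"
    by (auto simp: cong_p_def)
  have "a - c = (a - b) + (b - c)" by simp
  also have "\<dots> = P * (y + z)" unfolding yz by (simp add: distrib_left)
  finally show "cong_p a c" using yz teich_sums_add by (auto simp: cong_p_def)
qed

lemma cong_p_add: "cong_p a b \<Longrightarrow> cong_p c d \<Longrightarrow> cong_p (a + c) (b + d)"
proof -
  assume "cong_p a b" "cong_p c d"
  then obtain y z where yz: "y \<in> teich_sums" "z \<in> teich_sums" "a - b = P * y" "c - d = P * z"
    by (auto simp: cong_p_def)
  have "(a + c) - (b + d) = (a - b) + (c - d)" by simp
  also have "\<dots> = P * (y + z)" unfolding yz by (simp add: distrib_left)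
  finally show "cong_p (a + c) (b + d)" using yz teich_sums_add by (auto simp: cong_p_def)
qed

lemma cong_p_power:
  assumes "a \<in> teich_sums" "b \<in> teich_sums" "cong_p a b"
  shows "cong_p (a ^ n) (b ^ n)"
proof (induction n)
  case (Suc n)
  from assms Suc obtain y z where yz: "y \<in> teich_sums" "z \<in> teich_sums"
    "a - b = P * y" "a ^ n - b ^ n = P * z" by (auto simp: cong_p_def)
  have "a ^ Suc n - b ^ Suc n = a * (a ^ n - b ^ n) + (a - b) * b ^ n" by (simp add: algebra_simps)
  also have "\<dots> = P * (a * z + y * b ^ n)" unfolding yz by (simp add: algebra_simps)
  finally show ?case unfolding cong_p_def
    using yz assms subring_power[OF subring_teich_sums] by (blast intro: teich_sums_ring)
qed (simp add: cong_p_refl)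

lemma cong_p_frobenius_iterate:
  assumes "x \<in> teich_sums" "cong_p (x ^ (p ^ f)) x"
  shows "cong_p (x ^ (p ^ (f * k))) x"
proof (induction k)
  case (Suc k)
  have "cong_p ((x ^ (p ^ (f * k))) ^ (p ^ f)) (x ^ (p ^ f))"
    by (intro cong_p_power subring_power[OF subring_teich_sums] assms(1) Suc)
  moreover have "(x ^ (p ^ (f * k))) ^ (p ^ f) = x ^ (p ^ (f * Suc k))"
    by (simp add: power_add mult.commute flip: power_mult)
  ultimately show ?case using cong_p_trans assms(2) by simp
qed (simp add: cong_p_refl)

text \<open>A common power q of p works for each of the finitely many representatives in the sum,
  and the q-th power map is additive modulo p.\<close>

lemma cong_p_frobenius: "x \<in> teich_sums \<Longrightarrow> \<exists>f>0. cong_p (x ^ (p ^ f)) x"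
proof (induction rule: teich_sums.induct)
  case zero
  then show ?case using cong_p_refl[of 0] by (intro exI[of _ "1::nat"]) (simp add: power_0_left)
next
  case (add t x)
  then obtain f g where fg: "0 < f" "0 < g" "t ^ (p ^ f) = t" "cong_p (x ^ (p ^ g)) x"
    by (auto simp: teich_def)
  let ?N = "p ^ (f * g)"
  have "t ^ ?N = t" by (rule power_p_iterate[OF fg(3)])
  moreover have "cong_p (x ^ ?N) x"
    using cong_p_frobenius_iterate[OF add.hyps(2) fg(4), of f] by (simp add: mult.commute)
  ultimately have "cong_p (t ^ ?N + x ^ ?N) (t + x)" using cong_p_add cong_p_refl by metis
  moreover have "cong_p ((t + x) ^ ?N) (t ^ ?N + x ^ ?N)"
  proof -
    have "(t + x) ^ ?N - (t ^ ?N + x ^ ?N) = P * (- C_poly p (f * g) t x)"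
      using C_poly_eq[OF prime_p, of "f * g" t x] by simp
    then show ?thesis
      using subring_C_poly[OF subring_teich_sums] teich_in_sums[OF add.hyps(1)] add.hyps(2) teich_sums_ring(5)
      unfolding cong_p_def by blast
  qed
  ultimately show ?case using cong_p_trans fg by (intro exI[of _ "f * g"]) auto
qed

section \<open>The closure of the Teichmueller ring, in which p generates the maximal ideal\<close>

definition W :: "'k set" where "W = av_closure av teich_sums"

lemma subring_W: "subring W" and closed_W: "av_closed W" and teich_sums_W: "teich_sums \<subseteq> W"
  unfolding W_def by (rule subring_closure[OF subring_teich_sums], rule closed_closure, rule closure_subset)

lemmas W_ring = subringD[OF subring_W]

lemma av_W: "x \<in> W \<Longrightarrow> av x \<le> 1"
  using closure_mono[of teich_sums "{x. av x \<le> 1}"] av_teich_sums closed_unit_ball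
  unfolding W_def av_closed_def by blast

text \<open>Modulo p within \<open>teich_sums\<close>, \<open>y\<close> equals its iterated q-th
  powers, and these tend to 0. Hence y / P is a limit of the elements (y - y^(q^k)) / P of
  \<open>W\<close>. This is the unramifiedness of \<open>W\<close>.\<close>

lemma teich_sums_div_P:
  assumes "y \<in> teich_sums" "av y < 1"
  shows "y / P \<in> W"
proof -
  obtain f where f: "0 < f" "cong_p (y ^ (p ^ f)) y" using cong_p_frobenius[OF assms(1)] by blast
  let ?X = "\<lambda>k. (y - y ^ (p ^ (f * k))) / P"
  have "?X k \<in> W" for k
  proof -
    obtain z where z: "z \<in> teich_sums" "y ^ (p ^ (f * k)) - y = P * z"
      using cong_p_frobenius_iterate[OF assms(1) f(2), of k] by (auto simp: cong_p_def)
    then have "y - y ^ (p ^ (f * k)) = P * (- z)" by (simp add: algebra_simps)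
    then have "?X k = - z" by simp
    then show ?thesis using z teich_sums_W W_ring(5) by auto
  qed
  moreover have "conv ?X (y / P)"
  proof (rule convI_bound)
    show "(\<lambda>k. real p * av y ^ k) \<longlonglongrightarrow> 0"
      using tendsto_mult_left[OF LIMSEQ_power_zero[of "av y"], of "real p"] assms(2) av_nonneg[of y]
      by simp
    fix k
    have "k \<le> f * k" using f(1) by (cases f) auto
    then have "k \<le> p ^ (f * k)" using power_gt_expt[of p "f * k"] p_gt_1 by linarith
    have "?X k - y / P = - (y ^ (p ^ (f * k)) / P)" by (simp add: field_simps)
    then have "av (?X k - y / P) = real p * av y ^ (p ^ (f * k))"
      by (simp add: av_divide av_power av_p)
    also have "\<dots> \<le> real p * av y ^ k"
      using \<open>k \<le> p ^ (f * k)\<close> assms(2) av_nonneg[of y] by (intro mult_left_mono power_decreasing) auto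
    finally show "av (?X k - y / P) \<le> real p * av y ^ k" .
  qed
  ultimately show ?thesis using closed_conv[OF closed_W] by blast
qed

lemma W_div_P:
  assumes "x \<in> W" "av x < 1"
  shows "x / P \<in> W"
proof (rule closedD[OF closed_W])
  fix e :: real assume "0 < e"
  \<comment> \<open>The bound 1 keeps \<open>av y\<close> below 1, and e / p pays for the division
    by \<open>P\<close>, which enlarges distances by the factor p.\<close>
  then have "0 < min 1 (e / real p)" using p_gt_1 by simp
  then obtain y where y: "y \<in> teich_sums" "av (x - y) < min 1 (e / real p)"
    using assms(1) unfolding W_def av_closure_def by blast
  then have "av y < 1" using av_near_less[of y x 1] assms(2) by (simp add: av_diff_commute)
  then have "y / P \<in> W" by (rule teich_sums_div_P[OF y(1)])
  moreover have "av (x / P - y / P) < e"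
    using y(2) p_gt_1 by (simp add: av_divide av_p field_simps flip: diff_divide_distrib)
  ultimately show "\<exists>y\<in>W. av (x / P - y) < e" by blast
qed

lemma W_residue:
  assumes "x \<in> W"
  shows "\<exists>f>0. av (x ^ (p ^ f) - x) < 1"
proof -
  obtain y where y: "y \<in> teich_sums" "av (x - y) < 1"
    using assms unfolding W_def av_closure_def by (auto dest: spec[of _ 1])
  obtain f z where f: "0 < f" "z \<in> teich_sums" "y ^ (p ^ f) - y = P * z"
    using cong_p_frobenius[OF y(1)] by (auto simp: cong_p_def)
  have "av (P * z) \<le> 1 / real p * 1"
    unfolding av_mult av_p using av_teich_sums[OF f(2)] by (intro mult_left_mono) auto
  then have "av (y ^ (p ^ f) - y) < 1" using inv_p_less_1(1) unfolding f(3) by linarith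
  moreover have "av (x ^ (p ^ f) - y ^ (p ^ f)) < 1"
  proof -
    define t where "t = max (1 / real p) (av (x - y))"
    have t: "t < 1" "0 \<le> t" using y(2) inv_p_less_1 unfolding t_def by linarith+
    have "av (x ^ (p ^ f) - y ^ (p ^ f)) \<le> t * av (x - y)"
      by (rule av_power_diff_le) (use assms y f av_W av_teich_sums in \<open>auto simp: t_def\<close>)
    also have "\<dots> \<le> 1 * av (x - y)" using t av_nonneg by (intro mult_right_mono) auto
    finally show ?thesis using y(2) by simp
  qed
  ultimately have "av (x ^ (p ^ f) - y) < 1" by (rule av_diff_trans_less[rotated])
  then have "av (x ^ (p ^ f) - x) < 1"
    using av_diff_trans_less[of "x ^ (p ^ f)" y 1 x] y(2) by (simp only: av_diff_commute[of x y])
  then show ?thesis using f(1) by blast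
qed

section \<open>The fraction field of \<open>W\<close>\<close>

text \<open>Denominators that are powers of p suffice for a field, because every nonzero element of
  \<open>W\<close> is a power of p times a unit of \<open>W\<close>.\<close>

definition W_frac :: "'k set" where "W_frac = {x. \<exists>n. P ^ n * x \<in> W}"

lemma W_subset_frac: "W \<subseteq> W_frac"
  by (auto simp: W_frac_def intro: exI[of _ 0])

lemma P_power_W: "P ^ n \<in> W"
  by (intro subring_power subring_of_nat subring_W)

text \<open>The denominator is removed one factor \<open>P\<close> at a time: while one is left, the
  numerator has absolute value below 1, so \<open>W_div_P\<close> applies.\<close>

lemma W_frac_le_1:
  assumes "x \<in> W_frac" "av x \<le> 1"
  shows "x \<in> W"
proof -
  have "x \<in> W" if "P ^ n * x \<in> W" for n
    using that
  proof (induction n)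
    case (Suc n)
    have "(1 / real p) ^ Suc n * av x \<le> (1 / real p) ^ Suc n * 1"
      using assms(2) by (intro mult_left_mono) auto
    also have "\<dots> < 1" using inv_p_less_1 power_Suc_less_one[of "1 / real p" n] by simp
    finally have "av (P ^ Suc n * x) < 1" by (simp only: av_mult[of "P ^ Suc n"] av_P_power)
    then have "P ^ Suc n * x / P \<in> W" using Suc.prems by (intro W_div_P)
    then show ?case using Suc.IH by simp
  qed simp
  then show ?thesis using assms(1) by (auto simp: W_frac_def)
qed

text \<open>Elements of \<open>W_frac\<close> at distance less than 1 differ by an element of
  \<open>W\<close>, so all close approximations of \<open>x\<close> share one denominator with a
  fixed one, and closedness reduces to that of \<open>W\<close>.\<close>

lemma closed_W_frac: "av_closed W_frac"
proof (rule closedI)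
  fix x assume x: "\<And>e. 0 < e \<Longrightarrow> \<exists>y\<in>W_frac. av (x - y) < e"
  then obtain y where y: "y \<in> W_frac" "av (x - y) < 1" by (meson zero_less_one)
  obtain n where n: "P ^ n * y \<in> W" using y(1) by (auto simp: W_frac_def)
  have "x - y \<in> W"
  proof (rule closedD[OF closed_W])
    fix e :: real assume "0 < e"
    then obtain z where z: "z \<in> W_frac" "av (x - z) < min e 1" using x[of "min e 1"] by auto
    obtain m where m: "P ^ m * z \<in> W" using z(1) by (auto simp: W_frac_def)
    have "P ^ (n + m) * (z - y) = P ^ n * (P ^ m * z) - P ^ m * (P ^ n * y)"
      by (simp add: power_add algebra_simps)
    then have "z - y \<in> W_frac" using W_ring(3,4) P_power_W n m unfolding W_frac_def by (metis mem_Collect_eq)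
    moreover have "av (z - y) < 1"
      using av_diff_trans_less[of z x 1 y] y(2) z(2) by (simp add: av_diff_commute)
    ultimately have "z - y \<in> W" using W_frac_le_1 by simp
    then show "\<exists>w\<in>W. av (x - y - w) < e" using z(2) by (intro bexI[of _ "z - y"]) auto
  qed
  then have "P ^ n * (x - y) + P ^ n * y \<in> W" by (rule W_ring(6)[OF W_ring(4)[OF P_power_W] n])
  then have "P ^ n * x \<in> W" by (simp add: algebra_simps)
  then show "x \<in> W_frac" by (auto simp: W_frac_def)
qed

lemma subring_W_frac: "subring W_frac"
  unfolding subring_def
proof (intro conjI ballI)
  show "1 \<in> W_frac" using W_ring(1) W_subset_frac by blast
  fix x y assume "x \<in> W_frac" "y \<in> W_frac"
  then obtain n m where nm: "P ^ n * x \<in> W" "P ^ m * y \<in> W" by (auto simp: W_frac_def)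
  have "P ^ (n + m) * (x - y) = P ^ m * (P ^ n * x) - P ^ n * (P ^ m * y)"
    "P ^ (n + m) * (x * y) = (P ^ n * x) * (P ^ m * y)" by (simp_all add: power_add algebra_simps)
  then have "P ^ (n + m) * (x - y) \<in> W" "P ^ (n + m) * (x * y) \<in> W"
    using nm W_ring P_power_W by metis+
  then show "x - y \<in> W_frac" "x * y \<in> W_frac" by (auto simp: W_frac_def)
qed

text \<open>The exponent \<open>k\<close> bounds the number of divisions by \<open>P\<close> before
  an element of absolute value 1 is reached.\<close>

lemma W_unit_part:
  assumes "y \<in> W" "(1 / real p) ^ k < av y"
  shows "\<exists>m u. y = P ^ m * u \<and> u \<in> W \<and> av u = 1"
  using assms
proof (induction k arbitrary: y)
  case 0
  then show ?case using av_W by fastforce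
next
  case (Suc k)
  show ?case
  proof (cases "av y = 1")
    case True
    then show ?thesis using Suc.prems by (intro exI[of _ 0] exI[of _ y]) simp
  next
    case False
    then have "y / P \<in> W" using W_div_P[of y] av_W[of y] Suc.prems by simp
    moreover have "(1 / real p) ^ k < av (y / P)"
      using Suc.prems(2) p_gt_1 by (simp add: av_divide av_p field_simps)
    ultimately obtain m u where "y / P = P ^ m * u" "u \<in> W" "av u = 1" using Suc.IH by blast
    then have "y = P ^ Suc m * u" by (simp add: field_simps)
    then show ?thesis using \<open>u \<in> W\<close> \<open>av u = 1\<close> by blast
  qed
qed

text \<open>Invert the unit part \<open>u\<close> of \<open>x\<close> by the geometric series for \<open>w = u\<^bsup>q - 1\<^esup>\<close>, which is
  congruent to \<open>1\<close>.\<close>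

lemma inverse_in_closed_subring:
  assumes "subring V" "av_closed V" "inverse P \<in> V" "V \<subseteq> W_frac" "x \<in> V" "x \<noteq> 0"
  shows "inverse x \<in> V"
proof -
  note V = subringD[OF assms(1)] and V_power = subring_power[OF assms(1)]
  obtain n where n: "P ^ n * x \<in> W" using assms(4,5) by (auto simp: W_frac_def)
  have "0 < av (P ^ n * x)"
    using av_nonneg[of "P ^ n * x"] av_eq_0_iff[of "P ^ n * x"] assms(6) by simp
  then obtain k where "(1 / real p) ^ k < av (P ^ n * x)" using small_p_power by blast
  then obtain m u where u: "P ^ n * x = P ^ m * u" "u \<in> W" "av u = 1"
    using W_unit_part[OF n] by blast
  have PV: "P \<in> V" by (rule subring_of_nat[OF assms(1)])
  have "u = inverse P ^ m * (P ^ n * x)" unfolding u(1) by (simp add: power_inverse)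
  then have "u \<in> V" using V(4) V_power assms(3,5) PV by simp
  obtain f where f: "0 < f" "av (u ^ (p ^ f) - u) < 1" using W_residue[OF u(2)] by blast
  obtain j where j: "p ^ f = Suc (Suc j)" using q_ge_2[OF f(1)] by (metis add_2_eq_Suc le_Suc_ex)
  define w where "w = u ^ Suc j"
  have u_pow: "u ^ (p ^ f) = u * w" "w = u * u ^ j" unfolding w_def j by simp_all
  have "u ^ (p ^ f) - u = u * (w - 1)" unfolding u_pow(1) by (simp add: algebra_simps)
  then have w1: "av (1 - w) < 1" using f(2) u(3) by (simp add: av_mult av_diff_commute)
  have av_w: "av w = 1" using u(3) by (simp only: w_def av_power power_one)
  then have "w \<noteq> 0" by auto
  have "w \<in> V" unfolding w_def by (rule V_power[OF \<open>u \<in> V\<close>])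
  have "conv (\<lambda>n. \<Sum>k<n. (1 - w) ^ k) (inverse w)"
  proof (rule convI_bound)
    show "(\<lambda>n. av (1 - w) ^ n) \<longlonglongrightarrow> 0"
      using w1 av_nonneg[of "1 - w"] by (intro LIMSEQ_power_zero) simp
    fix n
    have "w * (\<Sum>k<n. (1 - w) ^ k) = 1 - (1 - w) ^ n"
      using one_diff_power_eq[of "1 - w" n] by simp
    then have "w * ((\<Sum>k<n. (1 - w) ^ k) - inverse w) = - ((1 - w) ^ n)"
      using \<open>w \<noteq> 0\<close> by (simp add: right_diff_distrib)
    then have "av w * av ((\<Sum>k<n. (1 - w) ^ k) - inverse w) = av (1 - w) ^ n"
      by (metis av_minus av_mult av_power)
    then show "av ((\<Sum>k<n. (1 - w) ^ k) - inverse w) \<le> av (1 - w) ^ n" using av_w by simp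
  qed
  moreover have "(\<Sum>k<n. (1 - w) ^ k) \<in> V" for n
    by (rule subring_sum[OF assms(1)]) (rule V_power[OF V(3)[OF V(1) \<open>w \<in> V\<close>]])
  ultimately have "inverse w \<in> V" by (rule closed_conv[OF assms(2)])
  have "u \<noteq> 0" using u(3) by auto
  then have "inverse u = u ^ j * inverse w"
    using \<open>w \<noteq> 0\<close> unfolding u_pow(2) by (simp add: field_simps)
  then have "inverse u \<in> V" using V(4) V_power \<open>u \<in> V\<close> \<open>inverse w \<in> V\<close> by simp
  have "inverse x = P ^ n * inverse P ^ m * inverse u"
  proof -
    have "inverse (P ^ n * x) = inverse (P ^ m * u)" using u(1) by simp
    then have "inverse (P ^ n) * inverse x = inverse P ^ m * inverse u" by (simp add: power_inverse)
    then have "P ^ n * (inverse (P ^ n) * inverse x) = P ^ n * (inverse P ^ m * inverse u)" by simp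
    then show ?thesis by (simp add: mult.assoc[symmetric])
  qed
  then show ?thesis using V(4) V_power assms(3) \<open>inverse u \<in> V\<close> PV by simp
qed

lemma inverse_P_frac: "inverse P \<in> W_frac"
  using W_ring(1) by (auto simp: W_frac_def intro!: exI[of _ 1])

lemma subfield_W_frac: "is_subfield W_frac"
  unfolding subfield_iff
proof (intro conjI ballI subring_W_frac)
  show "inverse x \<in> W_frac" if "x \<in> W_frac" for x
    using inverse_in_closed_subring[OF subring_W_frac closed_W_frac inverse_P_frac order_refl that] that
    by (cases "x = 0") auto
qed

section \<open>Comparison with the maximal unramified extension\<close>

lemma Q_p_subset_W_frac: "Q_p av \<subseteq> W_frac"
  using closure_mono[OF subfield_Rats[OF subfield_W_frac]] closed_W_frac
  unfolding Q_p_def av_closed_def by blast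

text \<open>Since p is a prime element of \<open>K\<close>, an integer of \<open>K\<close> has an
  expansion in powers of p with Teichmueller digits, whose partial sums lie in \<open>W\<close>.
  Other elements are made integral by a power of p.\<close>

lemma finite_unramified_subset:
  assumes "finite_unramified p av K"
  shows "K \<subseteq> W_frac"
proof
  have K: "finite_ext_Q_p av K" "prime_element av K P" using assms by (auto simp: finite_unramified_def)
  then have K_ring: "subring K" by (simp add: finite_ext_iff subfield_iff)
  have int: "x \<in> W" if x: "x \<in> integers av K" for x
  proof -
    have "\<exists>y\<in>W. \<exists>x'\<in>integers av K. x = y + P ^ n * x'" for n
    proof (induction n)
      case 0
      then show ?case using x W_ring(2) by (intro bexI[of _ 0] bexI[of _ x]) auto
    next
      case (Suc n)
      then obtain y x' where y: "y \<in> W" "x' \<in> integers av K" "x = y + P ^ n * x'" by blast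
      obtain w where w: "w \<in> teich" "w \<in> K" "av (x' - w) < 1"
        using finite_ext_teichmueller[OF K(1) y(2)] by blast
      have "x' - w \<in> K" using y(2) w(2) subringD(3)[OF K_ring] by (auto simp: integers_def)
      then obtain x'' where x'': "x'' \<in> integers av K" "x' - w = P * x''"
        using K(2) w(3) unfolding prime_element_def by blast
      have "x = (y + P ^ n * w) + P ^ n * (x' - w)" using y(3) by (simp add: algebra_simps)
      then have "x = (y + P ^ n * w) + P ^ Suc n * x''" unfolding x''(2) by (simp add: mult_ac)
      moreover have "y + P ^ n * w \<in> W"
        using y(1) w(1) teich_in_sums teich_sums_W by (intro W_ring(4,6) P_power_W) auto
      ultimately show ?case using x''(1) by blast
    qed
    then have approx: "\<exists>y\<in>W. \<exists>x'\<in>integers av K. x = y + P ^ n * x'" for n .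
    show "x \<in> W"
    proof (rule closedD[OF closed_W])
      fix e :: real assume "0 < e"
      then obtain n where n: "(1 / real p) ^ n < e" using small_p_power by blast
      obtain y x' where y: "y \<in> W" "x' \<in> integers av K" "x = y + P ^ n * x'" using approx by blast
      have "(1 / real p) ^ n * av x' \<le> (1 / real p) ^ n * 1"
        using y(2) by (intro mult_left_mono) (auto simp: integers_def)
      moreover have "av (x - y) = (1 / real p) ^ n * av x'" unfolding y(3) by (simp add: av_mult av_P_power)
      ultimately have "av (x - y) < e" using n by linarith
      then show "\<exists>y\<in>W. av (x - y) < e" using y(1) by blast
    qed
  qed
  fix x assume "x \<in> K"
  obtain n where n: "av (P ^ n * x) \<le> 1" using p_power_bound by blast
  have "P ^ n * x \<in> K" using \<open>x \<in> K\<close> subring_power[OF K_ring subring_of_nat[OF K_ring]]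
    by (intro subringD(4)[OF K_ring])
  then show "x \<in> W_frac" using int n by (auto simp: integers_def W_frac_def)
qed

text \<open>The solutions of z^(p^f) = z are finite in number and closed under multiplication, so
  their span over Q_p is a ring. Closed inside \<open>W_frac\<close>, it is a field by
  \<open>inverse_in_closed_subring\<close>, and \<open>W_div_P\<close> makes p a prime
  element.\<close>

lemma teich_in_finite_unramified:
  assumes "z \<in> teich"
  shows "\<exists>K. finite_unramified p av K \<and> z \<in> K"
proof -
  obtain f where f: "0 < f" "z ^ (p ^ f) = z" using assms by (auto simp: teich_def)
  define T :: "'k set" where "T = {z. z ^ (p ^ f) = z}"
  have "finite T"
  proof -
    \<comment> \<open>The polynomial X^q - X is nonzero because q is at least 2, so its leading term
      is not cancelled.\<close>
    let ?h = "monom 1 (p ^ f) - monom 1 1 :: 'k poly"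
    have "coeff ?h (p ^ f) = 1" using q_ge_2[OF f(1)] by simp
    then have "?h \<noteq> 0" by (metis coeff_0 zero_neq_one)
    then have "finite {z. poly ?h z = 0}" by (rule poly_roots_finite)
    then show ?thesis by (simp add: T_def poly_monom)
  qed
  have T: "T \<subseteq> W_frac" using f(1) teich_in_sums teich_sums_W W_subset_frac by (auto simp: T_def teich_def)
  have T_mult: "a * b \<in> T" if "a \<in> T" "b \<in> T" for a b
    using that by (simp add: T_def power_mult_distrib)
  have T1: "1 \<in> T" by (simp add: T_def)
  define K where "K = Q_p_span T"
  have base: "t \<in> K" if "t \<in> T" for t
    unfolding K_def using Q_p_span_base[OF \<open>finite T\<close> that] .
  have ring: "subring K"
    unfolding subring_def
  proof (intro conjI ballI)
    show "1 \<in> K" using base T1 .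
    fix x y assume xy: "x \<in> K" "y \<in> K"
    then show "x - y \<in> K" unfolding K_def by (intro Q_p_span_diff)
    obtain c d where cd: "x = (\<Sum>b\<in>T. c b * b)" "y = (\<Sum>b\<in>T. d b * b)"
      "\<forall>b\<in>T. c b \<in> Q_p av" "\<forall>b\<in>T. d b \<in> Q_p av" using xy by (auto simp: K_def Q_p_span_def)
    have "x * y = (\<Sum>a\<in>T. \<Sum>b\<in>T. (c a * d b) * (a * b))"
      unfolding cd sum_product by (simp add: mult_ac)
    also have "\<dots> \<in> K" unfolding K_def
      by (intro Q_p_span_sum Q_p_span_smult Q_p_ring(4) base[unfolded K_def] T_mult) (use cd in auto)
    finally show "x * y \<in> K" .
  qed
  have Q_K: "Q_p av \<subseteq> K" using Q_p_span_smult[OF base[OF T1, unfolded K_def]] by (auto simp: K_def)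
  have K_frac: "K \<subseteq> W_frac"
  proof
    fix x assume "x \<in> K"
    then obtain c where "x = (\<Sum>b\<in>T. c b * b)" "\<forall>b\<in>T. c b \<in> Q_p av" by (auto simp: K_def Q_p_span_def)
    then show "x \<in> W_frac"
      using T Q_p_subset_W_frac by (auto intro!: subring_sum subringD(4) subring_W_frac)
  qed
  have closed: "av_closed K" unfolding K_def using \<open>finite T\<close> by (rule closed_Q_p_span)
  have "subring (Q_p av)" using subfield_Q_p by (simp add: subfield_iff)
  then have inv_P: "inverse P \<in> K" using Q_K Q_p_inverse subring_of_nat by blast
  have field: "is_subfield K"
    unfolding subfield_iff
  proof (intro conjI ballI ring)
    show "inverse x \<in> K" if "x \<in> K" for x
      using inverse_in_closed_subring[OF ring closed inv_P K_frac that] that by (cases "x = 0") auto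
  qed
  have "prime_element av K P"
    unfolding prime_element_def
  proof (intro equalityI subsetI)
    fix x assume "x \<in> {x \<in> K. av x < 1}"
    then have x: "x \<in> K" "av x < 1" by auto
    then have "x \<in> W" using K_frac W_frac_le_1[of x] by auto
    then have "av (x / P) \<le> 1" using W_div_P[of x] x(2) av_W by blast
    moreover have "x / P \<in> K" using x(1) inv_P subringD(4)[OF ring] by (simp add: divide_inverse)
    ultimately have "x / P \<in> integers av K" by (simp add: integers_def)
    then show "x \<in> (\<lambda>y. P * y) ` integers av K" by (intro image_eqI[of _ _ "x / P"]) auto
  next
    fix x assume "x \<in> (\<lambda>y. P * y) ` integers av K"
    then obtain y where y: "y \<in> K" "av y \<le> 1" "x = P * y" by (auto simp: integers_def)
    have "1 / real p * av y \<le> 1 / real p * 1" using y(2) by (intro mult_left_mono) auto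
    moreover have "av x = 1 / real p * av y" using y(3) by (simp add: av_mult av_p)
    ultimately have "av x < 1" using inv_p_less_1(1) by linarith
    moreover have "x \<in> K" unfolding y(3) using y(1) subring_of_nat[OF ring] by (intro subringD(4)[OF ring])
    ultimately show "x \<in> {x \<in> K. av x < 1}" by simp
  qed
  then have "finite_unramified p av K"
    unfolding finite_unramified_def finite_ext_iff using field Q_K \<open>finite T\<close> base K_def by blast
  then show ?thesis using base f(2) by (auto simp: T_def)
qed

lemma subfield_Q_p_ur: "is_subfield (Q_p_ur p av)"
  by (auto simp: Q_p_ur_def is_subfield_def)

lemma teich_Q_p_ur: "teich \<subseteq> Q_p_ur p av"
  using teich_in_finite_unramified by (fastforce simp: Q_p_ur_def)

text \<open>For one inclusion, \<open>W_frac\<close> is among the subfields whose intersection is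
  \<open>Q_p_ur p av\<close>, and its integers are \<open>W\<close>; for the other, every
  Teichmueller representative lies in a finite unramified extension.\<close>

lemma R_ring_eq_W: "R_ring p av = W"
proof
  have "Q_p_ur p av \<subseteq> W_frac"
    using subfield_W_frac finite_unramified_subset by (auto simp: Q_p_ur_def)
  then have "integers av (Q_p_ur p av) \<subseteq> W" using W_frac_le_1 by (auto simp: integers_def)
  then show "R_ring p av \<subseteq> W"
    using closure_mono closed_W unfolding R_ring_def av_closed_def by blast
  have "x \<in> Q_p_ur p av" if "x \<in> teich_sums" for x
    using that
    by induction (use subfield_Q_p_ur teich_Q_p_ur in \<open>auto intro: subringD simp: subfield_iff\<close>)
  then have "teich_sums \<subseteq> integers av (Q_p_ur p av)" using av_teich_sums by (auto simp: integers_def)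
  then show "W \<subseteq> R_ring p av" unfolding W_def R_ring_def by (rule closure_mono)
qed

subsection \<open>The ring \<open>R[\<pi>]\<close>\<close>

lemma emb_1 [simp]: "emb 1 = 1" and emb_add: "emb (x + y) = emb x + emb y"
  and emb_mult: "emb (x * y) = emb x * emb y"
  using emb_hom by (auto simp: is_ring_hom_def)

lemma emb_0 [simp]: "emb 0 = 0"
  using emb_add[of 0 0] by simp

lemma emb_of_nat [simp]: "emb (of_nat n) = of_nat n"
  by (induction n) (auto simp: emb_add)

lemma emb_power: "emb (x ^ n) = emb x ^ n"
  by (induction n) (auto simp: emb_mult)

lemma emb_eq_iff [simp]: "emb x = emb y \<longleftrightarrow> x = y"
  using emb_inj by (auto simp: inj_def)

abbreviation unif :: 'k where "unif \<equiv> emb \<pi>"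

definition W_span :: "nat \<Rightarrow> 'k set" where
  "W_span e = {\<Sum>i<e. a i * unif ^ i | a. \<forall>i. a i \<in> W}"

lemma W_spanI: "x = (\<Sum>i<e. a i * unif ^ i) \<Longrightarrow> (\<And>i. a i \<in> W) \<Longrightarrow> x \<in> W_span e"
  by (auto simp: W_span_def)

text \<open>The series is summed coefficient by coefficient: \<open>W\<close> lies in the unit ball,
  so the coefficients converge, and \<open>W\<close> is closed, so it contains their limits.\<close>

lemma W_span_series:
  assumes "\<And>n. w n \<in> W_span e"
  shows "\<exists>l\<in>W_span e. conv (\<lambda>n. \<Sum>k<n. P ^ k * w k) l"
proof -
  have "\<forall>n. \<exists>a. w n = (\<Sum>i<e. a i * unif ^ i) \<and> (\<forall>i. a i \<in> W)"
    using assms unfolding W_span_def by blast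
  from choice[OF this] obtain a where
    a: "\<And>n. w n = (\<Sum>i<e. a n i * unif ^ i)" "\<And>n i. a n i \<in> W" by blast
  define b where "b i n = (\<Sum>k<n. P ^ k * a k i)" for i n
  have b_W: "b i n \<in> W" for i n
    unfolding b_def by (rule subring_sum[OF subring_W]) (rule W_ring(4)[OF P_power_W a(2)])
  have "\<exists>l. conv (b i) l" for i
  proof (rule conv_exists, rule Lim_null_comparison[OF _ p_powers_tendsto_0])
    have "(1 / real p) ^ n * av (a n i) \<le> (1 / real p) ^ n * 1" for n
      using av_W[OF a(2)] by (intro mult_left_mono) auto
    then show "\<forall>\<^sub>F n in sequentially. norm (av (b i (Suc n) - b i n)) \<le> (1 / real p) ^ n"
      by (simp add: b_def av_mult av_P_power av_nonneg)
  qed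
  then have "\<forall>i. \<exists>l. conv (b i) l" by blast
  from choice[OF this] obtain l where l: "\<And>i. conv (b i) (l i)" by blast
  have "l i \<in> W" for i by (rule closed_conv[OF closed_W l b_W])
  then have "(\<Sum>i<e. l i * unif ^ i) \<in> W_span e" by (auto simp: W_span_def)
  moreover have "(\<Sum>k<n. P ^ k * w k) = (\<Sum>i<e. b i n * unif ^ i)" for n
    unfolding a(1) b_def sum_distrib_left sum_distrib_right
    by (subst sum.swap) (simp add: mult.assoc)
  ultimately show ?thesis using conv_sum[of "{..<e}" "\<lambda>i n. b i n * unif ^ i" "\<lambda>i. l i * unif ^ i"]
      conv_cmult_right[OF l] by auto
qed

text \<open>The number \<open>e\<close> is the ramification index: p is unif^e times a unit of
  \<open>K\<close>. Expanding an integer of \<open>K\<close> to \<open>e\<close> digits in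
  \<open>unif\<close> leaves a remainder divisible by unif^e, hence by p; repetition gives a series
  in powers of p for \<open>W_span_series\<close>. All later facts about \<open>K\<close> are
  collected here, so that this field is chosen only once.\<close>

lemma integers_in_W_span:
  "\<exists>K e. is_subfield K \<and> unif \<in> K \<and> P \<in> K \<and> av unif < 1 \<and> unif \<noteq> 0 \<and> 0 < e \<and>
     av (P / unif) \<le> 1 \<and> av (unif ^ e / P) \<le> 1 \<and> integers av K \<subseteq> W_span e"
proof -
  obtain K where "finite_galois_ext_Q_p av K" and prime: "prime_element av K unif"
    using emb_prime by blast
  then have ext: "finite_ext_Q_p av K" by (simp add: finite_galois_ext_Q_p_def)
  then have field: "is_subfield K" and ring: "subring K" by (auto simp: finite_ext_iff subfield_iff)
  have inv: "inverse x \<in> K" if "x \<in> K" for x using field that by (simp add: subfield_iff)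
  have PK: "P \<in> K" by (rule subring_of_nat[OF ring])
  have div: "\<exists>y\<in>integers av K. x = unif * y" if "x \<in> K" "av x < 1" for x
    using prime that unfolding prime_element_def by blast
  have "1 \<in> integers av K" using subringD(1)[OF ring] by (simp add: integers_def)
  then have "unif * 1 \<in> {x \<in> K. av x < 1}" using prime unfolding prime_element_def by blast
  then have unifK: "unif \<in> K" "av unif < 1" by auto
  have "av P < 1" using inv_p_less_1 by (simp add: av_p)
  then obtain y0 where y0: "y0 \<in> integers av K" "P = unif * y0" using div[OF PK] by blast
  then have unif0: "unif \<noteq> 0" using P_nonzero by (metis mult_zero_left)
  have P_div: "av (P / unif) \<le> 1" using y0 unif0 by (simp add: integers_def)
  \<comment> \<open>Factors \<open>unif\<close> are split off until a unit remains; the bound on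
    \<open>av y\<close> limits their number in terms of \<open>k\<close>.\<close>
  have unit_part: "\<exists>m u. y = unif ^ m * u \<and> u \<in> K \<and> av u = 1"
    if "y \<in> K" "av y \<le> 1" "av unif ^ k < av y" for y k
    using that
  proof (induction k arbitrary: y)
    case (Suc k)
    show ?case
    proof (cases "av y = 1")
      case True
      then show ?thesis using Suc.prems by (intro exI[of _ 0] exI[of _ y]) simp
    next
      case False
      then obtain z where z: "z \<in> K" "av z \<le> 1" "y = unif * z"
        using div[of y] Suc.prems by (auto simp: integers_def)
      have "av unif * av unif ^ k < av unif * av z" using Suc.prems(3) z(3) by (simp add: av_mult)
      then have "av unif ^ k < av z" using mult_less_cancel_left_pos av_nonneg[of unif] unif0 av_eq_0_iff[of unif]
        by (simp add: mult_less_cancel_left)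
      then obtain m u where "z = unif ^ m * u" "u \<in> K" "av u = 1" using Suc.IH z by blast
      then show ?thesis using z(3) by (intro exI[of _ "Suc m"] exI[of _ u]) simp
    qed
  qed simp
  have "0 < av P" using inv_p_less_1 by (simp add: av_p)
  then obtain k where "av unif ^ k < av P" using real_arch_pow_inv unifK(2) by blast
  then obtain e u where u: "P = unif ^ e * u" "u \<in> K" "av u = 1"
    using unit_part[OF PK less_imp_le[OF \<open>av P < 1\<close>]] by blast
  have "u \<noteq> 0" using u(3) by auto
  have "0 < e" using u \<open>av P < 1\<close> by (cases e) auto
  have pow_div: "unif ^ e / P = inverse u" using u(1) \<open>u \<noteq> 0\<close> unif0 by (simp add: field_simps)
  have "av (unif ^ e / P) \<le> 1" unfolding pow_div using u(3) by (simp add: av_inverse)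
  have expand: "\<exists>a. (\<forall>i. a i \<in> W) \<and> (\<exists>x'\<in>integers av K. x = (\<Sum>i<n. a i * unif ^ i) + unif ^ n * x')"
    if "x \<in> integers av K" for x n
  proof (induction n)
    case 0
    then show ?case using that W_ring(2) by auto
  next
    case (Suc n)
    then obtain a x' where a: "\<And>i. a i \<in> W" "x' \<in> integers av K"
      "x = (\<Sum>i<n. a i * unif ^ i) + unif ^ n * x'" by blast
    obtain w where w: "w \<in> teich" "w \<in> K" "av (x' - w) < 1"
      using finite_ext_teichmueller[OF ext a(2)] by blast
    have "x' - w \<in> K" using a(2) w(2) subringD(3)[OF ring] by (auto simp: integers_def)
    then obtain x'' where x'': "x'' \<in> integers av K" "x' - w = unif * x''" using div w(3) by blast
    have "(\<Sum>i<n. (a(n := w)) i * unif ^ i) = (\<Sum>i<n. a i * unif ^ i)" by (rule sum.cong) auto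
    moreover have "x' = w + unif * x''" using x''(2) by (simp add: algebra_simps)
    ultimately have "x = (\<Sum>i<Suc n. (a(n := w)) i * unif ^ i) + unif ^ Suc n * x''"
      unfolding a(3) by (simp add: algebra_simps)
    moreover have "(a(n := w)) i \<in> W" for i using a(1) w(1) teich_in_sums teich_sums_W by auto
    ultimately show ?case using x''(1) by blast
  qed
  have step: "\<exists>w x'. w \<in> W_span e \<and> x' \<in> integers av K \<and> x = w + P * x'" if x: "x \<in> integers av K" for x
  proof -
    obtain a x' where a: "\<forall>i. a i \<in> W" "x' \<in> integers av K" "x = (\<Sum>i<e. a i * unif ^ i) + unif ^ e * x'"
      using expand[OF x, of e] by blast
    have "unif ^ e = P * inverse u" using pow_div by (simp add: field_simps)
    then have "x = (\<Sum>i<e. a i * unif ^ i) + P * (inverse u * x')" using a(3) by (simp add: mult.assoc)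
    moreover have "inverse u * x' \<in> integers av K"
      using a(2) u inv subringD(4)[OF ring] by (auto simp: integers_def av_mult av_inverse)
    moreover have "(\<Sum>i<e. a i * unif ^ i) \<in> W_span e" using a(1) by (auto simp: W_span_def)
    ultimately show ?thesis by blast
  qed
  have "integers av K \<subseteq> W_span e"
  proof
    fix x assume x: "x \<in> integers av K"
    have "\<forall>x\<in>integers av K. \<exists>g. fst g \<in> W_span e \<and> snd g \<in> integers av K \<and> x = fst g + P * snd g"
      using step by fastforce
    from bchoice[OF this] obtain g where g: "\<And>x. x \<in> integers av K \<Longrightarrow> fst (g x) \<in> W_span e"
      "\<And>x. x \<in> integers av K \<Longrightarrow> snd (g x) \<in> integers av K"
      "\<And>x. x \<in> integers av K \<Longrightarrow> x = fst (g x) + P * snd (g x)" by blast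
    \<comment> \<open>\<open>X n\<close> is the remainder after \<open>n\<close> steps of the p-adic
      expansion of \<open>x\<close>.\<close>
    define X where "X n = ((\<lambda>x. snd (g x)) ^^ n) x" for n
    have X: "X n \<in> integers av K" for n
      by (induction n) (auto simp: X_def x intro: g(2))
    have X_eq: "x = (\<Sum>k<n. P ^ k * fst (g (X k))) + P ^ n * X n" for n
    proof (induction n)
      case (Suc n)
      have "X n = fst (g (X n)) + P * X (Suc n)" using g(3)[OF X[of n]] by (simp add: X_def)
      then have "P ^ n * X n = P ^ n * fst (g (X n)) + P ^ Suc n * X (Suc n)"
        using distrib_left[of "P ^ n" "fst (g (X n))" "P * X (Suc n)"] by (simp add: mult_ac)
      then show ?case using Suc by (simp add: add.assoc)
    qed (simp add: X_def)
    obtain l where l: "l \<in> W_span e" "conv (\<lambda>n. \<Sum>k<n. P ^ k * fst (g (X k))) l"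
      using W_span_series[of "\<lambda>k. fst (g (X k))" e] g(1)[OF X] by blast
    have "conv (\<lambda>n. \<Sum>k<n. P ^ k * fst (g (X k))) x"
    proof (rule convI_bound[OF _ p_powers_tendsto_0])
      fix n
      have "(\<Sum>k<n. P ^ k * fst (g (X k))) - x = - (P ^ n * X n)" using X_eq[of n] by (simp add: algebra_simps)
      then have "av ((\<Sum>k<n. P ^ k * fst (g (X k))) - x) = (1 / real p) ^ n * av (X n)"
        by (simp add: av_mult av_P_power)
      also have "\<dots> \<le> (1 / real p) ^ n * 1" using X[of n] by (intro mult_left_mono) (auto simp: integers_def)
      finally show "av ((\<Sum>k<n. P ^ k * fst (g (X k))) - x) \<le> (1 / real p) ^ n" by simp
    qed
    then show "x \<in> W_span e" using l conv_unique by blast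
  qed
  then show ?thesis using field unifK unif0 PK \<open>0 < e\<close> P_div \<open>av (unif ^ e / P) \<le> 1\<close> by blast
qed

text \<open>Every power of \<open>unif\<close> is an integer of \<open>K\<close> and so reduces to
  degree below \<open>e\<close>; hence adjoining \<open>unif\<close> to \<open>W\<close> gives just
  \<open>W_span e\<close>. This span contains all integers of \<open>K\<close>, in particular p/unif
  and unif^e/p, which turns estimates of absolute values into divisibility in
  \<open>'r\<close>.\<close>

lemma R_pi_structure:
  "\<exists>e>0. range emb = W_span e \<and> P / unif \<in> range emb \<and> unif ^ e / P \<in> range emb \<and> unif \<noteq> 0 \<and> av unif < 1"
proof -
  obtain K e where K: "is_subfield K" "unif \<in> K" "P \<in> K" "av unif < 1" "unif \<noteq> 0" "0 < e"
    "av (P / unif) \<le> 1" "av (unif ^ e / P) \<le> 1" "integers av K \<subseteq> W_span e"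
    using integers_in_W_span by blast
  then have ring: "subring K" by (simp add: subfield_iff)
  have span_add: "x + y \<in> W_span e" if "x \<in> W_span e" "y \<in> W_span e" for x y
  proof -
    from that obtain a b where ab: "x = (\<Sum>i<e. a i * unif ^ i)" "y = (\<Sum>i<e. b i * unif ^ i)"
      "\<forall>i. a i \<in> W" "\<forall>i. b i \<in> W" by (auto simp: W_span_def)
    then have "x + y = (\<Sum>i<e. (a i + b i) * unif ^ i)" by (simp add: distrib_right sum.distrib)
    then show ?thesis by (rule W_spanI) (use ab W_ring(6) in blast)
  qed
  have span_smult: "c * x \<in> W_span e" if "x \<in> W_span e" "c \<in> W" for c x
  proof -
    from that obtain a where a: "x = (\<Sum>i<e. a i * unif ^ i)" "\<forall>i. a i \<in> W" by (auto simp: W_span_def)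
    then have "c * x = (\<Sum>i<e. (c * a i) * unif ^ i)" by (simp add: sum_distrib_left mult.assoc)
    then show ?thesis by (rule W_spanI) (use a that W_ring(4) in blast)
  qed
  have span_0: "0 \<in> W_span e" using W_ring(2) by (auto simp: W_span_def intro!: exI[of _ "\<lambda>_. 0"])
  have span_sum: "(\<And>i. i \<in> I \<Longrightarrow> f i \<in> W_span e) \<Longrightarrow> sum f I \<in> W_span e" for f and I :: "nat set"
    by (induction I rule: infinite_finite_induct) (auto intro: span_0 span_add)
  have pow: "unif ^ i \<in> W_span e" for i
    using K(2,4,9) subring_power[OF ring K(2)] av_power_le_1[of unif] by (auto simp: integers_def)
  have "range emb = W_span e"
    unfolding emb_range R_ring_eq_W
  proof (intro equalityI subsetI)
    fix x assume "x \<in> adjoin W unif"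
    then obtain f where f: "x = poly f unif" "\<forall>i. coeff f i \<in> W" by (auto simp: adjoin_def)
    then show "x \<in> W_span e" unfolding f(1) poly_altdef
      by (intro span_sum span_smult pow) auto
  next
    fix x assume "x \<in> W_span e"
    then obtain a where a: "x = (\<Sum>i<e. a i * unif ^ i)" "\<forall>i. a i \<in> W" by (auto simp: W_span_def)
    define f where "f = (\<Sum>i<e. monom (a i) i)"
    have "poly f unif = x" by (simp add: f_def poly_sum poly_monom a)
    moreover have "coeff f i \<in> W" for i
      unfolding f_def coeff_sum using a(2) W_ring(2) by (intro subring_sum[OF subring_W]) auto
    ultimately show "x \<in> adjoin W unif" unfolding adjoin_def by blast
  qed
  moreover have "P / unif \<in> integers av K" "unif ^ e / P \<in> integers av K"
    using K subring_power[OF ring] by (auto simp: integers_def is_subfield_def)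
  ultimately show ?thesis using K(4,5,6,9) by (intro exI[of _ e]) auto
qed

lemma pi_dvd_p: "\<pi> dvd of_nat p"
proof -
  obtain c where "P / unif = emb c" "unif \<noteq> 0" using R_pi_structure by (metis imageE)
  then have "emb (of_nat p) = emb (\<pi> * c)" by (simp add: emb_mult field_simps)
  then show ?thesis by (simp only: emb_eq_iff) simp
qed

lemma p_dvd_pi_power: "\<exists>e>0. of_nat p dvd \<pi> ^ e"
proof -
  obtain e c where e: "0 < e" "unif ^ e / P = emb c" using R_pi_structure by (metis imageE)
  then have "emb (\<pi> ^ e) = emb (of_nat p * c)" by (simp add: emb_mult emb_power field_simps)
  then have "of_nat p dvd \<pi> ^ e" by (simp only: emb_eq_iff) simp
  then show ?thesis using e(1) by blast
qed

lemma p_nonzero_R_pi: "of_nat p \<noteq> (0::'r)"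
  using emb_of_nat[of p] by (metis P_nonzero emb_0)

lemma av_emb: "av (emb x) \<le> 1"
proof -
  obtain e where e: "range emb = W_span e" "av unif < 1" using R_pi_structure by blast
  then obtain a where a: "emb x = (\<Sum>i<e. a i * unif ^ i)" "\<forall>i. a i \<in> W" unfolding W_span_def by blast
  show ?thesis unfolding a(1)
    using a(2) e(2) av_W by (intro av_sum_bound av_mult_le_1 av_power_le_1) auto
qed

lemma p_not_unit: "\<not> of_nat p dvd (1::'r)"
proof
  assume "of_nat p dvd (1::'r)"
  then obtain c where "of_nat p * c = (1::'r)" by (metis dvdE)
  then have "P * emb c = 1" by (metis emb_1 emb_mult emb_of_nat)
  then have "1 / real p * av (emb c) = 1" by (metis av_1 av_mult av_p)
  moreover have "1 / real p * av (emb c) \<le> 1 / real p * 1" using av_emb by (intro mult_left_mono) auto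
  ultimately show False using inv_p_less_1(1) by linarith
qed

text \<open>As p is odd, 1/2 is a rational number of absolute value 1, hence an integer of the
  maximal unramified extension.\<close>

lemma two_dvd_1: "2 dvd (1::'r)"
proof -
  obtain k where k: "p = 2 * k + 1" using odd_p by (auto elim: oddE)
  have "\<not> int p dvd 2"
    using k p_gt_1 by (auto dest!: zdvd_imp_le)
  then have "av 2 = 1" using av_of_int_prime_to_p[of 2] by simp
  then have "inverse 2 \<in> integers av (Q_p_ur p av)"
    using subfield_Rats[OF subfield_Q_p_ur] by (auto simp: integers_def av_divide inverse_eq_divide)
  then have "inverse 2 \<in> W" using closure_subset R_ring_eq_W unfolding R_ring_def by blast
  moreover have "W \<subseteq> range emb"
  proof
    fix x assume "x \<in> W"
    then have "x = poly [:x:] unif" "\<forall>i. coeff [:x:] i \<in> W" using W_ring(2) by (auto simp: coeff_pCons split: nat.splits)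
    then show "x \<in> range emb" unfolding emb_range R_ring_eq_W adjoin_def by blast
  qed
  ultimately obtain h where "inverse 2 = emb h" by blast
  then have "emb (of_nat 2 * h) = emb 1" unfolding emb_mult emb_of_nat by (simp flip: \<open>inverse 2 = emb h\<close>)
  then show ?thesis by (metis dvd_triv_left emb_eq_iff of_nat_numeral)
qed

lemma padic_complete_R_pi: "padic_complete p TYPE('r)"
  unfolding padic_complete_def
proof (intro conjI allI impI)
  fix a :: 'r assume a: "\<forall>n. of_nat p ^ n dvd a"
  have "av (emb a) \<le> (1 / real p) ^ n" for n
  proof -
    obtain b where "a = of_nat p ^ n * b" using a by (metis dvdE)
    then have "av (emb a) = (1 / real p) ^ n * av (emb b)"
      by (simp add: emb_mult emb_power av_mult av_P_power)
    also have "\<dots> \<le> (1 / real p) ^ n * 1" using av_emb by (intro mult_left_mono) auto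
    finally show ?thesis by simp
  qed
  then have "av (emb a) \<le> 0" using p_powers_tendsto_0 by (meson LIMSEQ_le_const)
  then have "emb a = emb 0" using av_nonneg[of "emb a"] av_eq_0_iff[of "emb a"] by simp
  then show "a = 0" by (simp only: emb_eq_iff)
next
  fix X :: "nat \<Rightarrow> 'r" assume X: "\<forall>n. of_nat p ^ n dvd X (Suc n) - X n"
  obtain e where e: "range emb = W_span e" using R_pi_structure by blast
  have "\<forall>n. \<exists>w. X (Suc n) - X n = of_nat p ^ n * w" using X by (metis dvdE)
  from choice[OF this] obtain w where w: "\<And>n. X (Suc n) - X n = of_nat p ^ n * w n" by blast
  \<comment> \<open>The tails of the series are summed from every starting index \<open>m\<close>,
    not only from 0: \<open>y n\<close> becomes the cofactor that witnesses the divisibility by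
    p^n.\<close>
  have "\<exists>y. conv (\<lambda>n. \<Sum>k<n. P ^ k * emb (w (m + k))) (emb y)" for m
  proof -
    have "emb (w (m + k)) \<in> W_span e" for k using e by auto
    then obtain l where "l \<in> W_span e" "conv (\<lambda>n. \<Sum>k<n. P ^ k * emb (w (m + k))) l"
      using W_span_series[of "\<lambda>k. emb (w (m + k))" e] by blast
    then show ?thesis unfolding e[symmetric] by auto
  qed
  then have "\<forall>m. \<exists>y. conv (\<lambda>n. \<Sum>k<n. P ^ k * emb (w (m + k))) (emb y)" by blast
  from choice[OF this] obtain y where
    y: "\<And>m. conv (\<lambda>n. \<Sum>k<n. P ^ k * emb (w (m + k))) (emb (y m))" by blast
  have X_eq: "X n = X 0 + (\<Sum>k<n. of_nat p ^ k * w k)" for n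
  proof (induction n)
    case (Suc n)
    have "X (Suc n) = X n + of_nat p ^ n * w n" using w[of n] by (simp add: algebra_simps)
    then show ?case using Suc by (simp add: add.assoc)
  qed simp
  have "of_nat p ^ n dvd X 0 + y 0 - X n" for n
  proof -
    have "(\<Sum>k<m + n. P ^ k * emb (w k)) =
        (\<Sum>k<n. P ^ k * emb (w k)) + P ^ n * (\<Sum>k<m. P ^ k * emb (w (n + k)))" for m
      by (induction m) (simp_all add: algebra_simps power_add)
    then have "conv (\<lambda>m. \<Sum>k<m + n. P ^ k * emb (w k)) ((\<Sum>k<n. P ^ k * emb (w k)) + P ^ n * emb (y n))"
      using conv_add[OF conv_const conv_cmult[OF y[of n]]] by simp
    moreover have "conv (\<lambda>m. \<Sum>k<m + n. P ^ k * emb (w k)) (emb (y 0))"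
      using conv_offset[OF y[of 0], of n] by simp
    ultimately have "emb (y 0) = (\<Sum>k<n. P ^ k * emb (w k)) + P ^ n * emb (y n)"
      using conv_unique by blast
    also have "\<dots> = emb ((\<Sum>k<n. of_nat p ^ k * w k) + of_nat p ^ n * y n)"
    proof -
      have "(\<Sum>k<n. P ^ k * emb (w k)) = emb (\<Sum>k<n. of_nat p ^ k * w k)"
        by (induction n) (auto simp: emb_add emb_mult emb_power)
      then show ?thesis by (simp add: emb_add emb_mult emb_power)
    qed
    finally have "y 0 = (\<Sum>k<n. of_nat p ^ k * w k) + of_nat p ^ n * y n" by (simp only: emb_eq_iff)
    then have "X 0 + y 0 - X n = of_nat p ^ n * y n" unfolding X_eq[of n] by simp
    then show ?thesis by simp
  qed
  then show "\<exists>l. \<forall>n. of_nat p ^ n dvd l - X n" by blast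
qed

end

section \<open>Ring homomorphisms\<close>

lemma ring_homD:
  assumes "is_ring_hom h"
  shows "h 1 = 1" "h (x + y) = h x + h y" "h (x * y) = h x * h y"
  using assms by (auto simp: is_ring_hom_def)

lemma ring_hom_0: "is_ring_hom h \<Longrightarrow> h 0 = 0"
  using ring_homD(2)[of h 0 0] by simp

lemma ring_hom_minus: "is_ring_hom h \<Longrightarrow> h (- x) = - h x"
  using ring_homD(2)[of h x "- x"] by (simp add: ring_hom_0 eq_neg_iff_add_eq_0 add.commute)

lemma ring_hom_diff: "is_ring_hom h \<Longrightarrow> h (x - y) = h x - h y"
  using ring_homD(2)[of h x "- y"] by (simp add: ring_hom_minus)

lemma ring_hom_power: "is_ring_hom h \<Longrightarrow> h (x ^ n) = h x ^ n"
  by (induction n) (auto simp: ring_homD)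

lemma ring_hom_of_nat: "is_ring_hom h \<Longrightarrow> h (of_nat n) = of_nat n"
  by (induction n) (auto simp: ring_homD ring_hom_0)

lemma ring_hom_of_int: "is_ring_hom h \<Longrightarrow> h (of_int n) = of_int n"
  by (cases n rule: int_cases2) (auto simp: ring_hom_minus ring_hom_of_nat)

lemma ring_hom_sum: "is_ring_hom h \<Longrightarrow> h (sum f A) = (\<Sum>x\<in>A. h (f x))"
  by (induction A rule: infinite_finite_induct) (auto simp: ring_homD ring_hom_0)

lemma ring_hom_prod: "is_ring_hom h \<Longrightarrow> h (prod f A) = (\<Prod>x\<in>A. h (f x))"
  by (induction A rule: infinite_finite_induct) (auto simp: ring_homD)

lemma ring_hom_dvd: "is_ring_hom h \<Longrightarrow> a dvd b \<Longrightarrow> h a dvd h b"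
  by (auto simp: ring_homD elim!: dvdE)

lemma ring_hom_comp: "is_ring_hom g \<Longrightarrow> is_ring_hom h \<Longrightarrow> is_ring_hom (g \<circ> h)"
  by (simp add: is_ring_hom_def)

lemma ring_hom_det: "is_ring_hom h \<Longrightarrow> h (det M) = det (map_matrix h M)"
  by (simp add: det_def ring_hom_sum ring_hom_prod ring_homD ring_hom_of_int map_matrix_def)

lemma ring_hom_matrix_mult:
  "is_ring_hom h \<Longrightarrow> map_matrix h (M ** N) = map_matrix h M ** map_matrix h N"
  by (simp add: matrix_matrix_mult_def map_matrix_def vec_eq_iff ring_hom_sum ring_homD)

lemma ring_hom_transpose: "map_matrix h (transpose M) = transpose (map_matrix h M)"
  by (simp add: transpose_def map_matrix_def)

lemma ring_hom_mat_1: "is_ring_hom h \<Longrightarrow> map_matrix h (mat 1) = mat 1"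
  by (simp add: mat_def map_matrix_def vec_eq_iff ring_homD ring_hom_0)

section \<open>Completions\<close>

lemma padic_completeD:
  fixes a :: "'a::comm_ring_1" and X :: "nat \<Rightarrow> 'a"
  assumes "padic_complete p TYPE('a)"
  shows "(\<And>n. of_nat p ^ n dvd a) \<Longrightarrow> a = 0"
    "(\<And>n. of_nat p ^ n dvd X (Suc n) - X n) \<Longrightarrow> \<exists>l. \<forall>n. of_nat p ^ n dvd l - X n"
  using assms unfolding padic_complete_def by auto

lemma padic_separated:
  fixes a b :: "'a::comm_ring_1"
  assumes "padic_complete p TYPE('a)" "\<And>n. of_nat p ^ n dvd a - b"
  shows "a = b"
  using padic_completeD(1)[OF assms(1), of "a - b"] assms(2) by simp

lemma dvd_diff_swap: "c dvd a - b \<Longrightarrow> c dvd b - (a::'a::comm_ring_1)"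
  by (metis dvd_minus_iff minus_diff_eq)

text \<open>The first condition excludes the degenerate value of \<open>pgen\<close>, so that the
  completion is the p-adic one; the second allows coherent sequences to be divided by powers of
  p.\<close>

locale completion =
  fixes P :: "'p::finite itself" and B :: "'b::comm_ring_1 itself"
  assumes p_nonunit: "\<not> of_nat CARD('p) dvd (1::'b)"
    and p_regular: "of_nat CARD('p) * (b::'b) = 0 \<Longrightarrow> b = 0"
begin

lemma pgen_eq: "pgen TYPE('p) = (of_nat CARD('p) :: 'b)"
  using p_nonunit by (simp add: pgen_def)

lemma coherent_iff: "coherent TYPE('p) X \<longleftrightarrow> (\<forall>n. of_nat CARD('p) ^ n dvd X (Suc n) - (X n :: 'b))"
  by (simp add: coherent_def pgen_eq)

lemma pcompl_rel_iff:
  "pcompl_rel TYPE('p) X Y \<longleftrightarrow> coherent TYPE('p) X \<and> coherent TYPE('p) Y \<and>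
     (\<forall>n. of_nat CARD('p) ^ n dvd X n - (Y n :: 'b))"
  by (simp add: pcompl_rel_def pgen_eq)

lemma pcompl_rel_self: "coherent TYPE('p) (X :: nat \<Rightarrow> 'b) \<Longrightarrow> pcompl_rel TYPE('p) X X"
  by (simp add: pcompl_rel_iff)

lemma coherent_const: "coherent TYPE('p) (\<lambda>_. c :: 'b)"
  by (simp add: coherent_iff)

lemma coherent_rep: "coherent TYPE('p) (rep_pcompl (a :: ('p, 'b) pcompl))"
  using rep_pcompl_refl[of a] by (simp add: pcompl_rel_def)

lemma pcompl_cases:
  obtains X where "coherent TYPE('p) X" "a = (abs_pcompl X :: ('p, 'b) pcompl)"
  using coherent_rep[of a] abs_rep_pcompl[of a] by metis

lemma abs_pcompl_eq_iff:
  assumes "coherent TYPE('p) X" "coherent TYPE('p) Y"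
  shows "(abs_pcompl X :: ('p, 'b) pcompl) = abs_pcompl Y \<longleftrightarrow> (\<forall>n. of_nat CARD('p) ^ n dvd X n - Y n)"
  using Quotient3_rel[OF Quotient3_pcompl[where 'p = 'p and 'b = 'b], of X Y] assms
  by (simp add: pcompl_rel_iff)

lemma coherent_mono:
  assumes "coherent TYPE('p) (X :: nat \<Rightarrow> 'b)"
  shows "of_nat CARD('p) ^ n dvd X (n + k) - X n"
proof (induction k)
  case (Suc k)
  have "of_nat CARD('p) ^ n dvd (of_nat CARD('p) ^ (n + k) :: 'b)" by (simp add: power_add)
  then have "of_nat CARD('p) ^ n dvd X (Suc (n + k)) - X (n + k)"
    using assms by (meson coherent_iff dvd_trans)
  then have "of_nat CARD('p) ^ n dvd (X (Suc (n + k)) - X (n + k)) + (X (n + k) - X n)"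
    using Suc by (rule dvd_add)
  then show ?case by simp
qed simp

lemma p_pow_regular: "of_nat CARD('p) ^ n * (b::'b) = 0 \<Longrightarrow> b = 0"
  by (induction n arbitrary: b) (auto simp: mult.assoc dest: p_regular)

lemma p_pow_cancel: "of_nat CARD('p) ^ n * (a::'b) dvd of_nat CARD('p) ^ n * b \<Longrightarrow> a dvd b"
proof -
  assume "of_nat CARD('p) ^ n * a dvd of_nat CARD('p) ^ n * b"
  then obtain c where "of_nat CARD('p) ^ n * b = of_nat CARD('p) ^ n * a * c" by (auto elim: dvdE)
  then have "of_nat CARD('p) ^ n * (b - a * c) = 0" by (simp add: algebra_simps)
  then have "b - a * c = 0" by (rule p_pow_regular)
  then show "a dvd b" by simp
qed

lemma coherent_scale: "coherent TYPE('p) (X :: nat \<Rightarrow> 'b) \<Longrightarrow> coherent TYPE('p) (\<lambda>n. c * X n)"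
  by (simp add: coherent_iff flip: right_diff_distrib)

lemma ring_hom_to_pcompl: "is_ring_hom (to_pcompl :: 'b \<Rightarrow> ('p, 'b) pcompl)"
  unfolding is_ring_hom_def to_pcompl_def
  by (simp add: one_pcompl_def abs_pcompl_add abs_pcompl_mult pcompl_rel_const)

lemma p_pow_times_abs:
  assumes "coherent TYPE('p) X"
  shows "of_nat CARD('p) ^ n * (abs_pcompl X :: ('p, 'b) pcompl) = abs_pcompl (\<lambda>k. of_nat CARD('p) ^ n * X k)"
proof -
  have "(of_nat CARD('p) ^ n :: ('p, 'b) pcompl) = to_pcompl (of_nat CARD('p) ^ n)"
    by (simp add: ring_hom_power[OF ring_hom_to_pcompl] ring_hom_of_nat[OF ring_hom_to_pcompl])
  then show ?thesis
    using assms by (simp add: to_pcompl_def abs_pcompl_mult pcompl_rel_const pcompl_rel_self)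
qed

text \<open>This identifies the kernel of the projection to the quotient by p^n. If p^n divides the
  n-th entry, it divides all later ones, and their quotients are again coherent by
  regularity.\<close>

lemma p_pow_dvd_abs_iff:
  assumes X: "coherent TYPE('p) X"
  shows "of_nat CARD('p) ^ n dvd (abs_pcompl X :: ('p, 'b) pcompl) \<longleftrightarrow> of_nat CARD('p) ^ n dvd X n"
proof
  assume "of_nat CARD('p) ^ n dvd (abs_pcompl X :: ('p, 'b) pcompl)"
  then obtain a :: "('p, 'b) pcompl" where a: "abs_pcompl X = of_nat CARD('p) ^ n * a" by (auto elim: dvdE)
  obtain Y where Y: "coherent TYPE('p) Y" "a = abs_pcompl Y" by (rule pcompl_cases)
  have "of_nat CARD('p) ^ n dvd X n - of_nat CARD('p) ^ n * Y n"
    using a abs_pcompl_eq_iff[OF X coherent_scale[OF Y(1)]] unfolding Y(2) p_pow_times_abs[OF Y(1)]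
    by blast
  then have "of_nat CARD('p) ^ n dvd (X n - of_nat CARD('p) ^ n * Y n) + of_nat CARD('p) ^ n * Y n" by (rule dvd_add) simp
  then show "of_nat CARD('p) ^ n dvd X n" by simp
next
  assume dvd: "of_nat CARD('p) ^ n dvd X n"
  have "\<forall>k. \<exists>d. X (n + k) = of_nat CARD('p) ^ n * d"
  proof
    fix k
    have "of_nat CARD('p) ^ n dvd (X (n + k) - X n) + X n" by (rule dvd_add[OF coherent_mono[OF X] dvd])
    then show "\<exists>d. X (n + k) = of_nat CARD('p) ^ n * d" by (simp add: dvd_def)
  qed
  \<comment> \<open>The index is shifted by \<open>n\<close>: the entry at n + k is known modulo
    p^(n+k), so its quotient by p^n is known modulo p^k, as coherence at \<open>k\<close>
    requires.\<close>
  from choice[OF this] obtain D where D: "\<And>k. X (n + k) = of_nat CARD('p) ^ n * D k" by blast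
  have "coherent TYPE('p) D"
    unfolding coherent_iff
  proof
    fix k
    have "of_nat CARD('p) ^ (n + k) dvd X (Suc (n + k)) - X (n + k)" using X by (simp add: coherent_iff)
    then have "of_nat CARD('p) ^ n * of_nat CARD('p) ^ k dvd of_nat CARD('p) ^ n * (D (Suc k) - D k)"
      using D[of "Suc k"] D[of k] by (simp add: power_add right_diff_distrib)
    then show "of_nat CARD('p) ^ k dvd D (Suc k) - D k" by (rule p_pow_cancel)
  qed
  moreover have "of_nat CARD('p) ^ k dvd X k - of_nat CARD('p) ^ n * D k" for k
  proof -
    have "of_nat CARD('p) ^ k dvd X (k + n) - X k" by (rule coherent_mono[OF X])
    then show ?thesis using D[of k] dvd_diff_swap by (simp add: add.commute)
  qed
  ultimately have "(abs_pcompl X :: ('p, 'b) pcompl) = of_nat CARD('p) ^ n * abs_pcompl D"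
    using abs_pcompl_eq_iff[OF X coherent_scale] by (simp add: p_pow_times_abs)
  then show "of_nat CARD('p) ^ n dvd (abs_pcompl X :: ('p, 'b) pcompl)" by simp
qed

lemma abs_minus_to_pcompl:
  assumes "coherent TYPE('p) X"
  shows "abs_pcompl X - to_pcompl b = (abs_pcompl (\<lambda>k. X k - b) :: ('p, 'b) pcompl)"
    and "coherent TYPE('p) (\<lambda>k. X k - b)"
proof -
  have "pcompl_rel TYPE('p) (\<lambda>_. - b) (\<lambda>_. - b)" by (rule pcompl_rel_const)
  then show "abs_pcompl X - to_pcompl b = (abs_pcompl (\<lambda>k. X k - b) :: ('p, 'b) pcompl)"
    unfolding to_pcompl_def minus_pcompl_def
    using assms by (simp add: abs_pcompl_uminus abs_pcompl_add pcompl_rel_const pcompl_rel_self)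
  show "coherent TYPE('p) (\<lambda>k. X k - b)" using assms by (simp add: coherent_iff)
qed

lemma p_pow_dvd_abs_minus:
  assumes "coherent TYPE('p) X"
  shows "of_nat CARD('p) ^ n dvd abs_pcompl X - (to_pcompl (X n) :: ('p, 'b) pcompl)"
  unfolding abs_minus_to_pcompl(1)[OF assms] p_pow_dvd_abs_iff[OF abs_minus_to_pcompl(2)[OF assms]]
  by simp

lemma to_pcompl_dense: "\<exists>b. of_nat CARD('p) ^ n dvd a - (to_pcompl b :: ('p, 'b) pcompl)"
  using p_pow_dvd_abs_minus by (metis pcompl_cases)

lemma p_pow_dvd_to_pcompl: "of_nat CARD('p) ^ n dvd (to_pcompl b :: ('p, 'b) pcompl) \<longleftrightarrow> of_nat CARD('p) ^ n dvd b"
  unfolding to_pcompl_def by (simp add: p_pow_dvd_abs_iff[OF coherent_const])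

text \<open>A diagonal argument: elements of the original ring that approximate the n-th term modulo
  p^n form a coherent sequence, and this sequence represents the limit.\<close>

lemma pcompl_complete: "padic_complete CARD('p) TYPE(('p, 'b) pcompl)"
  unfolding padic_complete_def
proof (intro conjI allI impI)
  fix a :: "('p, 'b) pcompl" assume a: "\<forall>n. of_nat CARD('p) ^ n dvd a"
  obtain X where X: "coherent TYPE('p) X" "a = abs_pcompl X" by (rule pcompl_cases)
  have "\<forall>n. of_nat CARD('p) ^ n dvd X n - 0" using a unfolding X(2) p_pow_dvd_abs_iff[OF X(1)] by simp
  then show "a = 0"
    unfolding X(2) zero_pcompl_def abs_pcompl_eq_iff[OF X(1) coherent_const] .
next
  fix A :: "nat \<Rightarrow> ('p, 'b) pcompl" assume A: "\<forall>n. of_nat CARD('p) ^ n dvd A (Suc n) - A n"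
  have "\<forall>n. \<exists>b. of_nat CARD('p) ^ n dvd A n - to_pcompl b" using to_pcompl_dense by blast
  from choice[OF this] obtain b where b: "\<And>n. of_nat CARD('p) ^ n dvd A n - to_pcompl (b n)" by blast
  have "of_nat CARD('p) ^ n dvd b (Suc n) - b n" for n
  proof -
    have "(of_nat CARD('p) ^ n :: ('p, 'b) pcompl) dvd of_nat CARD('p) ^ (Suc n)" by (simp add: power_Suc2)
    then have "of_nat CARD('p) ^ n dvd A (Suc n) - to_pcompl (b (Suc n))" using b dvd_trans by blast
    from dvd_diff[OF dvd_add[OF spec[OF A] b] this]
    have "(of_nat CARD('p) ^ n :: ('p, 'b) pcompl) dvd to_pcompl (b (Suc n)) - to_pcompl (b n)" by simp
    then show ?thesis
      unfolding ring_hom_diff[OF ring_hom_to_pcompl, symmetric] p_pow_dvd_to_pcompl .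
  qed
  then have coh: "coherent TYPE('p) b" by (simp add: coherent_iff)
  have "of_nat CARD('p) ^ n dvd abs_pcompl b - A n" for n
    using dvd_diff[OF p_pow_dvd_abs_minus[OF coh] b[of n]] by simp
  then show "\<exists>l. \<forall>n. of_nat CARD('p) ^ n dvd l - A n" by blast
qed

text \<open>Dividing a relation modulo p^(k+1) by p loses one power, which is absorbed by comparing
  the entries at k + 1 and k.\<close>

lemma pcompl_p_regular:
  fixes a :: "('p, 'b) pcompl"
  assumes "of_nat CARD('p) * a = 0"
  shows "a = 0"
proof -
  obtain X where X: "coherent TYPE('p) X" "a = abs_pcompl X" by (rule pcompl_cases)
  have "abs_pcompl (\<lambda>k. of_nat CARD('p) ^ 1 * X k) = (abs_pcompl (\<lambda>_. 0) :: ('p, 'b) pcompl)"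
    using assms p_pow_times_abs[OF X(1), of 1] unfolding X(2) zero_pcompl_def by simp
  then have dvd: "\<forall>k. of_nat CARD('p) ^ k dvd of_nat CARD('p) ^ 1 * X k - 0"
    unfolding abs_pcompl_eq_iff[OF coherent_scale[OF X(1)] coherent_const] .
  have "of_nat CARD('p) ^ k dvd X k - 0" for k
  proof -
    have "of_nat CARD('p) ^ 1 * of_nat CARD('p) ^ k dvd of_nat CARD('p) ^ 1 * X (Suc k)" using dvd[rule_format, of "Suc k"] by simp
    then have "of_nat CARD('p) ^ k dvd X (Suc k)" by (rule p_pow_cancel)
    moreover have "of_nat CARD('p) ^ k dvd X (Suc k) - X k" using X(1) by (simp add: coherent_iff)
    ultimately have "of_nat CARD('p) ^ k dvd X (Suc k) - (X (Suc k) - X k)" by (rule dvd_diff)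
    then show ?thesis by simp
  qed
  then show ?thesis unfolding X(2) zero_pcompl_def abs_pcompl_eq_iff[OF X(1) coherent_const] by blast
qed

text \<open>Ring homomorphisms preserve divisibility by p^n, so the images of a coherent sequence
  converge in the complete target; separatedness makes the chosen limit unique and with it the map
  additive and multiplicative.\<close>

lemma pcompl_hom_exists:
  fixes g :: "'b \<Rightarrow> 'c::comm_ring_1"
  assumes "is_ring_hom g" and complete: "padic_complete CARD('p) TYPE('c)"
  shows "\<exists>h :: ('p, 'b) pcompl \<Rightarrow> 'c. is_ring_hom h \<and> (\<forall>b. h (to_pcompl b) = g b)"
proof -
  have g_dvd: "of_nat CARD('p) ^ n dvd g x - g y" if "of_nat CARD('p) ^ n dvd x - y" for n x y
    using ring_hom_dvd[OF assms(1) that]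
    by (simp add: ring_hom_power[OF assms(1)] ring_hom_of_nat[OF assms(1)] ring_hom_diff[OF assms(1)])
  define h :: "('p, 'b) pcompl \<Rightarrow> 'c" where
    "h a = (SOME l. \<forall>n. of_nat CARD('p) ^ n dvd l - g (rep_pcompl a n))" for a
  have h_abs: "of_nat CARD('p) ^ n dvd h (abs_pcompl X) - g (X n)" if X: "coherent TYPE('p) X" for X n
  proof -
    let ?Y = "rep_pcompl (abs_pcompl X :: ('p, 'b) pcompl)"
    have "\<exists>l. \<forall>n. of_nat CARD('p) ^ n dvd l - g (?Y n)"
      by (rule padic_completeD(2)[OF complete]) (use coherent_rep in \<open>auto simp: coherent_iff intro: g_dvd\<close>)
    then have "of_nat CARD('p) ^ n dvd h (abs_pcompl X) - g (?Y n)" unfolding h_def by (rule someI2_ex) blast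
    moreover have "of_nat CARD('p) ^ n dvd ?Y n - X n"
      using pcompl_rel_rep_abs[OF pcompl_rel_self[OF X]] by (simp add: pcompl_rel_iff)
    ultimately have "of_nat CARD('p) ^ n dvd (h (abs_pcompl X) - g (?Y n)) + (g (?Y n) - g (X n))"
      by (intro dvd_add g_dvd)
    then show ?thesis by simp
  qed
  have h_eq: "h (abs_pcompl X) = l" if "coherent TYPE('p) X" "\<And>n. of_nat CARD('p) ^ n dvd l - g (X n)" for X l
  proof (rule padic_separated[OF complete])
    show "of_nat CARD('p) ^ n dvd h (abs_pcompl X) - l" for n
      using dvd_diff[OF h_abs[OF that(1)] that(2)] by simp
  qed
  have h_to: "h (to_pcompl b) = g b" for b
    unfolding to_pcompl_def by (rule h_eq[OF coherent_const]) simp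
  have "is_ring_hom h"
    unfolding is_ring_hom_def
  proof (intro conjI allI)
    show "h 1 = 1"
      using h_to[of 1] by (simp add: ring_homD(1)[OF assms(1)] ring_homD(1)[OF ring_hom_to_pcompl])
    fix x y :: "('p, 'b) pcompl"
    define X Y where "X = rep_pcompl x" and "Y = rep_pcompl y"
    have XY: "coherent TYPE('p) X" "x = abs_pcompl X" "coherent TYPE('p) Y" "y = abs_pcompl Y"
      by (simp_all add: X_def Y_def coherent_rep abs_rep_pcompl)
    note rel = pcompl_rel_self[OF XY(1)] pcompl_rel_self[OF XY(3)]
    have coh: "coherent TYPE('p) (\<lambda>n. X n + Y n)" "coherent TYPE('p) (\<lambda>n. X n * Y n)"
      using pcompl_rel_add[OF rel] pcompl_rel_mult[OF rel] by (simp_all add: pcompl_rel_def)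
    show "h (x + y) = h x + h y"
      unfolding XY abs_pcompl_add[OF rel]
      by (rule h_eq[OF coh(1)]) (simp only: ring_homD[OF assms(1)] dvd_diff_add h_abs XY)
    show "h (x * y) = h x * h y"
      unfolding XY abs_pcompl_mult[OF rel]
      by (rule h_eq[OF coh(2)]) (simp only: ring_homD[OF assms(1)] dvd_diff_mult h_abs XY)
  qed
  then show ?thesis using h_to by blast
qed

end

section \<open>Polynomial rings\<close>

lemma mpoly_induct [case_names const var add mult]:
  fixes f :: "('v, 'r::comm_ring_1) mpoly"
  assumes const: "\<And>a. Q (mconst a)" and var: "\<And>v. Q (mvar v)"
    and add: "\<And>f g. Q f \<Longrightarrow> Q g \<Longrightarrow> Q (f + g)" and mult: "\<And>f g. Q f \<Longrightarrow> Q g \<Longrightarrow> Q (f * g)"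
  shows "Q f"
proof -
  have Q_sum: "(\<And>x. x \<in> A \<Longrightarrow> Q (F x)) \<Longrightarrow> Q (sum F A)" for F and A :: "('v \<Rightarrow>\<^sub>0 nat) set"
    by (induction A rule: infinite_finite_induct) (use const[of 0] in \<open>auto simp: mconst_def intro: add\<close>)
  have one: "Q (Poly_Mapping.single 0 1)" using const[of 1] by (simp add: mconst_def)
  have split: "Q (Poly_Mapping.single (m + m') 1)"
    if "Q (Poly_Mapping.single m 1)" "Q (Poly_Mapping.single m' 1)" for m m'
    using mult[OF that] by (simp add: mult_single)
  have var_power: "Q (Poly_Mapping.single (Poly_Mapping.single v k) 1)" for v k
  proof (induction k)
    case (Suc k)
    have "Poly_Mapping.single v (Suc k) = Poly_Mapping.single v 1 + Poly_Mapping.single v k"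
      by (simp flip: single_add)
    then show ?case using split[OF var[of v, unfolded mvar_def] Suc] by simp
  qed (use one in simp)
  have "Q (Poly_Mapping.single (\<Sum>v\<in>A. Poly_Mapping.single v (c v)) 1)" for c and A :: "'v set"
    by (induction A rule: infinite_finite_induct) (use one in \<open>auto intro: split var_power\<close>)
  then have monom: "Q (Poly_Mapping.single m 1)" for m
    using mpoly_sum_single[of m] by metis
  have "Q (Poly_Mapping.single m a)" for m a
    using mult[OF const[of a] monom[of m]] by (simp add: mconst_def mult_single)
  then show ?thesis using mpoly_sum_single[of f] Q_sum by metis
qed

definition mp_eval :: "('r \<Rightarrow> 'c) \<Rightarrow> ('v \<Rightarrow> 'c) \<Rightarrow> ('v, 'r::comm_ring_1) mpoly \<Rightarrow> 'c::comm_ring_1" where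
  "mp_eval \<sigma> c f = (\<Sum>m\<in>Poly_Mapping.keys f. \<sigma> (Poly_Mapping.lookup f m) *
     (\<Prod>v\<in>Poly_Mapping.keys m. c v ^ Poly_Mapping.lookup m v))"

lemma mp_eval_hom:
  assumes "is_ring_hom \<sigma>"
  shows "is_ring_hom (mp_eval \<sigma> c)" "mp_eval \<sigma> c (mconst a) = \<sigma> a" "mp_eval \<sigma> c (mvar v) = c v"
proof -
  let ?mon = "\<lambda>m. \<Prod>v\<in>Poly_Mapping.keys m. c v ^ Poly_Mapping.lookup m v"
  note \<sigma> = ring_homD[OF assms] ring_hom_0[OF assms]
  have superset: "mp_eval \<sigma> c f = (\<Sum>m\<in>S. \<sigma> (Poly_Mapping.lookup f m) * ?mon m)"
    if "finite S" "Poly_Mapping.keys f \<subseteq> S" for f S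
    unfolding mp_eval_def
    by (rule sum.mono_neutral_left) (use that in \<open>auto simp: in_keys_iff \<sigma>\<close>)
  have single: "mp_eval \<sigma> c (Poly_Mapping.single m a) = \<sigma> a * ?mon m" for m a
    by (subst superset[of "{m}"]) auto
  have add: "mp_eval \<sigma> c (f + g) = mp_eval \<sigma> c f + mp_eval \<sigma> c g" for f g
  proof -
    let ?S = "Poly_Mapping.keys f \<union> Poly_Mapping.keys g"
    have "Poly_Mapping.keys (f + g) \<subseteq> ?S" by (rule Poly_Mapping.keys_add)
    then show ?thesis by (simp add: superset[of ?S] lookup_add distrib_right sum.distrib \<sigma>)
  qed
  have sum: "mp_eval \<sigma> c (sum F A) = (\<Sum>x\<in>A. mp_eval \<sigma> c (F x))" for F and A :: "('v \<Rightarrow>\<^sub>0 nat) set"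
    by (induction A rule: infinite_finite_induct) (auto simp: add, auto simp: mp_eval_def)
  have mult: "mp_eval \<sigma> c (f * g) = mp_eval \<sigma> c f * mp_eval \<sigma> c g" for f g
  proof -
    have "mp_eval \<sigma> c (f * g) = mp_eval \<sigma> c
        ((\<Sum>m\<in>Poly_Mapping.keys f. Poly_Mapping.single m (Poly_Mapping.lookup f m)) *
         (\<Sum>m\<in>Poly_Mapping.keys g. Poly_Mapping.single m (Poly_Mapping.lookup g m)))"
      by (rule arg_cong[where f = "mp_eval \<sigma> c"], rule arg_cong2[where f = "(*)"]; rule mpoly_sum_single)
    also have "\<dots> = mp_eval \<sigma> c f * mp_eval \<sigma> c g"
      unfolding mp_eval_def[of \<sigma> c f] mp_eval_def[of \<sigma> c g] sum_product
      by (simp add: mult_single sum single monomial_add \<sigma> ac_simps)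
    finally show ?thesis .
  qed
  have "mp_eval \<sigma> c 1 = 1" using single[of 0 1] by (simp add: \<sigma>)
  then show "is_ring_hom (mp_eval \<sigma> c)" by (simp add: is_ring_hom_def add mult)
  show "mp_eval \<sigma> c (mconst a) = \<sigma> a" "mp_eval \<sigma> c (mvar v) = c v"
    by (simp_all add: mconst_def mvar_def single \<sigma>)
qed

lemma ring_hom_mconst: "is_ring_hom (mconst :: 'r::comm_ring_1 \<Rightarrow> ('v, 'r) mpoly)"
  by (simp add: is_ring_hom_def mconst_def single_add mult_single)

lemma mconst_mult_eq_0:
  fixes a :: "'r::idom" and f :: "('v, 'r) mpoly"
  assumes "mconst a * f = 0" "a \<noteq> 0"
  shows "f = 0"
proof (rule poly_mapping_eqI)
  fix m
  have "Poly_Mapping.lookup (mconst a * f) m = a * Poly_Mapping.lookup f m"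
    unfolding mconst_def mult_map_scale_conv_mult[symmetric] by (simp add: Poly_Mapping.map.rep_eq when_def)
  then show "Poly_Mapping.lookup f m = Poly_Mapping.lookup 0 m" using assms by simp
qed

lemma ring_hom_id: "is_ring_hom (\<lambda>a. a)"
  by (simp add: is_ring_hom_def)

lemma mpoly_p_nonunit:
  assumes "\<not> of_nat p dvd (1::'r::comm_ring_1)"
  shows "\<not> of_nat p dvd (1::('v, 'r) mpoly)"
proof
  assume "of_nat p dvd (1::('v, 'r) mpoly)"
  from ring_hom_dvd[OF mp_eval_hom(1)[OF ring_hom_id, of "\<lambda>_. 0"] this] show False
    using assms
    by (simp add: ring_hom_of_nat[OF mp_eval_hom(1)[OF ring_hom_id]] ring_homD(1)[OF mp_eval_hom(1)[OF ring_hom_id]])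
qed

lemma completion_mpoly:
  assumes "\<not> of_nat CARD('p::finite) dvd (1::'r::idom)" "of_nat CARD('p) \<noteq> (0::'r)"
  shows "completion TYPE(('v, 'r) mpoly) TYPE('p)"
proof (rule completion.intro)
  show "\<not> of_nat CARD('p) dvd (1::('v, 'r) mpoly)" by (rule mpoly_p_nonunit[OF assms(1)])
  fix f :: "('v, 'r) mpoly" assume "of_nat CARD('p) * f = 0"
  then have "mconst (of_nat CARD('p)) * f = 0" by (simp add: ring_hom_of_nat[OF ring_hom_mconst])
  then show "f = 0" using mconst_mult_eq_0 assms(2) by blast
qed

section \<open>The coordinate ring of the general linear group\<close>

definition det_inv :: "('n::finite, 'r::comm_ring_1) gl_coord" where
  "det_inv = abs_gl_coord (1, 1)"

lemma ring_hom_to_gl_coord: "is_ring_hom (to_gl_coord :: _ \<Rightarrow> ('n::finite, 'r::comm_ring_1) gl_coord)"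
  by (simp add: is_ring_hom_def to_gl_coord_def one_gl_coord.abs_eq plus_gl_coord.abs_eq times_gl_coord.abs_eq)

lemma det_inv: "det_inv * to_gl_coord (det xpoly) = (1 :: ('n::finite, 'r::comm_ring_1) gl_coord)"
  unfolding det_inv_def to_gl_coord_def one_gl_coord.abs_eq times_gl_coord.abs_eq prod.case gl_coord.abs_eq_iff
  by (rule loc_rel_eq) simp

lemma gl_coord_eq: "abs_gl_coord (f, k) = (to_gl_coord f * det_inv ^ k :: ('n::finite, 'r::comm_ring_1) gl_coord)"
proof (induction k)
  case (Suc k)
  have "abs_gl_coord (f, Suc k) = abs_gl_coord (f, k) * det_inv"
    by (simp add: det_inv_def times_gl_coord.abs_eq)
  then show ?case using Suc by (simp add: mult_ac)
qed (simp add: to_gl_coord_def)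

lemma gl_coord_cases: obtains f k where "z = abs_gl_coord (f, k)"
  using gl_coord.abs_induct[of "\<lambda>x. \<exists>f k. x = abs_gl_coord (f, k)" z] by auto

lemma gl_coord_hom_exists:
  fixes g :: "('n::finite \<times> 'n, 'r::comm_ring_1) mpoly \<Rightarrow> 'c::comm_ring_1"
  assumes g: "is_ring_hom g" and u: "u * g (det xpoly) = 1"
  shows "\<exists>h. is_ring_hom h \<and> (\<forall>f. h (to_gl_coord f) = g f)"
proof -
  let ?d = "det xpoly :: ('n \<times> 'n, 'r) mpoly"
  have cancel: "u ^ k * g ?d ^ k = 1" for k using u by (simp flip: power_mult_distrib)
  have wd: "g f * u ^ k = g f' * u ^ k'" if rel: "loc_rel ?d (f, k) (f', k')" for f k f' k'
  proof -
    obtain m where "?d ^ m * (?d ^ k' * f - ?d ^ k * f') = 0" using rel unfolding loc_rel_def prod.case by blast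
    then have "g (?d ^ m * (?d ^ k' * f - ?d ^ k * f')) = 0" by (simp add: ring_hom_0[OF g])
    then have "g ?d ^ m * (g ?d ^ k' * g f - g ?d ^ k * g f') = 0"
      by (simp add: ring_homD[OF g] ring_hom_diff[OF g] ring_hom_power[OF g])
    \<comment> \<open>This power of \<open>u\<close> suffices to cancel every power of the
      determinant.\<close>
    then have "u ^ (m + k + k') * (g ?d ^ m * (g ?d ^ k' * g f - g ?d ^ k * g f')) = 0" by simp
    then have "(u ^ m * g ?d ^ m) * ((u ^ k' * g ?d ^ k') * (g f * u ^ k) - (u ^ k * g ?d ^ k) * (g f' * u ^ k')) = 0"
      by (simp add: power_add algebra_simps)
    then show ?thesis unfolding cancel by simp
  qed
  define h where "h z = (case rep_gl_coord z of (f, k) \<Rightarrow> g f * u ^ k)" for z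
  have h_abs: "h (abs_gl_coord (f, k)) = g f * u ^ k" for f k
  proof -
    obtain f' k' where fk: "rep_gl_coord (abs_gl_coord (f, k)) = (f', k')" by fastforce
    then have "loc_rel ?d (f', k') (f, k)"
      using Quotient3_rep_abs[OF Quotient3_gl_coord] equivp_reflp[OF equivp_loc_rel]
      by (metis (no_types, opaque_lifting))
    then show ?thesis unfolding h_def fk by (simp add: wd)
  qed
  have "is_ring_hom h"
    unfolding is_ring_hom_def
  proof (intro conjI allI)
    show "h 1 = 1" unfolding one_gl_coord.abs_eq h_abs by (simp add: ring_homD[OF g])
    fix x y :: "('n, 'r) gl_coord"
    obtain f k f' k' where xy: "x = abs_gl_coord (f, k)" "y = abs_gl_coord (f', k')"
      by (metis gl_coord_cases)
    have "h (x + y) = (u ^ k' * g ?d ^ k') * (g f * u ^ k) + (u ^ k * g ?d ^ k) * (g f' * u ^ k')"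
      unfolding xy plus_gl_coord.abs_eq prod.case h_abs ring_homD[OF g] ring_hom_power[OF g]
      by (simp add: power_add algebra_simps)
    then show "h (x + y) = h x + h y" unfolding cancel xy h_abs by simp
    show "h (x * y) = h x * h y"
      unfolding xy times_gl_coord.abs_eq prod.case h_abs ring_homD[OF g]
      by (simp add: power_add mult_ac)
  qed
  moreover have "h (to_gl_coord f) = g f" for f unfolding to_gl_coord_def h_abs by simp
  ultimately show ?thesis by blast
qed

lemma gl_coord_induct [case_names const var det_inv add mult]:
  fixes z :: "('n::finite, 'r::comm_ring_1) gl_coord"
  assumes const: "\<And>a. Q (to_gl_coord (mconst a))" and var: "\<And>i j. Q (to_gl_coord (xpoly $ i $ j))"
    and inv: "Q det_inv"
    and add: "\<And>x y. Q x \<Longrightarrow> Q y \<Longrightarrow> Q (x + y)" and mult: "\<And>x y. Q x \<Longrightarrow> Q y \<Longrightarrow> Q (x * y)"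
  shows "Q z"
proof -
  have poly: "Q (to_gl_coord f)" for f
  proof (induction f rule: mpoly_induct)
    case (var v)
    then show ?case using assms(2)[of "fst v" "snd v"] by (simp add: xpoly_def)
  qed (auto simp: ring_homD[OF ring_hom_to_gl_coord] intro: const add mult)
  have "Q 1" using poly[of 1] by (simp add: ring_homD[OF ring_hom_to_gl_coord])
  then have "Q (det_inv ^ k)" for k by (induction k) (auto intro: mult inv)
  then show ?thesis using poly mult gl_coord_eq by (metis gl_coord_cases)
qed

text \<open>Evaluation at the identity matrix maps to \<open>'r\<close>, where p is not a unit. For
  regularity the constant p is cancelled in the polynomial ring, after moving it past the power of
  the determinant that equality of fractions introduces.\<close>

lemma completion_gl_coord:
  assumes "\<not> of_nat CARD('p::finite) dvd (1::'r::idom)" "of_nat CARD('p) \<noteq> (0::'r)"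
  shows "completion TYPE(('n::finite, 'r) gl_coord) TYPE('p)"
proof (rule completion.intro)
  let ?g = "mp_eval (\<lambda>a::'r. a) (\<lambda>(i::'n, j). if i = j then 1 else 0)"
  note g = mp_eval_hom[OF ring_hom_id, of "\<lambda>(i::'n, j). if i = j then 1 else (0::'r)"]
  have "map_matrix ?g xpoly = mat 1"
    by (simp add: map_matrix_def xpoly_def g mat_def vec_eq_iff)
  then have "1 * ?g (det xpoly) = 1" by (simp add: ring_hom_det[OF g(1)])
  from gl_coord_hom_exists[OF g(1) this] obtain h :: "('n, 'r) gl_coord \<Rightarrow> 'r" where h: "is_ring_hom h" by blast
  show "\<not> of_nat CARD('p) dvd (1::('n, 'r) gl_coord)"
    using ring_hom_dvd[OF h, of "of_nat CARD('p)" 1] assms(1)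
    by (auto simp: ring_hom_of_nat[OF h] ring_homD(1)[OF h])
  fix z :: "('n, 'r) gl_coord" assume z: "of_nat CARD('p) * z = 0"
  obtain f k where fk: "z = abs_gl_coord (f, k)" by (rule gl_coord_cases)
  let ?c = "mconst (of_nat CARD('p)) :: ('n \<times> 'n, 'r) mpoly"
  have "(of_nat CARD('p) :: ('n, 'r) gl_coord) = to_gl_coord ?c"
    by (simp add: ring_hom_of_nat[OF ring_hom_to_gl_coord] ring_hom_of_nat[OF ring_hom_mconst])
  then have "abs_gl_coord (?c * f, k) = abs_gl_coord (0, 0)"
    using z unfolding fk to_gl_coord_def zero_gl_coord.abs_eq[symmetric] by (simp add: times_gl_coord.abs_eq)
  then obtain m where "det xpoly ^ m * (?c * f) = 0"
    unfolding gl_coord.abs_eq_iff loc_rel_def by auto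
  then have "?c * (det xpoly ^ m * f) = 0" by (simp add: mult_ac)
  then have "det xpoly ^ m * f = 0" using mconst_mult_eq_0 assms(2) by blast
  then show "z = 0" unfolding fk zero_gl_coord.abs_eq gl_coord.abs_eq_iff loc_rel_def by auto
qed

section \<open>Matrices over commutative rings\<close>

text \<open>The (j, k) entry is the cofactor of the entry (k, j), written as a determinant with row
  \<open>k\<close> replaced by a unit vector, so that row linearity of \<open>det\<close> applies
  directly.\<close>

definition adjugate :: "'a::comm_ring_1 ^ 'n ^ 'n \<Rightarrow> 'a ^ 'n ^ 'n::finite" where
  "adjugate M = (\<chi> j k. det (\<chi> l. if l = k then axis j 1 else M $ l))"

text \<open>Linearity in row \<open>k\<close> assembles the determinant with row \<open>k\<close>
  replaced by row \<open>i\<close>, which has a repeated row unless i = k.\<close>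

lemma matrix_mult_adjugate:
  fixes M :: "'a::comm_ring_1 ^ 'n ^ 'n::finite"
  shows "M ** adjugate M = (\<chi> i j. if i = j then det M else 0)"
proof -
  have "(M ** adjugate M) $ i $ k = (if i = k then det M else 0)" for i k
  proof -
    have "(M ** adjugate M) $ i $ k =
        (\<Sum>j\<in>UNIV. det (\<chi> l. if l = k then (M $ i $ j) *s axis j 1 else M $ l))"
      by (simp add: matrix_matrix_mult_def adjugate_def det_row_mul)
    also have "\<dots> = det (\<chi> l. if l = k then (\<Sum>j\<in>UNIV. (M $ i $ j) *s axis j 1) else M $ l)"
      by (rule det_linear_row_sum[symmetric]) simp
    also have "\<dots> = det (\<chi> l. if l = k then M $ i else M $ l)" unfolding basis_expansion ..
    also have "\<dots> = (if i = k then det M else 0)"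
    proof (cases "i = k")
      case True
      then have "(\<chi> l. if l = k then M $ i else M $ l) = M" by (simp add: vec_eq_iff)
      then show ?thesis using True by simp
    next
      case False
      then show ?thesis by (simp add: det_identical_rows[of i k] row_def)
    qed
    finally show ?thesis .
  qed
  then show ?thesis by (simp add: vec_eq_iff)
qed

lemma invertible_iff_det_dvd_1:
  fixes M :: "'a::comm_ring_1 ^ 'n ^ 'n::finite"
  shows "invertible M \<longleftrightarrow> det M dvd 1"
proof
  assume "invertible M"
  then obtain M' where "M ** M' = mat 1" by (auto simp: invertible_def)
  then have "det M * det M' = 1" by (metis det_I det_mul)
  then show "det M dvd 1" by (metis dvdI)
next
  assume "det M dvd 1"
  then obtain u where u: "1 = det M * u" by (auto elim: dvdE)
  \<comment> \<open>The adjugate gives right inverses; the transpose has the same determinant and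
    supplies the left inverse.\<close>
  have right: "\<exists>K'. K ** K' = mat 1" if "det K = det M" for K :: "'a ^ 'n ^ 'n"
  proof -
    have "(K ** (\<chi> i j. adjugate K $ i $ j * u)) $ i $ j = (K ** adjugate K) $ i $ j * u" for i j
      by (simp add: matrix_matrix_mult_def sum_distrib_right mult.assoc)
    then have "K ** (\<chi> i j. adjugate K $ i $ j * u) = mat 1"
      using u that by (simp add: matrix_mult_adjugate vec_eq_iff mat_def)
    then show ?thesis by blast
  qed
  obtain R where R: "M ** R = mat 1" using right[of M] by blast
  obtain L where "transpose M ** L = mat 1" using right[of "transpose M"] by (auto simp: det_transpose)
  then have L: "transpose L ** M = mat 1" by (metis matrix_transpose_mul transpose_mat transpose_transpose)
  have "transpose L = transpose L ** (M ** R)" by (simp add: R)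
  also have "\<dots> = R" by (simp add: matrix_mul_assoc L)
  finally show "invertible M" using R L unfolding invertible_def by blast
qed

lemma matrix_inv_left_right:
  fixes M :: "'a::comm_ring_1 ^ 'n ^ 'n::finite"
  assumes "invertible M"
  shows "M ** matrix_inv M = mat 1" "matrix_inv M ** M = mat 1"
proof -
  have "M ** matrix_inv M = mat 1 \<and> matrix_inv M ** M = mat 1"
    unfolding matrix_inv_def by (rule someI_ex) (use assms in \<open>simp add: invertible_def\<close>)
  then show "M ** matrix_inv M = mat 1" "matrix_inv M ** M = mat 1" by auto
qed

lemma dvd_1_mult: "a dvd 1 \<Longrightarrow> b dvd 1 \<Longrightarrow> a * b dvd (1::'a::comm_ring_1)"
  using mult_dvd_mono[of a 1 b 1] by simp

lemma dvd_1_power: "a dvd 1 \<Longrightarrow> a ^ n dvd (1::'a::comm_ring_1)"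
  using dvd_power_same[of a 1 n] by simp

lemma matrix_add_rdistrib': "(A + B) ** C = A ** C + B ** (C :: 'a::comm_ring_1 ^ 'n ^ 'n::finite)"
  by (simp add: matrix_matrix_mult_def vec_eq_iff distrib_right sum.distrib)

lemma transpose_add: "transpose (A + B) = transpose A + (transpose B :: 'a::comm_ring_1 ^ 'n ^ 'n::finite)"
  by (simp add: transpose_def vec_eq_iff)

section \<open>Scalar multiples and congruences of matrices\<close>

definition smat :: "'a::comm_ring_1 \<Rightarrow> 'a ^ 'n ^ 'n \<Rightarrow> 'a ^ 'n ^ 'n::finite" where
  "smat c A = map_matrix ((*) c) A"

lemma smat_nth [simp]: "smat c A $ i $ j = c * A $ i $ j"
  by (simp add: smat_def)

lemma smat_mult_left: "smat c A ** B = smat c (A ** B)"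
  and smat_mult_right: "A ** smat c B = smat c (A ** B)"
  by (simp_all add: matrix_matrix_mult_def vec_eq_iff sum_distrib_left mult_ac)

lemma smat_add: "smat c (A + B) = smat c A + smat c B"
  by (simp add: vec_eq_iff distrib_left)

lemma smat_transpose: "transpose (smat c A) = smat c (transpose A)"
  by (simp add: transpose_def vec_eq_iff)

lemma smat_cancel:
  fixes A B :: "'a::comm_ring_1 ^ 'n ^ 'n::finite"
  assumes "\<And>a. c * a = 0 \<Longrightarrow> a = 0"
  shows "smat c A = smat c B \<longleftrightarrow> A = B"
proof
  assume "smat c A = smat c B"
  then have "smat c A $ i $ j = smat c B $ i $ j" for i j by simp
  then have "c * (A $ i $ j - B $ i $ j) = 0" for i j by (simp add: right_diff_distrib)
  then have "A $ i $ j - B $ i $ j = 0" for i j using assms by blast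
  then show "A = B" by (simp add: vec_eq_iff)
qed simp

definition mcong :: "'a::comm_ring_1 \<Rightarrow> 'a ^ 'n ^ 'n \<Rightarrow> 'a ^ 'n ^ 'n::finite \<Rightarrow> bool" where
  "mcong c A B \<longleftrightarrow> (\<forall>i j. c dvd A $ i $ j - B $ i $ j)"

lemma mcongD: "mcong c A B \<Longrightarrow> c dvd A $ i $ j - B $ i $ j"
  by (simp add: mcong_def)

lemma mcong_refl [simp]: "mcong c A A"
  by (simp add: mcong_def)

lemma dvd_diff_sum:
  fixes f g :: "'i \<Rightarrow> 'a::comm_ring_1"
  shows "(\<And>x. x \<in> S \<Longrightarrow> c dvd f x - g x) \<Longrightarrow> c dvd sum f S - sum g S"
  by (simp add: sum_subtractf[symmetric] dvd_sum)

lemma dvd_diff_prod: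
  fixes f g :: "'i \<Rightarrow> 'a::comm_ring_1"
  shows "(\<And>x. x \<in> S \<Longrightarrow> c dvd f x - g x) \<Longrightarrow> c dvd prod f S - prod g S"
  by (induction S rule: infinite_finite_induct) (auto intro: dvd_diff_mult)

lemma dvd_diff_trans: "c dvd a - b \<Longrightarrow> c dvd b - d \<Longrightarrow> c dvd a - (d::'a::comm_ring_1)"
  using dvd_add[of c "a - b" "b - d"] by simp

lemma dvd_diff_minus: "c dvd a - a' \<Longrightarrow> c dvd b - b' \<Longrightarrow> c dvd (a - b) - (a' - (b'::'a::comm_ring_1))"
  using dvd_diff[of c "a - a'" "b - b'"] by (simp add: algebra_simps)

lemma dvd_diff_power: "c dvd a - b \<Longrightarrow> c dvd a ^ n - (b::'a::comm_ring_1) ^ n"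
  by (induction n) (auto intro: dvd_diff_mult)

lemma dvd_diff_scale: "c dvd a - b \<Longrightarrow> d * c dvd d * a - d * (b::'a::comm_ring_1)"
  unfolding right_diff_distrib[symmetric] by (rule mult_dvd_mono) simp_all

lemma mcong_add: "mcong c A A' \<Longrightarrow> mcong c B B' \<Longrightarrow> mcong c (A + B) (A' + B')"
  unfolding mcong_def vector_add_component by (intro allI dvd_diff_add) auto

lemma mcong_mult: "mcong c A A' \<Longrightarrow> mcong c B B' \<Longrightarrow> mcong c (A ** B) (A' ** B')"
  by (auto simp: mcong_def matrix_matrix_mult_def intro!: dvd_diff_sum dvd_diff_mult)

lemma mcong_transpose: "mcong c A A' \<Longrightarrow> mcong c (transpose A) (transpose A')"
  by (simp add: mcong_def transpose_def)

lemma mcong_smat: "mcong c A A' \<Longrightarrow> mcong (d * c) (smat d A) (smat d A')"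
  by (simp add: mcong_def dvd_diff_scale)

lemma mcong_trans: "mcong c A B \<Longrightarrow> mcong c B D \<Longrightarrow> mcong c A D"
  unfolding mcong_def by (blast intro: dvd_diff_trans)

lemma mcong_sym: "mcong c A B \<Longrightarrow> mcong c B A"
  unfolding mcong_def by (blast intro: dvd_diff_swap)

lemma mcong_weaken: "mcong d A B \<Longrightarrow> c dvd d \<Longrightarrow> mcong c A B"
  unfolding mcong_def by (blast intro: dvd_trans)

lemma mcong_det: "mcong c A B \<Longrightarrow> c dvd det A - det B"
  unfolding det_def mcong_def
  by (intro dvd_diff_sum dvd_diff_mult dvd_diff_prod) auto

section \<open>Adic rings\<close>

text \<open>Up to a unit, \<open>u\<close> is 1 - y with \<open>y\<close> divisible by
  \<open>c\<close>, and the geometric series inverts it. Completeness is a hypothesis on a general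
  \<open>c\<close> because the lemma is applied to the image of \<pi> rather than to p.\<close>

lemma unit_if_congruent_to_unit:
  fixes u v c :: "'a::comm_ring_1"
  assumes complete: "\<And>X :: nat \<Rightarrow> 'a. (\<And>k. c ^ k dvd X (Suc k) - X k) \<Longrightarrow> \<exists>l. \<forall>k. c ^ k dvd l - X k"
    and separated: "\<And>a. (\<And>k. c ^ k dvd a) \<Longrightarrow> a = 0"
    and "c dvd u - v" "v dvd 1"
  shows "u dvd 1"
proof -
  obtain v' where v': "v * v' = 1" using assms(4) by (metis dvdE)
  obtain w where "u - v = c * w" using assms(3) by (auto elim: dvdE)
  define y where "y = - c * w * v'"
  have "u * v' = v * v' + (u - v) * v'" by (simp add: algebra_simps)
  then have uy: "u * v' = 1 - y" using v' \<open>u - v = c * w\<close> by (simp add: y_def)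
  have y_pow: "c ^ k dvd y ^ k" for k by (rule dvd_power_same) (simp add: y_def)
  obtain l where l: "\<And>k. c ^ k dvd l - (\<Sum>j<k. y ^ j)"
    using complete[of "\<lambda>k. \<Sum>j<k. y ^ j"] y_pow by auto
  have "(1 - y) * l - 1 = 0"
  proof (rule separated)
    fix k
    have "(1 - y) * (\<Sum>j<k. y ^ j) = 1 - y ^ k" by (simp add: one_diff_power_eq)
    then have "(1 - y) * l - 1 = (1 - y) * (l - (\<Sum>j<k. y ^ j)) - y ^ k" by (simp add: right_diff_distrib)
    then show "c ^ k dvd (1 - y) * l - 1" using l y_pow by (simp add: dvd_diff)
  qed
  then have "u * (v' * l) = 1" using uy by (simp add: mult.assoc[symmetric])
  then show ?thesis by (metis dvdI)
qed

lemma p_dvd_sum_power_diff: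
  fixes f :: "'i \<Rightarrow> 'a::comm_ring_1"
  assumes "prime p"
  shows "of_nat p dvd sum f S ^ (p ^ s) - (\<Sum>x\<in>S. f x ^ (p ^ s))"
proof (induction S rule: infinite_finite_induct)
  case (insert x S)
  let ?N = "p ^ s"
  have "(f x + sum f S) ^ ?N = f x ^ ?N + sum f S ^ ?N - of_nat p * C_poly p s (f x) (sum f S)"
    using C_poly_eq[OF assms, of s "f x" "sum f S"] by simp
  then have "sum f (insert x S) ^ ?N - (\<Sum>x\<in>insert x S. f x ^ ?N) =
      (sum f S ^ ?N - (\<Sum>x\<in>S. f x ^ ?N)) - of_nat p * C_poly p s (f x) (sum f S)"
    using insert.hyps by simp
  then show ?case using insert.IH by (simp add: dvd_diff)
qed (use assms prime_gt_0_nat[OF assms] in \<open>auto simp: power_0_left\<close>)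

text \<open>In the Leibniz expansion the odd exponent preserves the signs, and modulo p the power of
  a sum is the sum of the powers. This keeps entrywise powers of invertible matrices invertible in
  the coordinate algebra.\<close>

lemma p_dvd_det_entrywise_power:
  fixes M :: "'a::comm_ring_1 ^ 'n ^ 'n::finite"
  assumes "prime p" "odd p"
  shows "of_nat p dvd det M ^ (p ^ s) - det (entrywise_power M (p ^ s))"
proof -
  let ?N = "p ^ s" and ?S = "{\<tau>. \<tau> permutes (UNIV :: 'n set)}"
  have "(of_int (sign \<tau>) * (\<Prod>i\<in>UNIV. M $ i $ \<tau> i)) ^ ?N =
      of_int (sign \<tau>) * (\<Prod>i\<in>UNIV. entrywise_power M ?N $ i $ \<tau> i)" for \<tau> :: "'n \<Rightarrow> 'n"
  proof -
    have "(of_int (sign \<tau>) :: 'a) ^ ?N = of_int (sign \<tau>)" using assms(2) by (simp add: sign_def)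
    then show ?thesis by (simp add: power_mult_distrib prod_power_distrib entrywise_power_def)
  qed
  then have "det (entrywise_power M ?N) = (\<Sum>\<tau>\<in>?S. (of_int (sign \<tau>) * (\<Prod>i\<in>UNIV. M $ i $ \<tau> i)) ^ ?N)"
    by (simp add: det_def)
  then show ?thesis using p_dvd_sum_power_diff[OF assms(1), of _ ?S s] by (simp add: det_def)
qed

section \<open>The algebras \<open>\<A>\<close> and \<open>R[\<pi>][y]\<close>\<close>

locale padic_domain =
  fixes P :: "'p::finite itself" and R :: "'r::idom itself"
  assumes p_nonunit_R: "\<not> of_nat CARD('p) dvd (1::'r)"
    and p_nonzero_R: "of_nat CARD('p) \<noteq> (0::'r)"
    and complete_R: "padic_complete CARD('p) TYPE('r)"
begin

lemma ring_hom_gl_const: "is_ring_hom (gl_const :: 'r \<Rightarrow> ('p, 'n::finite, 'r) gl_alg)"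
proof -
  interpret completion "TYPE('p)" "TYPE(('n, 'r) gl_coord)"
    by (rule completion_gl_coord[OF p_nonunit_R p_nonzero_R])
  show ?thesis
    using ring_hom_comp[OF ring_hom_to_pcompl ring_hom_comp[OF ring_hom_to_gl_coord ring_hom_mconst]]
    by (simp add: comp_def gl_const_def[abs_def])
qed

lemmas gl_const_simps = ring_homD[OF ring_hom_gl_const] ring_hom_0[OF ring_hom_gl_const]
  ring_hom_minus[OF ring_hom_gl_const] ring_hom_diff[OF ring_hom_gl_const]
  ring_hom_power[OF ring_hom_gl_const] ring_hom_of_nat[OF ring_hom_gl_const]
  ring_hom_sum[OF ring_hom_gl_const]

lemma gl_complete: "padic_complete CARD('p) TYPE(('p, 'n::finite, 'r) gl_alg)"
  by (rule completion.pcompl_complete[OF completion_gl_coord[OF p_nonunit_R p_nonzero_R]])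

lemma gl_p_regular: "of_nat CARD('p) * a = 0 \<Longrightarrow> a = (0 :: ('p, 'n::finite, 'r) gl_alg)"
  by (rule completion.pcompl_p_regular[OF completion_gl_coord[OF p_nonunit_R p_nonzero_R]])

lemma gl_det_x: "to_pcompl det_inv * det gl_x = (1 :: ('p, 'n::finite, 'r) gl_alg)"
proof -
  interpret completion "TYPE('p)" "TYPE(('n, 'r) gl_coord)"
    by (rule completion_gl_coord[OF p_nonunit_R p_nonzero_R])
  have hom: "is_ring_hom (\<lambda>f. to_pcompl (to_gl_coord f) :: ('p, 'n, 'r) gl_alg)"
    using ring_hom_comp[OF ring_hom_to_pcompl ring_hom_to_gl_coord] by (simp add: comp_def)
  have det: "det gl_x = (to_pcompl (to_gl_coord (det xpoly)) :: ('p, 'n, 'r) gl_alg)"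
    unfolding gl_x_def ring_hom_det[OF hom] ..
  show "to_pcompl det_inv * det gl_x = (1 :: ('p, 'n, 'r) gl_alg)"
    unfolding det ring_homD(3)[OF ring_hom_to_pcompl, symmetric] det_inv
    by (rule ring_homD(1)[OF ring_hom_to_pcompl])
qed

text \<open>The case of the inverse is stated for every \<open>u\<close> with u det = 1, so that the
  rule can be used without unfolding the localization or the completion.\<close>

lemma gl_induct [case_names const var det_inv add mult limit]:
  fixes a :: "('p, 'n::finite, 'r) gl_alg"
  assumes const: "\<And>c. Q (gl_const c)" and var: "\<And>i j. Q (gl_x $ i $ j)"
    and inv: "\<And>u. u * det gl_x = 1 \<Longrightarrow> Q u"
    and add: "\<And>x y. Q x \<Longrightarrow> Q y \<Longrightarrow> Q (x + y)" and mult: "\<And>x y. Q x \<Longrightarrow> Q y \<Longrightarrow> Q (x * y)"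
    and limit: "\<And>a. (\<And>n. \<exists>b. Q b \<and> of_nat CARD('p) ^ n dvd a - b) \<Longrightarrow> Q a"
  shows "Q a"
proof -
  interpret completion "TYPE('p)" "TYPE(('n, 'r) gl_coord)"
    by (rule completion_gl_coord[OF p_nonunit_R p_nonzero_R])
  have "Q (to_pcompl z)" for z
  proof (induction z rule: gl_coord_induct)
    case (const c)
    show ?case using assms(1)[of c] by (simp add: gl_const_def)
  next
    case (var i j)
    show ?case using assms(2)[of i j] by (simp add: gl_x_def)
  next
    case det_inv
    show ?case by (rule inv[OF gl_det_x])
  qed (simp_all only: ring_homD[OF ring_hom_to_pcompl] add mult)
  then have "\<exists>b. Q b \<and> of_nat CARD('p) ^ n dvd a - b" for n using to_pcompl_dense[of n a] by blast
  then show ?thesis by (rule limit)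
qed

lemma gl_hom_exists:
  fixes \<sigma> :: "'r \<Rightarrow> 'c::comm_ring_1" and M :: "'c ^ 'n ^ 'n::finite"
  assumes \<sigma>: "is_ring_hom \<sigma>" and "det M dvd 1" and complete: "padic_complete CARD('p) TYPE('c)"
  shows "\<exists>h :: ('p, 'n, 'r) gl_alg \<Rightarrow> 'c. is_ring_hom h \<and> (\<forall>a. h (gl_const a) = \<sigma> a) \<and> map_matrix h gl_x = M"
proof -
  interpret completion "TYPE('p)" "TYPE(('n, 'r) gl_coord)"
    by (rule completion_gl_coord[OF p_nonunit_R p_nonzero_R])
  let ?g = "mp_eval \<sigma> (\<lambda>(i, j). M $ i $ j)"
  note g = mp_eval_hom[OF \<sigma>, of "\<lambda>(i, j). M $ i $ j"]
  have M: "map_matrix ?g xpoly = M" by (simp add: map_matrix_def xpoly_def g vec_eq_iff)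
  obtain u where "1 = det M * u" using assms(2) by (rule dvdE)
  then have "u * ?g (det xpoly) = 1" unfolding ring_hom_det[OF g(1)] M by (simp add: mult.commute)
  from gl_coord_hom_exists[OF g(1) this] obtain h0 where
    h0: "is_ring_hom h0" "\<And>f. h0 (to_gl_coord f) = ?g f" by blast
  from pcompl_hom_exists[OF h0(1) complete] obtain h :: "('p, 'n, 'r) gl_alg \<Rightarrow> 'c" where
    h: "is_ring_hom h" "\<And>b. h (to_pcompl b) = h0 b" by blast
  have "map_matrix h gl_x = M" using M by (simp add: gl_x_def h h0 map_matrix_def)
  then show ?thesis using h(1) by (intro exI[of _ h]) (simp add: gl_const_def h(2) h0 g)
qed

lemma gl_hom_unique:
  fixes h h' :: "('p, 'n::finite, 'r) gl_alg \<Rightarrow> 'c::comm_ring_1"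
  assumes h: "is_ring_hom h" "is_ring_hom h'" "\<And>a. h (gl_const a) = h' (gl_const a)"
    "map_matrix h gl_x = map_matrix h' gl_x" and complete: "padic_complete CARD('p) TYPE('c)"
  shows "h = h'"
proof
  fix a show "h a = h' a"
  proof (induction a rule: gl_induct)
    case (var i j)
    show ?case using h(4) by (metis nth_map_matrix)
  next
    case (det_inv u)
    let ?d = "h (det gl_x)"
    have d: "?d = h' (det gl_x)" using h by (simp add: ring_hom_det)
    have "h u * ?d = 1" using det_inv ring_homD[OF h(1)] by metis
    moreover have "h' u * ?d = 1" unfolding d using det_inv ring_homD[OF h(2)] by metis
    ultimately show ?case by (metis mult.assoc mult.commute mult_1)
  next
    case (limit a)
    show ?case
    proof (rule padic_separated[OF complete])
      fix n
      obtain b where b: "h b = h' b" "of_nat CARD('p) ^ n dvd a - b" using limit by blast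
      have "of_nat CARD('p) ^ n dvd g (a - b)" if "is_ring_hom g" for g :: "_ \<Rightarrow> 'c"
        using ring_hom_dvd[OF that b(2)] by (simp add: ring_hom_power[OF that] ring_hom_of_nat[OF that])
      from dvd_diff[OF this[OF h(1)] this[OF h(2)]] show "of_nat CARD('p) ^ n dvd h a - h' a"
        by (simp add: ring_hom_diff[OF h(1)] ring_hom_diff[OF h(2)] b(1))
    qed
  qed (simp_all add: h ring_homD)
qed

lemma gl_subst_eq:
  fixes h :: "('p, 'n::finite, 'r) gl_alg \<Rightarrow> 'c::comm_ring_1"
  assumes "is_ring_hom h" "\<And>a. h (gl_const a) = \<sigma> a" "map_matrix h gl_x = M"
    and "padic_complete CARD('p) TYPE('c)"
  shows "gl_subst \<sigma> M = h"
  unfolding gl_subst_def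
  by (rule the_equality) (use assms in \<open>auto intro: gl_hom_unique\<close>)

lemma gl_subst:
  fixes \<sigma> :: "'r \<Rightarrow> 'c::comm_ring_1" and M :: "'c ^ 'n ^ 'n::finite"
  assumes "is_ring_hom \<sigma>" "det M dvd 1" "padic_complete CARD('p) TYPE('c)"
  shows "is_ring_hom (gl_subst \<sigma> M :: ('p, 'n, 'r) gl_alg \<Rightarrow> 'c)"
    "gl_subst \<sigma> M (gl_const a :: ('p, 'n, 'r) gl_alg) = \<sigma> a"
    "map_matrix (gl_subst \<sigma> M) (gl_x :: ('p, 'n, 'r) gl_alg ^ 'n ^ 'n) = M"
proof -
  obtain h :: "('p, 'n, 'r) gl_alg \<Rightarrow> 'c" where
    h: "is_ring_hom h" "\<And>a. h (gl_const a) = \<sigma> a" "map_matrix h gl_x = M"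
    using gl_hom_exists[OF assms] by blast
  have "gl_subst \<sigma> M = h" by (rule gl_subst_eq[OF h assms(3)])
  then show "is_ring_hom (gl_subst \<sigma> M :: ('p, 'n, 'r) gl_alg \<Rightarrow> 'c)"
    "gl_subst \<sigma> M (gl_const a :: ('p, 'n, 'r) gl_alg) = \<sigma> a"
    "map_matrix (gl_subst \<sigma> M) (gl_x :: ('p, 'n, 'r) gl_alg ^ 'n ^ 'n) = M"
    using h by auto
qed

lemma y_induct [case_names const var add mult limit]:
  fixes a :: "('p, 'n::finite, 'r) y_alg"
  assumes const: "\<And>c. Q (yconst c)" and var: "\<And>i j k. Q (yvar i $ j $ k)"
    and add: "\<And>x y. Q x \<Longrightarrow> Q y \<Longrightarrow> Q (x + y)" and mult: "\<And>x y. Q x \<Longrightarrow> Q y \<Longrightarrow> Q (x * y)"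
    and limit: "\<And>a. (\<And>n. \<exists>b. Q b \<and> of_nat CARD('p) ^ n dvd a - b) \<Longrightarrow> Q a"
  shows "Q a"
proof -
  interpret completion "TYPE('p)" "TYPE(('n \<times> 'n \<times> 'n, 'r) mpoly)"
    by (rule completion_mpoly[OF p_nonunit_R p_nonzero_R])
  have "Q (to_pcompl f)" for f
  proof (induction f rule: mpoly_induct)
    case (const c)
    show ?case using assms(1)[of c] by (simp add: yconst_def)
  next
    case (var v)
    show ?case using assms(2)[of "fst v" "fst (snd v)" "snd (snd v)"] by (simp add: yvar_def)
  qed (simp_all only: ring_homD[OF ring_hom_to_pcompl] add mult)
  then have "\<exists>b. Q b \<and> of_nat CARD('p) ^ n dvd a - b" for n using to_pcompl_dense[of n a] by blast
  then show ?thesis by (rule limit)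
qed

lemma y_hom_exists:
  fixes \<sigma> :: "'r \<Rightarrow> 'c::comm_ring_1" and M :: "'n::finite \<Rightarrow> 'c ^ 'n ^ 'n"
  assumes \<sigma>: "is_ring_hom \<sigma>" and complete: "padic_complete CARD('p) TYPE('c)"
  shows "\<exists>h :: ('p, 'n, 'r) y_alg \<Rightarrow> 'c. is_ring_hom h \<and> (\<forall>a. h (yconst a) = \<sigma> a) \<and> (\<forall>i. map_matrix h (yvar i) = M i)"
proof -
  interpret completion "TYPE('p)" "TYPE(('n \<times> 'n \<times> 'n, 'r) mpoly)"
    by (rule completion_mpoly[OF p_nonunit_R p_nonzero_R])
  note g = mp_eval_hom[OF \<sigma>, of "\<lambda>(i, j, k). M i $ j $ k"]
  from pcompl_hom_exists[OF g(1) complete] obtain h :: "('p, 'n, 'r) y_alg \<Rightarrow> 'c" where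
    h: "is_ring_hom h" "\<And>b. h (to_pcompl b) = mp_eval \<sigma> (\<lambda>(i, j, k). M i $ j $ k) b" by blast
  then show ?thesis by (intro exI[of _ h]) (simp add: yconst_def yvar_def g vec_eq_iff)
qed

text \<open>Congruence modulo \<open>c\<close> passes through sums and products, and through p-adic
  limits because \<open>c\<close> divides a power of p. With c = p^n for all n this yields
  uniqueness, with powers of \<pi> the estimates for the torsion terms.\<close>

lemma y_hom_cong:
  fixes h h' :: "('p, 'n::finite, 'r) y_alg \<Rightarrow> 'c::comm_ring_1"
  assumes h: "is_ring_hom h" "is_ring_hom h'" "\<And>a. h (yconst a) = h' (yconst a)"
    "\<And>i. mcong c (map_matrix h (yvar i)) (map_matrix h' (yvar i))" and c: "c dvd of_nat CARD('p) ^ n"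
  shows "c dvd h a - h' a"
proof (induction a rule: y_induct)
  case (const a)
  show ?case using h(3) by simp
next
  case (var i j k)
  show ?case using mcongD[OF h(4)[of i], of j k] by simp
next
  case (limit a)
  obtain b where b: "c dvd h b - h' b" "of_nat CARD('p) ^ n dvd a - b" using limit by blast
  have "c dvd g a - g b" if "is_ring_hom g" for g :: "_ \<Rightarrow> 'c"
  proof -
    have "of_nat CARD('p) ^ n dvd g a - g b"
      using ring_hom_dvd[OF that b(2)]
      by (simp add: ring_hom_power[OF that] ring_hom_of_nat[OF that] ring_hom_diff[OF that])
    then show ?thesis using c dvd_trans by blast
  qed
  from dvd_diff_trans[OF dvd_diff_trans[OF this[OF h(1)] b(1)] dvd_diff_swap[OF this[OF h(2)]]]
  show ?case .
qed (simp_all only: ring_homD[OF h(1)] ring_homD[OF h(2)] dvd_diff_add dvd_diff_mult)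

lemma y_hom_unique:
  fixes h h' :: "('p, 'n::finite, 'r) y_alg \<Rightarrow> 'c::comm_ring_1"
  assumes "is_ring_hom h" "is_ring_hom h'" "\<And>a. h (yconst a) = h' (yconst a)"
    "\<And>i. map_matrix h (yvar i) = map_matrix h' (yvar i)" and complete: "padic_complete CARD('p) TYPE('c)"
  shows "h = h'"
proof
  fix a show "h a = h' a"
    by (rule padic_separated[OF complete]) (rule y_hom_cong[OF _ _ _ _ dvd_refl], use assms in auto)
qed

lemma y_subst:
  fixes \<sigma> :: "'r \<Rightarrow> 'c::comm_ring_1" and M :: "'n::finite \<Rightarrow> 'c ^ 'n ^ 'n"
  assumes "is_ring_hom \<sigma>" "padic_complete CARD('p) TYPE('c)"
  shows "is_ring_hom (y_subst \<sigma> M :: ('p, 'n, 'r) y_alg \<Rightarrow> 'c)"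
    "y_subst \<sigma> M (yconst a :: ('p, 'n, 'r) y_alg) = \<sigma> a"
    "map_matrix (y_subst \<sigma> M) (yvar i :: ('p, 'n, 'r) y_alg ^ 'n ^ 'n) = M i"
proof -
  obtain h :: "('p, 'n, 'r) y_alg \<Rightarrow> 'c" where
    h: "is_ring_hom h" "\<And>a. h (yconst a) = \<sigma> a" "\<And>i. map_matrix h (yvar i) = M i"
    using y_hom_exists[OF assms] by blast
  have "y_subst \<sigma> M = h" unfolding y_subst_def
    by (rule the_equality) (use h assms in \<open>auto intro: y_hom_unique\<close>)
  then show "is_ring_hom (y_subst \<sigma> M :: ('p, 'n, 'r) y_alg \<Rightarrow> 'c)"
    "y_subst \<sigma> M (yconst a :: ('p, 'n, 'r) y_alg) = \<sigma> a"
    "map_matrix (y_subst \<sigma> M) (yvar i :: ('p, 'n, 'r) y_alg ^ 'n ^ 'n) = M i"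
    using h by auto
qed

end

section \<open>Frobenius lifts\<close>

lemma ring_hom_frob:
  fixes \<pi> \<rho> :: "'a::comm_ring_1"
  assumes "prime p" "\<pi> * \<rho> = of_nat p" "higher_pi_derivation p s \<pi> \<rho> \<delta>"
  shows "is_ring_hom (frob p s \<pi> \<delta>)"
  unfolding is_ring_hom_def
proof (intro conjI allI)
  note \<delta> = assms(3)[unfolded higher_pi_derivation_def]
  show "frob p s \<pi> \<delta> 1 = 1" using \<delta> by (simp add: frob_def)
  fix x y
  have "\<delta> (x + y) = \<delta> x + \<delta> y + \<rho> * C_poly p s x y" using \<delta> by blast
  then have "\<pi> * \<delta> (x + y) = \<pi> * \<delta> x + \<pi> * \<delta> y + (\<pi> * \<rho>) * C_poly p s x y" by (simp add: algebra_simps)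
  then show "frob p s \<pi> \<delta> (x + y) = frob p s \<pi> \<delta> x + frob p s \<pi> \<delta> y"
    unfolding assms(2) C_poly_eq[OF assms(1)] by (simp add: frob_def)
  have "\<delta> (x * y) = x ^ (p ^ s) * \<delta> y + y ^ (p ^ s) * \<delta> x + \<pi> * \<delta> x * \<delta> y" using \<delta> by blast
  then show "frob p s \<pi> \<delta> (x * y) = frob p s \<pi> \<delta> x * frob p s \<pi> \<delta> y"
    by (simp add: frob_def power_mult_distrib algebra_simps)
qed

text \<open>The homomorphism laws of the Frobenius lift are divided by \<pi>; the correction term in
  the sum rule arises from writing p as \<pi> \<rho>.\<close>

lemma higher_pi_derivation_of_frob:
  fixes \<pi> \<rho> :: "'a::comm_ring_1"
  assumes "prime p" "\<pi> * \<rho> = of_nat p" and regular: "\<And>a. \<pi> * a = 0 \<Longrightarrow> a = 0"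
    and \<phi>: "is_ring_hom (frob p s \<pi> D)"
  shows "higher_pi_derivation p s \<pi> \<rho> D"
  unfolding higher_pi_derivation_def
proof (intro conjI allI)
  have cancel: "a = b" if "\<pi> * a = \<pi> * b" for a b
    using regular[of "a - b"] that by (simp add: right_diff_distrib)
  note hom = ring_homD[OF \<phi>, unfolded frob_def]
  show "D 1 = 0" using hom(1) regular by simp
  fix x y
  show "D (x + y) = D x + D y + \<rho> * C_poly p s x y"
  proof (rule cancel)
    have "\<pi> * D (x + y) = \<pi> * D x + \<pi> * D y + (x ^ (p ^ s) + y ^ (p ^ s) - (x + y) ^ (p ^ s))"
      using hom(2)[of x y] by (simp add: algebra_simps)
    also have "\<dots> = \<pi> * (D x + D y + \<rho> * C_poly p s x y)"
      unfolding C_poly_eq[OF assms(1), symmetric] assms(2)[symmetric] by (simp add: algebra_simps)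
    finally show "\<pi> * D (x + y) = \<pi> * (D x + D y + \<rho> * C_poly p s x y)" .
  qed
  show "D (x * y) = x ^ (p ^ s) * D y + y ^ (p ^ s) * D x + \<pi> * D x * D y"
    by (rule cancel) (use hom(3)[of x y] in \<open>simp add: power_mult_distrib algebra_simps\<close>)
qed

text \<open>Koszul's argument: \<open>Z\<close> plays the role of the Christoffel symbols of the first kind.\<close>

lemma koszul:
  fixes Z S T :: "'n \<Rightarrow> 'n \<Rightarrow> 'n \<Rightarrow> 'a::comm_ring_1"
  assumes h: "2 * h = (1::'a)" and S: "\<And>i j k. S i j k = S i k j" and T: "\<And>i j k. T i j k + T j i k = 0"
  shows "(\<forall>i j k. Z i j k + Z i k j = S i j k) \<and> (\<forall>i j k. Z i j k - Z j i k = T i j k) \<longleftrightarrow>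
    (\<forall>i j k. Z i j k = h * (S i j k + S j i k - S k i j + (T i j k + T k i j - T j k i)))"
    (is "?lhs \<longleftrightarrow> (\<forall>i j k. Z i j k = h * ?rhs i j k)")
proof
  have half: "z = h * (z + z)" for z :: 'a
  proof -
    have "z = (2 * h) * z" unfolding h by simp
    then show ?thesis by (simp add: algebra_simps)
  qed
  {
    assume L: ?lhs
    show "\<forall>i j k. Z i j k = h * ?rhs i j k"
    proof (intro allI)
      fix i j k
      have *: "S i j k = Z i j k + Z i k j" "S j i k = Z j i k + Z j k i" "S k i j = Z k i j + Z k j i"
        "T i j k = Z i j k - Z j i k" "T k i j = Z k i j - Z i k j" "T j k i = Z j k i - Z k j i"
        using L by auto
      have "?rhs i j k = Z i j k + Z i j k" unfolding * by (simp add: algebra_simps)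
      then show "Z i j k = h * ?rhs i j k" using half[of "Z i j k"] by simp
    qed
  }
  {
    assume R: "\<forall>i j k. Z i j k = h * ?rhs i j k"
    have T': "T j i k = - T i j k" for i j k using T[of i j k] by (simp add: eq_neg_iff_add_eq_0 add.commute)
    have "Z i j k + Z i k j = S i j k" for i j k
    proof -
      have "Z i j k + Z i k j = h * (?rhs i j k + ?rhs i k j)"
        using R by (simp only: distrib_left)
      also have "?rhs i j k + ?rhs i k j = S i j k + S i j k"
        using S[of i k j] S[of j i k] S[of k i j] T'[of i k j] T'[of j k i] T'[of i j k] T'[of k j i] T'[of k i j]
        by (simp add: algebra_simps S)
      finally show ?thesis using half[of "S i j k"] by simp
    qed
    moreover have "Z i j k - Z j i k = T i j k" for i j k
    proof -
      have "Z i j k - Z j i k = h * (?rhs i j k - ?rhs j i k)"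
        using R by (simp only: right_diff_distrib)
      also have "?rhs i j k - ?rhs j i k = T i j k + T i j k"
        using T'[of i j k] T'[of k i j] T'[of j k i] S[of k i j] by (simp add: algebra_simps)
      finally show ?thesis using half[of "T i j k"] by simp
    qed
    ultimately show ?lhs by blast
  }
qed

section \<open>The Levi-Civita connection\<close>

text \<open>The properties of R[\<pi>] that enter the study of connections are isolated here, so
  that no valuation occurs in it.\<close>

locale levi_civita_data = padic_domain P R
  for P :: "'p::finite itself" and R :: "'r::idom itself" +
  fixes \<pi> :: 'r and s :: nat and \<delta> :: "'n::finite \<Rightarrow> 'r \<Rightarrow> 'r" and q :: "'r ^ 'n ^ 'n"
    and L :: "'n \<Rightarrow> ('p, 'n, 'r) y_alg ^ 'n ^ 'n"
  assumes prime: "prime CARD('p)" and odd: "odd CARD('p)"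
    and pi_dvd: "\<pi> dvd of_nat CARD('p)" and p_dvd: "\<exists>e. of_nat CARD('p) dvd \<pi> ^ e"
    and two_unit: "2 dvd (1::'r)"
    and deriv: "\<And>i. higher_pi_derivation CARD('p) s \<pi> (p_over_pi CARD('p) \<pi>) (\<delta> i)"
    and q_inv: "invertible q" and q_sym: "transpose q = q"
    and torsion: "torsion_symbol L"
begin

abbreviation c :: "'r \<Rightarrow> ('p, 'n, 'r) gl_alg" where "c \<equiv> gl_const"

abbreviation \<theta> :: "('p, 'n, 'r) gl_alg" where "\<theta> \<equiv> gl_const \<pi>"

abbreviation x :: "('p, 'n, 'r) gl_alg ^ 'n ^ 'n" where "x \<equiv> gl_x"

lemma pi_nz: "\<pi> \<noteq> 0"
  using pi_dvd p_nonzero_R by auto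

lemma pi_p_over_pi: "\<pi> * p_over_pi CARD('p) \<pi> = of_nat CARD('p)"
proof -
  obtain d where d: "of_nat CARD('p) = \<pi> * d" using pi_dvd by (rule dvdE)
  have "p_over_pi CARD('p) \<pi> = d"
    unfolding p_over_pi_def by (rule the_equality) (use d pi_nz in auto)
  then show ?thesis using d by simp
qed

lemma half_eq: "2 * (half :: 'r) = 1"
proof -
  obtain h :: 'r where h: "1 = 2 * h" using two_unit by (rule dvdE)
  then have "(2::'r) \<noteq> 0" by auto
  then have unique: "h' = h" if "2 * h' = 1" for h' using h that mult_cancel_left[of 2 h' h] by simp
  have "(half :: 'r) = h"
    unfolding half_def by (rule the_equality) (rule h[symmetric], rule unique)
  then show ?thesis using h[symmetric] by simp
qed

lemma c_half: "2 * c half = 1"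
proof -
  have "c 2 = 2" using ring_hom_of_nat[OF ring_hom_gl_const, of 2] by simp
  moreover have "c (2 * half) = 1" unfolding half_eq by (rule gl_const_simps(1))
  ultimately show ?thesis by (simp add: gl_const_simps(3))
qed

lemma frob_hom: "is_ring_hom (frob CARD('p) s \<pi> (\<delta> i))"
  by (rule ring_hom_frob[OF prime pi_p_over_pi deriv])

lemma theta_p_over_pi: "\<theta> * c (p_over_pi CARD('p) \<pi>) = of_nat CARD('p)"
  by (simp only: pi_p_over_pi gl_const_simps flip: gl_const_simps(3))

section \<open>The \<theta>-adic topology of the coordinate algebra\<close>

lemma theta_dvd_p: "\<theta> dvd of_nat CARD('p)"
  using theta_p_over_pi by (metis dvdI)

lemma theta_regular: "\<theta> * a = 0 \<Longrightarrow> a = 0"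
proof -
  assume "\<theta> * a = 0"
  then have "c (p_over_pi CARD('p) \<pi>) * (\<theta> * a) = 0" by simp
  then have "of_nat CARD('p) * a = 0" unfolding theta_p_over_pi[symmetric] by (simp add: mult_ac)
  then show "a = 0" by (rule gl_p_regular)
qed

lemma p_dvd_theta: "\<exists>e. of_nat CARD('p) dvd \<theta> ^ e"
proof -
  obtain e where "of_nat CARD('p) dvd \<pi> ^ e" using p_dvd by blast
  from ring_hom_dvd[OF ring_hom_gl_const this] show ?thesis by (auto simp: gl_const_simps)
qed

lemma theta_separated: "(\<And>k. \<theta> ^ k dvd a) \<Longrightarrow> a = 0"
proof -
  assume a: "\<And>k. \<theta> ^ k dvd a"
  obtain e where e: "of_nat CARD('p) dvd \<theta> ^ e" using p_dvd_theta by blast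
  have "of_nat CARD('p) ^ n dvd a" for n
    using dvd_power_same[OF e, of n] a[of "e * n"] by (metis dvd_trans power_mult)
  then show "a = 0" by (rule padic_completeD(1)[OF gl_complete])
qed

text \<open>Each of p and \<theta> divides a power of the other, so the two topologies agree: the
  subsequence with indices e k converges p-adically, and its limit serves for the whole
  sequence.\<close>

lemma theta_complete:
  fixes G :: "nat \<Rightarrow> ('p, 'n, 'r) gl_alg"
  assumes G: "\<And>k. \<theta> ^ k dvd G (Suc k) - G k"
  shows "\<exists>l. \<forall>k. \<theta> ^ k dvd l - G k"
proof -
  obtain e0 where "of_nat CARD('p) dvd \<theta> ^ e0" using p_dvd_theta by blast
  \<comment> \<open>The successor makes e k at least k, as the comparison of
    \<open>G (e * k)\<close> with \<open>G k\<close> requires.\<close>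
  define e where "e = Suc e0"
  have e: "of_nat CARD('p) dvd \<theta> ^ e"
    using \<open>of_nat CARD('p) dvd \<theta> ^ e0\<close> by (simp add: e_def)
  have mono: "\<theta> ^ k dvd G (k + j) - G k" for k j
  proof (induction j)
    case (Suc j)
    have "\<theta> ^ k dvd G (Suc (k + j)) - G (k + j)"
      using G[of "k + j"] by (simp add: power_add dvd_mult_left)
    then show ?case using dvd_diff_trans[OF _ Suc] by simp
  qed simp
  have pe: "of_nat CARD('p) ^ k dvd \<theta> ^ (e * k)" for k
    using dvd_power_same[OF e, of k] by (simp add: power_mult)
  have "of_nat CARD('p) ^ k dvd G (e * Suc k) - G (e * k)" for k
    using dvd_trans[OF pe mono[of "e * k" e]] by (simp add: add.commute)
  from padic_completeD(2)[OF gl_complete, of "\<lambda>k. G (e * k)", OF this]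
  obtain l where l: "\<And>k. of_nat CARD('p) ^ k dvd l - G (e * k)" by blast
  have "\<theta> ^ k dvd l - G k" for k
  proof (rule dvd_diff_trans)
    show "\<theta> ^ k dvd l - G (e * k)" by (rule dvd_trans[OF dvd_power_same[OF theta_dvd_p] l])
    show "\<theta> ^ k dvd G (e * k) - G k" using mono[of k "e0 * k"] by (simp add: e_def)
  qed
  then show ?thesis by blast
qed

lemma unit_cong: "\<theta> dvd u - v \<Longrightarrow> v dvd 1 \<Longrightarrow> u dvd 1"
  using theta_complete theta_separated by (rule unit_if_congruent_to_unit)

lemma det_x_unit: "det x dvd 1"
  using gl_det_x by (metis dvdI mult.commute)

lemma det_power_unit: "det M dvd 1 \<Longrightarrow> det (entrywise_power M (CARD('p) ^ s)) dvd 1" for M :: "('p, 'n, 'r) gl_alg ^ 'n ^ 'n"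
  by (rule unit_cong[OF dvd_diff_swap[OF dvd_trans[OF theta_dvd_p p_dvd_det_entrywise_power[OF prime odd]]]])
    (rule dvd_1_power)

text \<open>With \<open>\<Lambda>\<^sub>i = 1 + \<pi> G\<^sub>i\<close> the connection is metric iff \<open>\<Lambda>\<^sub>i\<^sup>t A\<^sub>i \<Lambda>\<^sub>i = B\<close>, and below \<open>A\<^sub>i = B + \<pi> C\<^sub>i\<close>.\<close>

definition X :: "('p, 'n, 'r) gl_alg ^ 'n ^ 'n" where "X = entrywise_power x (CARD('p) ^ s)"

definition B :: "('p, 'n, 'r) gl_alg ^ 'n ^ 'n" where
  "B = entrywise_power (transpose x ** map_matrix c q ** x) (CARD('p) ^ s)"

definition q\<phi> :: "'n \<Rightarrow> 'r ^ 'n ^ 'n" where "q\<phi> i = map_matrix (frob CARD('p) s \<pi> (\<delta> i)) q"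

definition A :: "'n \<Rightarrow> ('p, 'n, 'r) gl_alg ^ 'n ^ 'n" where
  "A i = transpose X ** map_matrix c (q\<phi> i) ** X"

lemma X_nth: "X $ i $ j = x $ i $ j ^ CARD('p) ^ s"
  by (simp add: X_def entrywise_power_def)

lemma det_X: "det X dvd 1"
  unfolding X_def by (rule det_power_unit[OF det_x_unit])

lemma det_H: "det (transpose x ** map_matrix c q ** x) dvd 1"
proof -
  have "det q dvd 1" using q_inv by (simp add: invertible_iff_det_dvd_1)
  from ring_hom_dvd[OF ring_hom_gl_const this] have "det (map_matrix c q) dvd 1"
    by (simp add: ring_hom_det[OF ring_hom_gl_const] gl_const_simps)
  then show ?thesis using det_x_unit by (simp add: det_mul det_transpose dvd_1_mult)
qed

lemma det_B: "det B dvd 1"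
  unfolding B_def by (rule det_power_unit[OF det_H])

lemma invertible_X: "invertible X" and invertible_B: "invertible B"
  by (simp_all add: invertible_iff_det_dvd_1 det_X det_B)

lemma B_sym: "transpose B = B"
proof -
  have H: "transpose (transpose x ** map_matrix c q ** x) = transpose x ** map_matrix c q ** x"
    by (simp add: matrix_transpose_mul matrix_mul_assoc q_sym flip: ring_hom_transpose)
  have "transpose B = entrywise_power (transpose (transpose x ** map_matrix c q ** x)) (CARD('p) ^ s)"
    by (simp add: B_def entrywise_power_def ring_hom_transpose)
  then show ?thesis by (simp add: H B_def)
qed

lemma A_sym: "transpose (A i) = A i"
proof -
  have "transpose (q\<phi> i) = q\<phi> i"
    unfolding q\<phi>_def ring_hom_transpose[symmetric] q_sym ..
  then show ?thesis
    by (simp add: A_def matrix_transpose_mul matrix_mul_assoc flip: ring_hom_transpose)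
qed

text \<open>A Frobenius lift is the p^s-th power map modulo \<pi>, and that map is additive modulo
  p; so both entries are congruent to the same double sum. This makes the metric equation divisible
  by \<pi>.\<close>

lemma A_cong_B: "mcong \<theta> (A i) B"
  unfolding mcong_def
proof (intro allI)
  fix j k
  have A_jk: "A i $ j $ k = (\<Sum>l\<in>UNIV. \<Sum>m\<in>UNIV. x $ m $ j ^ CARD('p) ^ s * c (q\<phi> i $ m $ l) * x $ l $ k ^ CARD('p) ^ s)"
    by (simp add: A_def matrix_matrix_mult_def transpose_def X_nth sum_distrib_right)
  have B_jk: "B $ j $ k = (\<Sum>l\<in>UNIV. \<Sum>m\<in>UNIV. x $ m $ j * c (q $ m $ l) * x $ l $ k) ^ CARD('p) ^ s"
    by (simp add: B_def entrywise_power_def matrix_matrix_mult_def transpose_def sum_distrib_right)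
  let ?f = "\<lambda>(l, m). x $ m $ j * c (q $ m $ l) * x $ l $ k"
  have "\<theta> dvd (\<Sum>lm\<in>UNIV. ?f lm) ^ CARD('p) ^ s - (\<Sum>lm\<in>UNIV. ?f lm ^ CARD('p) ^ s)"
    by (rule dvd_trans[OF theta_dvd_p p_dvd_sum_power_diff[OF prime]])
  then have 1: "\<theta> dvd B $ j $ k - (\<Sum>l\<in>UNIV. \<Sum>m\<in>UNIV. x $ m $ j ^ CARD('p) ^ s * c (q $ m $ l) ^ CARD('p) ^ s * x $ l $ k ^ CARD('p) ^ s)"
    unfolding B_jk by (simp add: sum.cartesian_product power_mult_distrib case_prod_unfold flip: UNIV_Times_UNIV)
  have "\<theta> dvd c (q\<phi> i $ m $ l) - c (q $ m $ l) ^ CARD('p) ^ s" for m l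
    by (simp add: q\<phi>_def frob_def gl_const_simps)
  then have 2: "\<theta> dvd A i $ j $ k - (\<Sum>l\<in>UNIV. \<Sum>m\<in>UNIV. x $ m $ j ^ CARD('p) ^ s * c (q $ m $ l) ^ CARD('p) ^ s * x $ l $ k ^ CARD('p) ^ s)"
    unfolding A_jk by (intro dvd_diff_sum dvd_diff_mult) auto
  show "\<theta> dvd A i $ j $ k - B $ j $ k" by (rule dvd_diff_trans[OF 2 dvd_diff_swap[OF 1]])
qed

text \<open>The quotient of A - B by \<theta>; as \<theta> is regular, the choice made by
  \<open>SOME\<close> is the only one.\<close>

definition C :: "'n \<Rightarrow> ('p, 'n, 'r) gl_alg ^ 'n ^ 'n" where
  "C i = (\<chi> j k. SOME d. A i $ j $ k - B $ j $ k = \<theta> * d)"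

lemma A_eq: "A i = B + smat \<theta> (C i)"
proof -
  have "A i $ j $ k - B $ j $ k = \<theta> * C i $ j $ k" for j k
  proof -
    have "\<exists>d. A i $ j $ k - B $ j $ k = \<theta> * d" using mcongD[OF A_cong_B] unfolding dvd_def .
    then show ?thesis unfolding C_def vec_lambda_beta by (rule someI_ex)
  qed
  then show ?thesis by (simp add: vec_eq_iff algebra_simps)
qed

lemma theta_smat_cancel: "smat \<theta> M = smat \<theta> M' \<longleftrightarrow> M = M'"
  by (rule smat_cancel) (rule theta_regular)

lemma C_sym: "transpose (C i) = C i"
proof -
  have "smat \<theta> (transpose (C i)) + B = smat \<theta> (C i) + B"
    using A_sym[of i] unfolding A_eq transpose_add B_sym smat_transpose by (simp add: add.commute)
  then show ?thesis by (simp add: theta_smat_cancel)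
qed

end

lemma vector_times_invertible_eq_0:
  fixes M :: "'a::comm_ring_1 ^ 'n ^ 'n::finite"
  assumes "invertible M" "\<And>k. (\<Sum>m\<in>UNIV. v m * M $ m $ k) = 0"
  shows "v l = 0"
proof -
  have "v l = (\<Sum>m\<in>UNIV. v m * (M ** matrix_inv M) $ m $ l)"
    unfolding matrix_inv_left_right(1)[OF assms(1)] by (simp add: mat_def if_distrib cong: if_cong)
  also have "\<dots> = (\<Sum>m\<in>UNIV. \<Sum>k\<in>UNIV. v m * M $ m $ k * matrix_inv M $ k $ l)"
    by (simp add: matrix_matrix_mult_def sum_distrib_left mult.assoc)
  also have "\<dots> = (\<Sum>k\<in>UNIV. (\<Sum>m\<in>UNIV. v m * M $ m $ k) * matrix_inv M $ k $ l)"
    by (subst sum.swap) (simp add: sum_distrib_right)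
  finally show ?thesis by (simp add: assms(2))
qed

context levi_civita_data
begin

section \<open>The metric and symmetry conditions as equations for \<open>G\<close>\<close>

definition Lam :: "('n \<Rightarrow> ('p, 'n, 'r) gl_alg ^ 'n ^ 'n) \<Rightarrow> 'n \<Rightarrow> ('p, 'n, 'r) gl_alg ^ 'n ^ 'n" where
  "Lam G i = mat 1 + smat \<theta> (G i)"

definition torsion_at :: "('n \<Rightarrow> ('p, 'n, 'r) gl_alg ^ 'n ^ 'n) \<Rightarrow> 'n \<Rightarrow> 'n \<Rightarrow> 'n \<Rightarrow> ('p, 'n, 'r) gl_alg" where
  "torsion_at G k i j = y_subst c (Lam G) (L k $ i $ j)"

definition metric_eq :: "('n \<Rightarrow> ('p, 'n, 'r) gl_alg ^ 'n ^ 'n) \<Rightarrow> bool" where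
  "metric_eq G \<longleftrightarrow> (\<forall>i. transpose (Lam G i) ** A i ** Lam G i = B)"

definition sym_eq :: "('n \<Rightarrow> ('p, 'n, 'r) gl_alg ^ 'n ^ 'n) \<Rightarrow> bool" where
  "sym_eq G \<longleftrightarrow> (\<forall>i j k. G i $ k $ j - G j $ k $ i = torsion_at G k i j)"

text \<open>The index is lowered with \<open>B\<close> and not with the entrywise power of
  \<open>q\<close>: in the algebra it is \<open>B\<close> that occurs in the metric equation, and it
  specializes to that power at x = 1 (\<open>eps_B\<close>).\<close>

definition Z :: "('n \<Rightarrow> ('p, 'n, 'r) gl_alg ^ 'n ^ 'n) \<Rightarrow> 'n \<Rightarrow> ('p, 'n, 'r) gl_alg ^ 'n ^ 'n" where
  "Z G i = transpose (G i) ** B"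

text \<open>What the metric equation prescribes for Z + Z^t after division by \<theta>. Here
  \<open>G\<close> occurs only behind a further factor \<theta>, which makes the iteration
  contract.\<close>

definition S :: "('n \<Rightarrow> ('p, 'n, 'r) gl_alg ^ 'n ^ 'n) \<Rightarrow> 'n \<Rightarrow> ('p, 'n, 'r) gl_alg ^ 'n ^ 'n" where
  "S G i = smat (- 1) (C i + smat \<theta> (transpose (G i) ** C i + C i ** G i + transpose (G i) ** A i ** G i))"

definition T :: "('n \<Rightarrow> ('p, 'n, 'r) gl_alg ^ 'n ^ 'n) \<Rightarrow> 'n \<Rightarrow> 'n \<Rightarrow> 'n \<Rightarrow> ('p, 'n, 'r) gl_alg" where
  "T G i j k = (\<Sum>m\<in>UNIV. torsion_at G m i j * B $ m $ k)"

text \<open>The metric equation, expanded and divided by \<open>\<pi>\<close>.\<close>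

lemma metric_eq_iff: "metric_eq G \<longleftrightarrow> (\<forall>i. Z G i + transpose (Z G i) = S G i)"
proof -
  have "transpose (Lam G i) ** A i ** Lam G i = B \<longleftrightarrow> Z G i + transpose (Z G i) = S G i" for i
  proof -
    let ?g = "G i" and ?gt = "transpose (G i)"
    define E where "E = ?gt ** C i + C i ** ?g + ?gt ** A i ** ?g"
    have T_Z: "transpose (Z G i) = B ** ?g" by (simp add: Z_def matrix_transpose_mul B_sym)
    have "transpose (Lam G i) ** A i ** Lam G i =
        A i + smat \<theta> (?gt ** A i + A i ** ?g + smat \<theta> (?gt ** A i ** ?g))"
      by (simp add: Lam_def transpose_add transpose_mat smat_transpose matrix_add_rdistrib'
          matrix_add_ldistrib smat_mult_left smat_mult_right smat_add matrix_mul_assoc add_ac)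
    also have "?gt ** A i + A i ** ?g + smat \<theta> (?gt ** A i ** ?g) = Z G i + transpose (Z G i) + smat \<theta> E"
      unfolding T_Z unfolding E_def Z_def A_eq
      by (simp add: matrix_add_rdistrib' matrix_add_ldistrib smat_mult_left smat_mult_right smat_add add_ac)
    also have "A i + smat \<theta> (Z G i + transpose (Z G i) + smat \<theta> E) =
        B + smat \<theta> (Z G i + transpose (Z G i) + (C i + smat \<theta> E))"
      unfolding A_eq by (simp add: smat_add add_ac)
    finally have "transpose (Lam G i) ** A i ** Lam G i = B \<longleftrightarrow>
        smat \<theta> (Z G i + transpose (Z G i) + (C i + smat \<theta> E)) = smat \<theta> 0"
      by (simp add: vec_eq_iff)
    also have "\<dots> \<longleftrightarrow> Z G i + transpose (Z G i) + (C i + smat \<theta> E) = 0"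
      by (rule theta_smat_cancel)
    also have "\<dots> \<longleftrightarrow> Z G i + transpose (Z G i) = S G i"
      unfolding S_def E_def[symmetric] by (simp add: vec_eq_iff add_eq_0_iff2)
    finally show ?thesis .
  qed
  then show ?thesis by (simp add: metric_eq_def)
qed

lemma S_sym: "S G i $ j $ k = S G i $ k $ j"
proof -
  have "transpose (S G i) = S G i"
    unfolding S_def
    by (simp add: smat_transpose transpose_add matrix_transpose_mul C_sym A_sym matrix_mul_assoc add_ac)
  then have "transpose (S G i) $ j $ k = S G i $ j $ k" by simp
  then show ?thesis by (simp add: transpose_def)
qed

lemma torsion_at_antisym: "torsion_at G k i j + torsion_at G k j i = 0"
proof -
  note hom = y_subst(1)[OF ring_hom_gl_const gl_complete, of "Lam G"]
  have "L k $ i $ j + L k $ j $ i = 0" using torsion by (simp add: torsion_symbol_def)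
  then have "y_subst c (Lam G) (L k $ i $ j + L k $ j $ i) = 0" by (simp add: ring_hom_0[OF hom])
  then show ?thesis by (simp add: torsion_at_def ring_homD[OF hom])
qed

lemma T_antisym: "T G i j k + T G j i k = 0"
  unfolding T_def sum.distrib[symmetric] distrib_right[symmetric] by (simp add: torsion_at_antisym)

lemma Z_nth: "Z G i $ j $ k = (\<Sum>m\<in>UNIV. G i $ m $ j * B $ m $ k)"
  by (simp add: Z_def matrix_matrix_mult_def transpose_def)

text \<open>Lowering the upper index is reversible since \<open>B\<close> is invertible, so the
  equation for the lowered symbols is as strong as the original one.\<close>

lemma sym_eq_iff: "sym_eq G \<longleftrightarrow> (\<forall>i j k. Z G i $ j $ k - Z G j $ i $ k = T G i j k)"
proof -
  have diff: "Z G i $ j $ k - Z G j $ i $ k - T G i j k =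
      (\<Sum>m\<in>UNIV. (G i $ m $ j - G j $ m $ i - torsion_at G m i j) * B $ m $ k)" for i j k
    by (simp add: Z_nth T_def left_diff_distrib sum_subtractf)
  show ?thesis
  proof
    assume "sym_eq G"
    then have "Z G i $ j $ k - Z G j $ i $ k - T G i j k = 0" for i j k
      unfolding diff by (simp add: sym_eq_def)
    then show "\<forall>i j k. Z G i $ j $ k - Z G j $ i $ k = T G i j k" by simp
  next
    assume Z: "\<forall>i j k. Z G i $ j $ k - Z G j $ i $ k = T G i j k"
    have "G i $ m $ j - G j $ m $ i - torsion_at G m i j = 0" for i j m
      by (rule vector_times_invertible_eq_0[OF invertible_B, of "\<lambda>m. G i $ m $ j - G j $ m $ i - torsion_at G m i j"])
        (use diff Z in simp)
    then show "sym_eq G" by (simp add: sym_eq_def)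
  qed
qed

definition Z_rhs :: "('n \<Rightarrow> ('p, 'n, 'r) gl_alg ^ 'n ^ 'n) \<Rightarrow> 'n \<Rightarrow> ('p, 'n, 'r) gl_alg ^ 'n ^ 'n" where
  "Z_rhs G i = (\<chi> j k. c half *
     (S G i $ j $ k + S G j $ i $ k - S G k $ i $ j + (T G i j k + T G k i j - T G j k i)))"

text \<open>The index of the Koszul expression is raised again by the inverse of \<open>B\<close>,
  which solves Z G = Z_rhs G for the \<open>G\<close> on the left side.\<close>

definition step :: "('n \<Rightarrow> ('p, 'n, 'r) gl_alg ^ 'n ^ 'n) \<Rightarrow> 'n \<Rightarrow> ('p, 'n, 'r) gl_alg ^ 'n ^ 'n" where
  "step G i = transpose (Z_rhs G i ** matrix_inv B)"

lemma equations_iff_Z: "metric_eq G \<and> sym_eq G \<longleftrightarrow> (\<forall>i. Z G i = Z_rhs G i)"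
proof -
  have "metric_eq G \<longleftrightarrow> (\<forall>i j k. Z G i $ j $ k + Z G i $ k $ j = S G i $ j $ k)"
    unfolding metric_eq_iff by (simp add: vec_eq_iff transpose_def)
  moreover have "(\<forall>i. Z G i = Z_rhs G i) \<longleftrightarrow> (\<forall>i j k. Z G i $ j $ k = c half *
     (S G i $ j $ k + S G j $ i $ k - S G k $ i $ j + (T G i j k + T G k i j - T G j k i)))"
    by (simp add: vec_eq_iff Z_rhs_def)
  ultimately show ?thesis
    unfolding sym_eq_iff
    using koszul[OF c_half, of "\<lambda>i j k. S G i $ j $ k" "T G" "\<lambda>i j k. Z G i $ j $ k"] S_sym T_antisym
    by blast
qed

lemma equations_iff_fixed_point: "metric_eq G \<and> sym_eq G \<longleftrightarrow> step G = G"
proof -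
  have "Z G i = Z_rhs G i \<longleftrightarrow> step G i = G i" for i
  proof
    assume "Z G i = Z_rhs G i"
    then have "Z_rhs G i ** matrix_inv B = transpose (G i) ** (B ** matrix_inv B)"
      by (simp add: Z_def matrix_mul_assoc)
    then show "step G i = G i" by (simp add: step_def matrix_inv_left_right[OF invertible_B])
  next
    assume "step G i = G i"
    then have "transpose (G i) = Z_rhs G i ** matrix_inv B" by (metis step_def transpose_transpose)
    then show "Z G i = Z_rhs G i"
      unfolding Z_def by (simp add: matrix_inv_left_right[OF invertible_B] flip: matrix_mul_assoc)
  qed
  then show ?thesis unfolding equations_iff_Z by (simp add: fun_eq_iff)
qed

section \<open>The contraction and its fixed point\<close>

text \<open>The matrices 1 + \<theta> G gain one factor \<theta> over \<open>G\<close>, and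
  \<open>y_hom_cong\<close> carries this through the substitution.\<close>

lemma torsion_at_cong:
  assumes "\<And>i. mcong (\<theta> ^ k) (G i) (G' i)"
  shows "\<theta> ^ Suc k dvd torsion_at G m i j - torsion_at G' m i j"
  unfolding torsion_at_def
proof (rule y_hom_cong[OF y_subst(1) y_subst(1)])
  have "mcong (\<theta> ^ Suc k) (Lam G i) (Lam G' i)" for i
    unfolding Lam_def power_Suc by (intro mcong_add mcong_smat assms mcong_refl)
  then show "mcong (\<theta> ^ Suc k) (map_matrix (y_subst c (Lam G)) (yvar i :: ('p, 'n, 'r) y_alg ^ 'n ^ 'n))
      (map_matrix (y_subst c (Lam G')) (yvar i :: ('p, 'n, 'r) y_alg ^ 'n ^ 'n))" for i
    by (simp add: y_subst[OF ring_hom_gl_const gl_complete])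
  show "\<theta> ^ Suc k dvd of_nat CARD('p) ^ Suc k" by (rule dvd_power_same[OF theta_dvd_p])
qed (simp_all add: y_subst(2)[OF ring_hom_gl_const gl_complete] ring_hom_gl_const gl_complete)

text \<open>\<open>G\<close> enters \<open>S\<close> behind a factor \<theta> and \<open>T\<close>
  through the torsion terms at 1 + \<theta> G; both gain one power of \<theta>, while
  \<open>B\<close> and its inverse do not depend on \<open>G\<close>.\<close>

lemma step_cong:
  assumes G: "\<And>i. mcong (\<theta> ^ k) (G i) (G' i)"
  shows "mcong (\<theta> ^ Suc k) (step G i) (step G' i)"
proof -
  have "mcong (\<theta> * \<theta> ^ k) (S G i) (S G' i)" for i
    unfolding S_def
    \<comment> \<open>\<open>mcong_smat\<close> multiplies the modulus by the scalar -1, hence the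
      associated modulus.\<close>
    by (rule mcong_weaken[where d = "- 1 * (\<theta> * \<theta> ^ k)"], rule mcong_smat, rule mcong_add[OF mcong_refl], rule mcong_smat)
      (intro mcong_add mcong_mult mcong_transpose mcong_refl G, simp)
  then have S: "\<theta> ^ Suc k dvd S G i $ j $ l - S G' i $ j $ l" for i j l
    using mcongD by simp blast
  have T: "\<theta> ^ Suc k dvd T G i j l - T G' i j l" for i j l
    unfolding T_def by (intro dvd_diff_sum dvd_diff_mult torsion_at_cong G) simp
  have "\<theta> ^ Suc k dvd Z_rhs G i $ j $ l - Z_rhs G' i $ j $ l" for i j l
    unfolding Z_rhs_def vec_lambda_beta
    by (intro dvd_diff_mult dvd_diff_add dvd_diff_minus S T) simp
  then have "mcong (\<theta> ^ Suc k) (Z_rhs G i) (Z_rhs G' i)" by (simp add: mcong_def)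
  then show ?thesis unfolding step_def by (intro mcong_transpose mcong_mult mcong_refl)
qed

lemma mcong_all_imp_eq: "(\<And>k. mcong (\<theta> ^ k) M M') \<Longrightarrow> M = M'"
  for M M' :: "('p, 'n, 'r) gl_alg ^ 'n ^ 'n"
proof -
  assume "\<And>k. mcong (\<theta> ^ k) M M'"
  then have "M $ i $ j - M' $ i $ j = 0" for i j by (intro theta_separated mcongD)
  then show "M = M'" by (simp add: vec_eq_iff)
qed

text \<open>Banach's fixed point theorem in \<theta>-adic form: the k-th iterate from 0 is correct
  modulo \<theta>^k, and two fixed points are congruent modulo every power of \<theta>.\<close>

lemma step_fixed_point: "\<exists>!G. step G = G"
proof -
  define F where "F k = (step ^^ k) (\<lambda>_. 0)" for k
  have F_Suc: "F (Suc k) = step (F k)" for k by (simp add: F_def)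
  have F: "mcong (\<theta> ^ k) (F (Suc k) i) (F k i)" for k i
  proof (induction k arbitrary: i)
    case (Suc k)
    then show ?case unfolding F_Suc[of "Suc k"] F_Suc[of k] by (intro step_cong) (simp add: F_Suc)
  qed (simp add: mcong_def)
  have "\<exists>l. \<forall>k. \<theta> ^ k dvd l - F k i $ j $ m" for i j m
    by (rule theta_complete) (rule mcongD[OF F])
  then have "\<forall>a. \<exists>l. \<forall>k. \<theta> ^ k dvd l - F k (fst a) $ fst (snd a) $ snd (snd a)" by blast
  from choice[OF this] obtain l where
    l: "\<And>a k. \<theta> ^ k dvd l a - F k (fst a) $ fst (snd a) $ snd (snd a)" by blast
  define G where "G i = (\<chi> j m. l (i, j, m))" for i
  have G: "mcong (\<theta> ^ k) (G i) (F k i)" for i k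
    using l[of k "(i, _, _)"] by (simp add: mcong_def G_def)
  have "step G i = G i" for i
  proof (rule mcong_all_imp_eq)
    fix k
    have "mcong (\<theta> ^ Suc k) (step G i) (F (Suc k) i)" unfolding F_Suc by (intro step_cong G)
    then have "mcong (\<theta> ^ Suc k) (step G i) (G i)" using mcong_trans mcong_sym G by blast
    then show "mcong (\<theta> ^ k) (step G i) (G i)" by (rule mcong_weaken) (simp add: power_Suc2)
  qed
  then have "step G = G" ..
  moreover have "G' = G" if G': "step G' = G'" for G'
  proof
    fix i
    have "mcong (\<theta> ^ k) (G' i) (G i)" for k
    proof (induction k arbitrary: i)
      case (Suc k)
      then show ?case using step_cong[of k G' G i] unfolding G' \<open>step G = G\<close> by simp
    qed (simp add: mcong_def)
    then show "G' i = G i" by (rule mcong_all_imp_eq)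
  qed
  ultimately show ?thesis by blast
qed

text \<open>The matrix \<open>\<Gamma>\<^sub>i\<^sup>t\<close> of the paper.\<close>

definition christoffel :: "('n \<Rightarrow> ('p, 'n, 'r) gl_alg \<Rightarrow> ('p, 'n, 'r) gl_alg) \<Rightarrow> 'n \<Rightarrow> ('p, 'n, 'r) gl_alg ^ 'n ^ 'n" where
  "christoffel \<Delta> i = matrix_inv X ** map_matrix (\<Delta> i) x"

section \<open>Connections in terms of their Christoffel matrices\<close>

lemma Gamma2_eq: "Gamma2 s \<Delta> k i j = christoffel \<Delta> i $ k $ j"
  by (simp add: Gamma2_def Gamma_mat_def christoffel_def X_def transpose_def)

lemma frob_x: "map_matrix (frob CARD('p) s \<theta> D) x = X + smat \<theta> (map_matrix D x)"
  by (simp add: vec_eq_iff frob_def X_nth)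

lemma X_times_christoffel: "X ** christoffel \<Delta> i = map_matrix (\<Delta> i) x"
  by (simp add: christoffel_def matrix_mul_assoc matrix_inv_left_right[OF invertible_X])

lemma conn_frob_x: "map_matrix (conn_frob s \<pi> \<Delta> i) x = X ** Lam (christoffel \<Delta>) i"
  by (simp add: conn_frob_def frob_x Lam_def matrix_add_ldistrib smat_mult_right X_times_christoffel)

lemma Lambda_mat_eq: "Lambda_mat s \<pi> \<Delta> = Lam (christoffel \<Delta>)"
  by (rule ext) (simp add: Lambda_mat_def conn_frob_x matrix_mul_assoc
      matrix_inv_left_right[OF invertible_X] flip: X_def)

lemma symmetric_conn_iff: "symmetric_conn s \<pi> L \<Delta> \<longleftrightarrow> sym_eq (christoffel \<Delta>)"
  by (simp add: symmetric_conn_def sym_eq_def Gamma2_eq Lambda_mat_eq torsion_at_def)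

lemma ring_hom_conn_frob: "pi_connection s \<pi> \<delta> \<Delta> \<Longrightarrow> is_ring_hom (conn_frob s \<pi> \<Delta> i)"
  for \<Delta> :: "'n \<Rightarrow> ('p, 'n, 'r) gl_alg \<Rightarrow> ('p, 'n, 'r) gl_alg"
  unfolding conn_frob_def pi_connection_def
  by (rule ring_hom_frob[OF prime theta_p_over_pi]) blast

lemma conn_frob_const:
  "pi_connection s \<pi> \<delta> \<Delta> \<Longrightarrow> conn_frob s \<pi> \<Delta> i (c a) = c (frob CARD('p) s \<pi> (\<delta> i) a)"
  by (simp add: conn_frob_def pi_connection_def frob_def gl_const_simps)

lemma frob_const_hom: "is_ring_hom (\<lambda>a. c (frob CARD('p) s \<pi> (\<delta> i) a))"
  using ring_hom_comp[OF ring_hom_gl_const frob_hom] by (simp add: comp_def)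

lemmas H_map = gl_subst[OF ring_hom_gl_const det_H gl_complete, folded H_map_def]

lemmas phi0 = gl_subst[OF frob_const_hom det_X gl_complete, unfolded X_def, folded phi0_def]

text \<open>Both compositions are ring homomorphisms with the same values on constants, so their
  equality is decided on \<open>x\<close>, where they give the two sides of the matrix
  equation.\<close>

lemma metric_conn_iff:
  assumes \<Delta>: "pi_connection s \<pi> \<delta> \<Delta>"
  shows "metric_conn s \<pi> \<delta> q \<Delta> \<longleftrightarrow> metric_eq (christoffel \<Delta>)"
proof -
  have "conn_frob s \<pi> \<Delta> i \<circ> H_map q = H_map q \<circ> phi0 s \<pi> (\<delta> i) \<longleftrightarrow>
      transpose (Lam (christoffel \<Delta>) i) ** A i ** Lam (christoffel \<Delta>) i = B" for i
  proof -
    note \<phi> = ring_hom_conn_frob[OF \<Delta>, of i]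
    let ?lhs = "conn_frob s \<pi> \<Delta> i \<circ> H_map q" and ?rhs = "H_map q \<circ> phi0 s \<pi> (\<delta> i)"
    have comp: "map_matrix (f \<circ> g) M = map_matrix f (map_matrix g M)"
      for f g :: "('p, 'n, 'r) gl_alg \<Rightarrow> ('p, 'n, 'r) gl_alg" and M :: "_ ^ 'n ^ 'n"
      by (simp add: map_matrix_def)
    have "map_matrix ?lhs x = map_matrix (conn_frob s \<pi> \<Delta> i) (transpose x ** map_matrix c q ** x)"
      unfolding comp H_map ..
    also have "\<dots> = transpose (X ** Lam (christoffel \<Delta>) i) ** map_matrix c (q\<phi> i) ** (X ** Lam (christoffel \<Delta>) i)"
    proof -
      have "map_matrix (conn_frob s \<pi> \<Delta> i) (map_matrix c q) = map_matrix c (q\<phi> i)"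
        by (simp add: vec_eq_iff conn_frob_const[OF \<Delta>] q\<phi>_def)
      then show ?thesis by (simp add: ring_hom_matrix_mult[OF \<phi>] ring_hom_transpose conn_frob_x)
    qed
    also have "\<dots> = transpose (Lam (christoffel \<Delta>) i) ** A i ** Lam (christoffel \<Delta>) i"
      by (simp add: A_def matrix_transpose_mul matrix_mul_assoc)
    finally have lhs: "map_matrix ?lhs x = transpose (Lam (christoffel \<Delta>) i) ** A i ** Lam (christoffel \<Delta>) i" .
    have "map_matrix ?rhs x = map_matrix (H_map q) (entrywise_power x (CARD('p) ^ s))"
      unfolding comp phi0 ..
    also have "\<dots> = entrywise_power (map_matrix (H_map q) x) (CARD('p) ^ s)"
      by (simp add: entrywise_power_def vec_eq_iff ring_hom_power[OF H_map(1)])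
    finally have rhs: "map_matrix ?rhs x = B" by (simp add: H_map B_def)
    have "?lhs = ?rhs \<longleftrightarrow> map_matrix ?lhs x = map_matrix ?rhs x"
    proof
      assume "map_matrix ?lhs x = map_matrix ?rhs x"
      then show "?lhs = ?rhs"
        by (intro gl_hom_unique[OF _ _ _ _ gl_complete] ring_hom_comp \<phi> H_map(1) phi0(1))
          (simp_all add: H_map(2) phi0(2) conn_frob_const[OF \<Delta>])
    qed simp
    then show ?thesis unfolding lhs rhs .
  qed
  then show ?thesis by (simp add: metric_conn_def metric_eq_def)
qed

lemma levi_civita_iff: "levi_civita s \<pi> \<delta> q L \<Delta> \<longleftrightarrow> pi_connection s \<pi> \<delta> \<Delta> \<and> step (christoffel \<Delta>) = christoffel \<Delta>"
  unfolding levi_civita_def equations_iff_fixed_point[symmetric] symmetric_conn_iff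
  using metric_conn_iff by blast

section \<open>Frobenius lifts with prescribed Christoffel matrices\<close>

text \<open>Lifting the p^s-th power map modulo \<theta> is a property that passes to sums because
  that map is additive modulo p, and to limits because \<theta> divides p. It can therefore be
  checked on generators; for the inverse determinant it follows from
  \<open>p_dvd_det_entrywise_power\<close>.\<close>

lemma theta_dvd_hom_minus_power:
  assumes \<phi>: "is_ring_hom \<phi>" "\<And>a. \<theta> dvd \<phi> (c a) - c a ^ CARD('p) ^ s"
    "\<And>i j. \<theta> dvd \<phi> (x $ i $ j) - x $ i $ j ^ CARD('p) ^ s"
  shows "\<theta> dvd \<phi> a - a ^ CARD('p) ^ s"
proof (induction a rule: gl_induct)
  case (det_inv u)
  have power_sum: "\<theta> dvd \<phi> (det x) - det x ^ CARD('p) ^ s"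
  proof -
    have "mcong \<theta> (map_matrix \<phi> x) (entrywise_power x (CARD('p) ^ s))"
      using \<phi>(3) by (simp add: mcong_def entrywise_power_def)
    then have "\<theta> dvd \<phi> (det x) - det (entrywise_power x (CARD('p) ^ s))"
      unfolding ring_hom_det[OF \<phi>(1)] by (rule mcong_det)
    then show ?thesis
      by (rule dvd_diff_trans) (rule dvd_diff_swap[OF dvd_trans[OF theta_dvd_p p_dvd_det_entrywise_power[OF prime odd]]])
  qed
  have 1: "\<phi> u * \<phi> (det x) = 1" using det_inv by (metis ring_homD(1,3)[OF \<phi>(1)])
  have 2: "u ^ CARD('p) ^ s * det x ^ CARD('p) ^ s = 1" using det_inv by (simp flip: power_mult_distrib)
  \<comment> \<open>The two inverses are compared by inserting 1 in the form of the products
    \<open>1\<close> and \<open>2\<close>, which leaves a multiple of the known difference for the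
    determinant.\<close>
  have "\<phi> u - u ^ CARD('p) ^ s = \<phi> u * (u ^ CARD('p) ^ s * det x ^ CARD('p) ^ s) - (\<phi> u * \<phi> (det x)) * u ^ CARD('p) ^ s"
    unfolding 1 2 by simp
  also have "\<dots> = - (\<phi> u * u ^ CARD('p) ^ s * (\<phi> (det x) - det x ^ CARD('p) ^ s))" by (simp add: algebra_simps)
  finally show ?case using power_sum by simp
next
  case (add a b)
  have "\<theta> dvd (a ^ CARD('p) ^ s + b ^ CARD('p) ^ s) - (a + b) ^ CARD('p) ^ s"
    unfolding C_poly_eq[OF prime, symmetric] using theta_dvd_p by simp
  from dvd_diff_trans[OF dvd_diff_add[OF add] this] show ?case by (simp add: ring_homD[OF \<phi>(1)])
next
  case (mult a b)
  from dvd_diff_mult[OF this] show ?case by (simp add: ring_homD[OF \<phi>(1)] power_mult_distrib)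
next
  case (limit a)
  obtain b where b: "\<theta> dvd \<phi> b - b ^ CARD('p) ^ s" "of_nat CARD('p) ^ 1 dvd a - b"
    using limit[of 1] by blast
  then have ab: "of_nat CARD('p) dvd a - b" by simp
  have "of_nat CARD('p) dvd \<phi> a - \<phi> b"
    using ring_hom_dvd[OF \<phi>(1) ab] by (simp add: ring_hom_of_nat[OF \<phi>(1)] ring_hom_diff[OF \<phi>(1)])
  then have "\<theta> dvd \<phi> a - \<phi> b" using theta_dvd_p dvd_trans by blast
  moreover have "\<theta> dvd b ^ CARD('p) ^ s - a ^ CARD('p) ^ s"
    by (rule dvd_diff_power[OF dvd_diff_swap[OF dvd_trans[OF theta_dvd_p ab]]])
  ultimately show ?case using dvd_diff_trans b(1) by blast
qed (use \<phi> in auto)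

text \<open>Sending \<open>x\<close> to X (1 + \<theta> G) is admissible because det (1 + \<theta>
  G) is congruent to 1 modulo \<theta>, hence a unit. The derivation is the quotient of \<phi> a -
  a^(p^s) by \<theta>.\<close>

lemma pi_connection_exists: "\<exists>\<Delta>. pi_connection s \<pi> \<delta> \<Delta> \<and> christoffel \<Delta> = G"
proof -
  define M where "M i = X ** Lam G i" for i
  have "det (Lam G i) dvd 1" for i
  proof (rule unit_cong)
    have "mcong (\<theta> * 1) (mat 1 + smat \<theta> (G i)) (mat 1 + smat \<theta> 0)"
      by (intro mcong_add mcong_smat mcong_refl) (simp add: mcong_def)
    moreover have "mat 1 + smat \<theta> 0 = (mat 1 :: ('p, 'n, 'r) gl_alg ^ 'n ^ 'n)" by (simp add: vec_eq_iff)
    ultimately show "\<theta> dvd det (Lam G i) - det (mat 1 :: ('p, 'n, 'r) gl_alg ^ 'n ^ 'n)"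
      using mcong_det by (metis Lam_def mult_1_right)
    show "det (mat 1 :: ('p, 'n, 'r) gl_alg ^ 'n ^ 'n) dvd 1" by simp
  qed
  then have "det (M i) dvd 1" for i using det_X by (simp add: M_def det_mul dvd_1_mult)
  note subst = gl_subst[OF frob_const_hom this gl_complete]
  define \<phi> :: "'n \<Rightarrow> ('p, 'n, 'r) gl_alg \<Rightarrow> ('p, 'n, 'r) gl_alg" where
    "\<phi> i = gl_subst (\<lambda>a. c (frob CARD('p) s \<pi> (\<delta> i) a)) (M i)" for i
  have \<phi>: "is_ring_hom (\<phi> i)" "\<phi> i (c a) = c (frob CARD('p) s \<pi> (\<delta> i) a)" "map_matrix (\<phi> i) x = M i" for i a
    unfolding \<phi>_def by (rule subst)+
  have M_eq: "M i = X + smat \<theta> (X ** G i)" for i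
    by (simp add: M_def Lam_def matrix_add_ldistrib smat_mult_right)
  have "\<theta> dvd \<phi> i a - a ^ CARD('p) ^ s" for i a
  proof (rule theta_dvd_hom_minus_power[OF \<phi>(1)])
    show "\<theta> dvd \<phi> i (c a) - c a ^ CARD('p) ^ s" for a
      by (simp add: \<phi>(2) frob_def gl_const_simps)
    have "\<phi> i (x $ j $ k) = M i $ j $ k" for j k by (simp flip: \<phi>(3))
    then show "\<theta> dvd \<phi> i (x $ j $ k) - x $ j $ k ^ CARD('p) ^ s" for j k
      by (simp add: M_eq X_nth)
  qed
  then have "\<forall>i a. \<exists>d. \<phi> i a - a ^ CARD('p) ^ s = \<theta> * d" by (auto simp: dvd_def)
  then obtain \<Delta> where "\<And>i a. \<phi> i a - a ^ CARD('p) ^ s = \<theta> * \<Delta> i a" by metis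
  then have \<Delta>: "\<phi> i = frob CARD('p) s \<theta> (\<Delta> i)" for i
    by (simp add: fun_eq_iff frob_def algebra_simps)
  have "pi_connection s \<pi> \<delta> \<Delta>"
    unfolding pi_connection_def
  proof (intro allI conjI)
    fix i
    show "higher_pi_derivation CARD('p) s \<theta> (c (p_over_pi CARD('p) \<pi>)) (\<Delta> i)"
      by (rule higher_pi_derivation_of_frob[OF prime theta_p_over_pi theta_regular \<phi>(1)[of i, unfolded \<Delta>]])
    fix a
    have "\<theta> * (\<Delta> i (c a) - c (\<delta> i a)) = 0"
      using \<phi>(2)[of i a] unfolding \<Delta> by (simp add: frob_def gl_const_simps algebra_simps)
    then show "\<Delta> i (c a) = c (\<delta> i a)" using theta_regular by force
  qed
  moreover have "christoffel \<Delta> = G"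
  proof
    fix i
    have "X + smat \<theta> (X ** G i) = X + smat \<theta> (map_matrix (\<Delta> i) x)"
      using \<phi>(3)[of i] unfolding \<Delta> frob_x M_eq by simp
    then have "X ** G i = map_matrix (\<Delta> i) x" by (simp add: theta_smat_cancel)
    then show "christoffel \<Delta> i = G i"
      unfolding christoffel_def by (simp add: matrix_mul_assoc matrix_inv_left_right[OF invertible_X] flip: \<open>X ** G i = _\<close>)
  qed
  ultimately show ?thesis by blast
qed

lemma pi_connection_unique:
  assumes \<Delta>: "pi_connection s \<pi> \<delta> \<Delta>" "pi_connection s \<pi> \<delta> \<Delta>'" "christoffel \<Delta> = christoffel \<Delta>'"
  shows "\<Delta> = \<Delta>'"
proof (intro ext)
  fix i a
  have "conn_frob s \<pi> \<Delta> i = conn_frob s \<pi> \<Delta>' i"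
    by (rule gl_hom_unique[OF ring_hom_conn_frob ring_hom_conn_frob _ _ gl_complete])
      (simp_all add: \<Delta> conn_frob_const conn_frob_x)
  then have "\<theta> * (\<Delta> i a - \<Delta>' i a) = 0"
    by (simp add: fun_eq_iff conn_frob_def frob_def right_diff_distrib)
  then show "\<Delta> i a = \<Delta>' i a" using theta_regular by force
qed

theorem levi_civita_ex1: "\<exists>!\<Delta>. levi_civita s \<pi> \<delta> q L \<Delta>"
proof -
  obtain G where G: "step G = G" "\<And>G'. step G' = G' \<Longrightarrow> G' = G" using step_fixed_point by blast
  obtain \<Delta> where \<Delta>: "pi_connection s \<pi> \<delta> \<Delta>" "christoffel \<Delta> = G" using pi_connection_exists by blast
  show ?thesis
  proof (rule ex1I)
    show "levi_civita s \<pi> \<delta> q L \<Delta>" using \<Delta> G(1) by (simp add: levi_civita_iff)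
    show "\<Delta>' = \<Delta>" if "levi_civita s \<pi> \<delta> q L \<Delta>'" for \<Delta>'
    proof (rule pi_connection_unique)
      show "pi_connection s \<pi> \<delta> \<Delta>'" using that by (simp add: levi_civita_iff)
      show "christoffel \<Delta>' = christoffel \<Delta>" using that G(2) \<Delta>(2) by (simp add: levi_civita_iff)
    qed (rule \<Delta>)
  qed
qed

end

section \<open>Ideals\<close>

lemma gen_ideal:
  fixes S :: "'a::comm_ring_1 set"
  shows "a \<in> S \<Longrightarrow> a \<in> gen_ideal S" "0 \<in> gen_ideal S"
    "a \<in> gen_ideal S \<Longrightarrow> b \<in> gen_ideal S \<Longrightarrow> a + b \<in> gen_ideal S"
    "a \<in> gen_ideal S \<Longrightarrow> r * a \<in> gen_ideal S"
proof -
  interpret module "(*) :: 'a \<Rightarrow> 'a \<Rightarrow> 'a" by unfold_locales (simp_all add: algebra_simps)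
  show "a \<in> S \<Longrightarrow> a \<in> gen_ideal S" "0 \<in> gen_ideal S"
    "a \<in> gen_ideal S \<Longrightarrow> b \<in> gen_ideal S \<Longrightarrow> a + b \<in> gen_ideal S"
    "a \<in> gen_ideal S \<Longrightarrow> r * a \<in> gen_ideal S"
    unfolding gen_ideal_def by (rule span_base span_zero span_add span_scale; assumption?)+
qed

lemma gen_ideal_minus: "a \<in> gen_ideal S \<Longrightarrow> - a \<in> gen_ideal S"
  using gen_ideal(4)[of a S "- 1"] by simp

context levi_civita_data
begin

subsection \<open>Christoffel symbols at the identity\<close>

definition \<epsilon> :: "('p, 'n, 'r) gl_alg \<Rightarrow> 'r" where "\<epsilon> = gl_subst (\<lambda>a. a) (mat 1)"

lemma eps: "is_ring_hom \<epsilon>" "\<epsilon> (c a) = a" "map_matrix \<epsilon> x = mat 1"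
proof -
  have "det (mat 1 :: 'r ^ 'n ^ 'n) dvd 1" by simp
  note subst = gl_subst[OF ring_hom_id this complete_R]
  show "is_ring_hom \<epsilon>" "\<epsilon> (c a) = a" "map_matrix \<epsilon> x = mat 1" unfolding \<epsilon>_def by (rule subst)+
qed

lemmas eps_simps = ring_homD[OF eps(1)] ring_hom_0[OF eps(1)] ring_hom_minus[OF eps(1)]
  ring_hom_diff[OF eps(1)] ring_hom_power[OF eps(1)] ring_hom_sum[OF eps(1)] eps(2)

text \<open>The ideal is generated algebraically, so p-adic limits need an argument: as
  \<open>d\<close> divides p^n, an approximation modulo p^n is good enough, its error being a
  multiple of \<open>d\<close>.\<close>

lemma minus_eps_in_ideal:
  assumes d: "d dvd of_nat CARD('p) ^ n"
  shows "a - c (\<epsilon> a) \<in> (ideal_with_P d :: ('p, 'n, 'r) gl_alg set)"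
proof -
  define I where "I = (ideal_with_P d :: ('p, 'n, 'r) gl_alg set)"
  note I = gen_ideal[where S = "insert (c d) x_minus_1_entries", folded ideal_with_P_def I_def]
  have I_minus: "a \<in> I \<Longrightarrow> - a \<in> I" for a
    using gen_ideal_minus unfolding I_def ideal_with_P_def .
  let ?Q = "\<lambda>a. a - c (\<epsilon> a) \<in> I"
  have add: "?Q (a + b)" if "?Q a" "?Q b" for a b
    using I(3)[OF that] by (simp add: eps_simps gl_const_simps algebra_simps)
  have mult: "?Q (a * b)" if "?Q a" "?Q b" for a b
  proof -
    have "a * b - c (\<epsilon> (a * b)) = a * (b - c (\<epsilon> b)) + c (\<epsilon> b) * (a - c (\<epsilon> a))"
      by (simp add: eps_simps gl_const_simps algebra_simps)
    then show ?thesis using that I(3,4) by simp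
  qed
  have const: "?Q (c b)" for b using I(2) by (simp add: eps_simps)
  have var: "?Q (x $ i $ j)" for i j
  proof -
    have "\<epsilon> (x $ i $ j) = (mat 1 :: 'r ^ 'n ^ 'n) $ i $ j" by (simp flip: eps(3))
    then have "c (\<epsilon> (x $ i $ j)) = (mat 1 :: ('p, 'n, 'r) gl_alg ^ 'n ^ 'n) $ i $ j"
      by (simp add: mat_def gl_const_simps)
    then have "x $ i $ j - c (\<epsilon> (x $ i $ j)) = (gl_x - mat 1) $ i $ j" by simp
    also have "\<dots> \<in> I" by (rule I(1)) (auto simp: x_minus_1_entries_def)
    finally show ?thesis .
  qed
  have Q_int: "?Q (of_int k)" for k
    using const[of "of_int k"] by (simp add: ring_hom_of_int[OF ring_hom_gl_const])
  have Q_prod: "?Q (\<Prod>i\<in>K. x $ i $ \<tau> i)" for K \<tau>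
    by (induction K rule: infinite_finite_induct)
      (use const[of 1] in \<open>auto simp: gl_const_simps intro: mult var\<close>)
  have Q_sum: "(\<And>t. t \<in> K \<Longrightarrow> ?Q (f t)) \<Longrightarrow> ?Q (sum f K)" for f and K :: "('n \<Rightarrow> 'n) set"
    by (induction K rule: infinite_finite_induct)
      (use const[of 0] in \<open>auto simp: gl_const_simps intro: add\<close>)
  have det: "?Q (det x)" unfolding det_def by (rule Q_sum) (rule mult[OF Q_int Q_prod])
  have "?Q a"
  proof (induction a rule: gl_induct)
    case (det_inv u)
    have "\<epsilon> (det x) = 1" by (simp add: ring_hom_det[OF eps(1)] eps(3))
    moreover have "\<epsilon> u * \<epsilon> (det x) = 1" using det_inv by (simp flip: eps_simps(3) add: eps_simps(1))
    ultimately have e: "\<epsilon> (det x) = 1" "\<epsilon> u = 1" by auto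
    \<comment> \<open>From u det x = 1 the inverse determinant differs from 1 by a multiple of det x
      - 1.\<close>
    have "u - 1 = - (u * (det x - c 1))" using det_inv by (simp add: right_diff_distrib gl_const_simps)
    then show ?case using det I(4) I_minus unfolding e by (simp add: gl_const_simps)
  next
    case (limit a)
    obtain b where b: "?Q b" "of_nat CARD('p) ^ n dvd a - b" using limit by blast
    obtain t where t: "a - b = of_nat CARD('p) ^ n * t" using b(2) by (rule dvdE)
    obtain r where r: "of_nat CARD('p) ^ n = d * r" using d by (rule dvdE)
    have "(of_nat CARD('p) ^ n :: ('p, 'n, 'r) gl_alg) = c (of_nat CARD('p) ^ n)" by (simp add: gl_const_simps)
    also have "\<dots> = c r * c d" unfolding r by (simp add: gl_const_simps mult.commute)
    finally have pn: "a - b = (c r * t) * c d" using t by (simp add: mult_ac)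
    have "c d \<in> I" by (rule I(1)) simp
    \<comment> \<open>Evaluation fixes constants, so the value at 1 of the error is again a multiple
      of \<open>c d\<close>.\<close>
    have "c (\<epsilon> (a - b)) = c (\<epsilon> (c r * t)) * c d" unfolding pn by (simp add: eps_simps gl_const_simps)
    then have eps_pn: "c (\<epsilon> a) - c (\<epsilon> b) = c (\<epsilon> (c r * t)) * c d"
      unfolding eps_simps(6) gl_const_simps(6) .
    have "a - c (\<epsilon> a) = (b - c (\<epsilon> b)) + ((c r * t) * c d + (- c (\<epsilon> (c r * t))) * c d)"
      unfolding pn[symmetric] mult_minus_left eps_pn[symmetric] by simp
    moreover have "(b - c (\<epsilon> b)) + ((c r * t) * c d + (- c (\<epsilon> (c r * t))) * c d) \<in> I"
      by (intro I(3) I(4) b(1) \<open>c d \<in> I\<close>)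
    ultimately show ?case by simp
  qed (fact const var add mult)+
  then show ?thesis unfolding I_def .
qed

lemma eps_X: "map_matrix \<epsilon> X = mat 1"
proof -
  have "\<epsilon> (x $ i $ j) = (mat 1 :: 'r ^ 'n ^ 'n) $ i $ j" for i j by (simp flip: eps(3))
  moreover have "CARD('p) ^ s \<noteq> 0" by simp
  ultimately show ?thesis by (simp add: vec_eq_iff X_nth eps_simps mat_def power_0_left)
qed

lemma map_eps_c: "map_matrix \<epsilon> (map_matrix c M) = M"
  by (simp add: vec_eq_iff eps(2))

lemma eps_B: "\<epsilon> (B $ i $ j) = q $ i $ j ^ CARD('p) ^ s"
proof -
  have "map_matrix \<epsilon> (transpose x ** map_matrix c q ** x) = q"
    by (simp add: ring_hom_matrix_mult[OF eps(1)] ring_hom_transpose eps(3) map_eps_c transpose_mat)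
  then have "\<epsilon> ((transpose x ** map_matrix c q ** x) $ i $ j) = q $ i $ j" by (metis nth_map_matrix)
  then show ?thesis by (simp add: B_def entrywise_power_def eps_simps)
qed

lemma eps_A: "map_matrix \<epsilon> (A i) = q\<phi> i"
  by (simp add: A_def ring_hom_matrix_mult[OF eps(1)] ring_hom_transpose eps_X map_eps_c transpose_mat)

text \<open>At x = 1 the relation A = B + \<theta> C compares q^(p^s) + \<pi> \<delta> q with
  q^(p^s), entrywise; cancelling \<pi> leaves \<delta> q. This is how the derivatives of
  \<open>q\<close> enter the formula for the symbols.\<close>

lemma eps_C: "\<epsilon> (C i $ j $ k) = \<delta> i (q $ j $ k)"
proof -
  have "q\<phi> i $ j $ k = \<epsilon> (A i $ j $ k)" by (simp flip: eps_A)
  then have "q $ j $ k ^ CARD('p) ^ s + \<pi> * \<delta> i (q $ j $ k) = q $ j $ k ^ CARD('p) ^ s + \<pi> * \<epsilon> (C i $ j $ k)"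
    unfolding A_eq by (simp add: q\<phi>_def frob_def eps_simps eps_B)
  then show ?thesis using pi_nz by simp
qed

section \<open>Congruences for the values at the identity\<close>

text \<open>At x = 1 the substituted matrices 1 + \<pi> G(1) are congruent to 1 modulo \<pi>^(t+1).
  The exponent \<open>t\<close> is general for the sake of the later induction.\<close>

lemma eps_torsion_at:
  assumes "\<And>i. mcong (\<pi> ^ t) (map_matrix \<epsilon> (G i)) 0"
  shows "\<pi> ^ Suc t dvd \<epsilon> (torsion_at G m i j) - L2_at_1 L m i j"
proof -
  let ?h = "\<epsilon> \<circ> y_subst c (Lam G) :: ('p, 'n, 'r) y_alg \<Rightarrow> 'r"
    and ?h' = "y_subst (\<lambda>a. a) (\<lambda>_. mat 1) :: ('p, 'n, 'r) y_alg \<Rightarrow> 'r"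
  note y = y_subst[OF ring_hom_gl_const gl_complete, of "Lam G"]
    and y' = y_subst[OF ring_hom_id complete_R, of "\<lambda>_. mat 1"]
  have "\<pi> ^ Suc t dvd ?h a - ?h' a" for a
  proof (rule y_hom_cong)
    show "is_ring_hom ?h" by (rule ring_hom_comp[OF eps(1) y(1)])
    show "is_ring_hom ?h'" by (rule y'(1))
    show "?h (yconst a) = ?h' (yconst a)" for a by (simp add: y(2) y'(2) eps(2))
    show "\<pi> ^ Suc t dvd of_nat CARD('p) ^ Suc t" by (rule dvd_power_same[OF pi_dvd])
    fix i
    have "map_matrix ?h (yvar i :: ('p, 'n, 'r) y_alg ^ 'n ^ 'n) = map_matrix \<epsilon> (map_matrix (y_subst c (Lam G)) (yvar i :: ('p, 'n, 'r) y_alg ^ 'n ^ 'n))"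
      by (simp add: map_matrix_def)
    also have "\<dots> = map_matrix \<epsilon> (mat 1) + smat \<pi> (map_matrix \<epsilon> (G i))"
      unfolding y(3) by (simp add: vec_eq_iff Lam_def eps_simps)
    also have "map_matrix \<epsilon> (mat 1) = mat 1" by (rule ring_hom_mat_1[OF eps(1)])
    finally have 1: "map_matrix ?h (yvar i :: ('p, 'n, 'r) y_alg ^ 'n ^ 'n) = mat 1 + smat \<pi> (map_matrix \<epsilon> (G i))" .
    have 2: "map_matrix ?h' (yvar i :: ('p, 'n, 'r) y_alg ^ 'n ^ 'n) = mat 1 + smat \<pi> 0"
      unfolding y'(3) by (simp add: vec_eq_iff)
    show "mcong (\<pi> ^ Suc t) (map_matrix ?h (yvar i :: ('p, 'n, 'r) y_alg ^ 'n ^ 'n)) (map_matrix ?h' (yvar i :: ('p, 'n, 'r) y_alg ^ 'n ^ 'n))"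
      unfolding 1 2 power_Suc by (intro mcong_add mcong_smat mcong_refl assms)
  qed
  then show ?thesis by (simp add: torsion_at_def L2_at_1_def)
qed

text \<open>All terms of \<open>S\<close> beyond -C contain \<open>G\<close> and a factor \<pi>, so
  they vanish to order t + 1 at x = 1, while \<open>C\<close> becomes \<delta> q by
  \<open>eps_C\<close>.\<close>

lemma eps_S:
  assumes "\<And>i. mcong (\<pi> ^ t) (map_matrix \<epsilon> (G i)) 0"
  shows "\<pi> ^ Suc t dvd \<epsilon> (S G i $ j $ k) - (- \<delta> i (q $ j $ k))"
proof -
  let ?E = "transpose (G i) ** C i + C i ** G i + transpose (G i) ** A i ** G i"
  let ?g = "map_matrix \<epsilon> (G i)"
  have "map_matrix \<epsilon> ?E = transpose ?g ** map_matrix \<epsilon> (C i) + map_matrix \<epsilon> (C i) ** ?g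
      + transpose ?g ** map_matrix \<epsilon> (A i) ** ?g"
    by (simp add: vec_eq_iff eps_simps matrix_matrix_mult_def transpose_def)
  moreover have "mcong (\<pi> ^ t) (transpose ?g ** map_matrix \<epsilon> (C i) + map_matrix \<epsilon> (C i) ** ?g
      + transpose ?g ** map_matrix \<epsilon> (A i) ** ?g)
      (transpose 0 ** map_matrix \<epsilon> (C i) + map_matrix \<epsilon> (C i) ** 0 + transpose 0 ** map_matrix \<epsilon> (A i) ** 0)"
    by (intro mcong_add mcong_mult mcong_transpose mcong_refl assms)
  moreover have "transpose 0 ** map_matrix \<epsilon> (C i) + map_matrix \<epsilon> (C i) ** 0
      + transpose 0 ** map_matrix \<epsilon> (A i) ** 0 = (0 :: 'r ^ 'n ^ 'n)"
    by (simp add: vec_eq_iff matrix_matrix_mult_def transpose_def)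
  ultimately have "mcong (\<pi> ^ t) (map_matrix \<epsilon> ?E) 0" by simp
  from mcongD[OF this, of j k] have "\<pi> ^ t dvd \<epsilon> (?E $ j $ k)" by simp
  then have "\<pi> ^ Suc t dvd \<pi> * \<epsilon> (?E $ j $ k)" unfolding power_Suc by (rule mult_dvd_mono[OF dvd_refl])
  moreover have "\<epsilon> (S G i $ j $ k) - (- \<delta> i (q $ j $ k)) = - (\<pi> * \<epsilon> (?E $ j $ k))"
    unfolding S_def smat_nth vector_add_component[of "C i"] by (simp add: eps_simps eps_C)
  ultimately show ?thesis by simp
qed

lemma eps_Gamma1_eq: "\<epsilon> (Gamma1 s q \<Delta> i j k) = \<epsilon> (Z (christoffel \<Delta>) i $ j $ k)"
  by (simp add: Gamma1_def Gamma2_eq Z_nth eps_simps eps_B)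

definition Gamma_value :: "'n \<Rightarrow> 'n \<Rightarrow> 'n \<Rightarrow> 'r" where
  "Gamma_value i j k = - half * (\<delta> i (q $ j $ k) + \<delta> j (q $ i $ k) - \<delta> k (q $ i $ j))
     + half * (L1_at_1 s q L k i j + L1_at_1 s q L i j k - L1_at_1 s q L j k i)"

text \<open>The Koszul formula at x = 1: if the symbols vanish to order \<open>t\<close>, the
  correction terms vanish to order t + 1. The case t = 0 is the congruence modulo \<pi>; iteration
  gives the vanishing to order m.\<close>

lemma eps_Gamma1:
  assumes "levi_civita s \<pi> \<delta> q L \<Delta>" and G: "\<And>i. mcong (\<pi> ^ t) (map_matrix \<epsilon> (christoffel \<Delta> i)) 0"
  shows "\<pi> ^ Suc t dvd \<epsilon> (Gamma1 s q \<Delta> i j k) - Gamma_value i j k"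
proof -
  let ?G = "christoffel \<Delta>"
  have "step ?G = ?G" using assms(1) by (simp add: levi_civita_iff)
  then have "Z ?G i = Z_rhs ?G i"
    unfolding equations_iff_fixed_point[symmetric] equations_iff_Z by blast
  then have eq: "\<epsilon> (Gamma1 s q \<Delta> i j k) = half * (\<epsilon> (S ?G i $ j $ k) + \<epsilon> (S ?G j $ i $ k) - \<epsilon> (S ?G k $ i $ j)
      + (\<epsilon> (T ?G i j k) + \<epsilon> (T ?G k i j) - \<epsilon> (T ?G j k i)))"
    unfolding eps_Gamma1_eq by (simp add: Z_rhs_def eps_simps)
  have T: "\<pi> ^ Suc t dvd \<epsilon> (T ?G i j k) - L1_at_1 s q L i j k" for i j k
    unfolding T_def L1_at_1_def ring_hom_sum[OF eps(1)] eps_simps(3) eps_B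
    by (intro dvd_diff_sum dvd_diff_mult eps_torsion_at G) simp
  have val: "Gamma_value i j k = half * (- \<delta> i (q $ j $ k) + - \<delta> j (q $ i $ k) - - \<delta> k (q $ i $ j)
      + (L1_at_1 s q L i j k + L1_at_1 s q L k i j - L1_at_1 s q L j k i))"
    by (simp add: Gamma_value_def algebra_simps)
  show ?thesis unfolding eq val
    by (intro dvd_diff_mult dvd_diff_add dvd_diff_minus T eps_S G) simp
qed

lemma Gamma1_mod_pi:
  assumes "levi_civita s \<pi> \<delta> q L \<Delta>"
  shows "Gamma1 s q \<Delta> i j k - c (Gamma_value i j k) \<in> ideal_with_P \<pi>"
proof -
  have "\<pi> ^ Suc 0 dvd \<epsilon> (Gamma1 s q \<Delta> i j k) - Gamma_value i j k"
    by (rule eps_Gamma1[OF assms]) (simp add: mcong_def)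
  then obtain r where r: "\<epsilon> (Gamma1 s q \<Delta> i j k) - Gamma_value i j k = \<pi> * r" by (auto elim: dvdE)
  have "Gamma1 s q \<Delta> i j k - c (\<epsilon> (Gamma1 s q \<Delta> i j k)) \<in> ideal_with_P \<pi>"
    by (rule minus_eps_in_ideal[of \<pi> 1]) (simp add: pi_dvd)
  moreover have "c r * c \<pi> \<in> (ideal_with_P \<pi> :: ('p, 'n, 'r) gl_alg set)"
    unfolding ideal_with_P_def by (intro gen_ideal(4) gen_ideal(1)) simp
  ultimately have "(Gamma1 s q \<Delta> i j k - c (\<epsilon> (Gamma1 s q \<Delta> i j k))) + c r * c \<pi> \<in> ideal_with_P \<pi>"
    unfolding ideal_with_P_def by (rule gen_ideal(3))
  moreover have "c r * c \<pi> = c (\<epsilon> (Gamma1 s q \<Delta> i j k)) - c (Gamma_value i j k)"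
    using r by (simp add: mult.commute flip: gl_const_simps)
  ultimately show ?thesis by simp
qed

text \<open>Induction on t up to m: if the symbols at 1 vanish modulo \<pi>^t, their lowered forms
  equal \<open>Gamma_value\<close> modulo \<pi>^(t+1), and that value is divisible by \<pi>^m. The
  matrix B(1) is invertible, so the vanishing passes back to \<open>christoffel\<close>.\<close>

lemma Gamma1_mod_pi_power:
  assumes \<Delta>: "levi_civita s \<pi> \<delta> q L \<Delta>"
    and m: "\<forall>i j k. \<pi> ^ m dvd L2_at_1 L k i j \<and> \<pi> ^ m dvd \<delta> i (q $ j $ k)"
  shows "Gamma1 s q \<Delta> i j k \<in> ideal_with_P (\<pi> ^ m)"
proof -
  let ?Q = "map_matrix \<epsilon> B"
  have "\<epsilon> (det B) dvd 1" using ring_hom_dvd[OF eps(1) det_B] by (simp add: eps_simps)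
  then have inv: "invertible ?Q" by (simp add: invertible_iff_det_dvd_1 ring_hom_det[OF eps(1)])
  have "\<pi> ^ m dvd L1_at_1 s q L i j k" for i j k
    unfolding L1_at_1_def using m by (intro dvd_sum dvd_mult2) blast
  then have val: "\<pi> ^ m dvd Gamma_value i j k" for i j k
    unfolding Gamma_value_def using m by (intro dvd_add dvd_mult dvd_diff) auto
  have "mcong (\<pi> ^ t) (map_matrix \<epsilon> (christoffel \<Delta> i)) 0" if "t \<le> m" for t i
    using that
  proof (induction t arbitrary: i)
    case (Suc t)
    let ?g = "map_matrix \<epsilon> (christoffel \<Delta> i)"
    have "\<pi> ^ Suc t dvd \<epsilon> (Z (christoffel \<Delta>) i $ j $ k) - 0" for j k
    proof (rule dvd_diff_trans)
      show "\<pi> ^ Suc t dvd \<epsilon> (Z (christoffel \<Delta>) i $ j $ k) - Gamma_value i j k"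
        using eps_Gamma1[OF \<Delta>] Suc by (simp flip: eps_Gamma1_eq)
      have "\<pi> ^ Suc t dvd \<pi> ^ m" using Suc.prems by (rule le_imp_power_dvd)
      then show "\<pi> ^ Suc t dvd Gamma_value i j k - 0" using val dvd_trans by simp blast
    qed
    then have "mcong (\<pi> ^ Suc t) (map_matrix \<epsilon> (Z (christoffel \<Delta>) i)) 0" by (simp add: mcong_def)
    then have "mcong (\<pi> ^ Suc t) (transpose ?g ** ?Q) 0"
      by (simp add: Z_def ring_hom_matrix_mult[OF eps(1)] ring_hom_transpose)
    then have "mcong (\<pi> ^ Suc t) (transpose (transpose ?g ** ?Q ** matrix_inv ?Q)) (transpose ((0 :: 'r ^ 'n ^ 'n) ** matrix_inv ?Q))"
      by (intro mcong_transpose mcong_mult mcong_refl)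
    moreover have "transpose ?g ** ?Q ** matrix_inv ?Q = transpose ?g"
      by (simp add: matrix_inv_left_right[OF inv] flip: matrix_mul_assoc)
    moreover have "transpose (0 ** matrix_inv ?Q) = (0 :: 'r ^ 'n ^ 'n)" by (simp add: vec_eq_iff matrix_matrix_mult_def transpose_def)
    ultimately show ?case by (simp only: transpose_transpose)
  qed (simp add: mcong_def)
  then have "mcong (\<pi> ^ m) (map_matrix \<epsilon> (christoffel \<Delta> i)) 0" for i by simp
  \<comment> \<open>The estimate at t = m holds even modulo \<pi>^(m+1); only \<pi>^m is kept, the
    order to which the value itself is known to vanish.\<close>
  from eps_Gamma1[OF \<Delta> this] have "\<pi> ^ m dvd \<epsilon> (Gamma1 s q \<Delta> i j k) - Gamma_value i j k"
    unfolding power_Suc by (rule dvd_mult_right)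
  from dvd_add[OF this val[of i j k]] obtain r where r: "\<epsilon> (Gamma1 s q \<Delta> i j k) = \<pi> ^ m * r" by (auto elim: dvdE)
  have "Gamma1 s q \<Delta> i j k - c (\<epsilon> (Gamma1 s q \<Delta> i j k)) \<in> ideal_with_P (\<pi> ^ m)"
    by (rule minus_eps_in_ideal[of _ m]) (rule dvd_power_same[OF pi_dvd])
  moreover have "c r * c (\<pi> ^ m) \<in> (ideal_with_P (\<pi> ^ m) :: ('p, 'n, 'r) gl_alg set)"
    unfolding ideal_with_P_def by (intro gen_ideal(4) gen_ideal(1)) simp
  ultimately have "(Gamma1 s q \<Delta> i j k - c (\<epsilon> (Gamma1 s q \<Delta> i j k))) + c r * c (\<pi> ^ m) \<in> ideal_with_P (\<pi> ^ m)"
    unfolding ideal_with_P_def by (rule gen_ideal(3))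
  then show ?thesis unfolding r by (simp add: gl_const_simps mult.commute)
qed

end

theorem theorem3p30:
  fixes av :: "'k::{alg_closed_field, field_char_0} \<Rightarrow> real"
    and emb :: "'r::idom \<Rightarrow> 'k"
    and \<pi> :: 'r
    and s :: nat
    and \<delta> :: "'n::finite \<Rightarrow> 'r \<Rightarrow> 'r"
    and q :: "'r ^ 'n ^ 'n"
    and L :: "'n \<Rightarrow> ('p::finite, 'n, 'r) y_alg ^ 'n ^ 'n"
  assumes R_pi: "R_pi_ring CARD('p) av emb \<pi>"
    and s: "1 \<le> s"
    and derivations: "\<And>i. higher_pi_derivation CARD('p) s \<pi> (p_over_pi CARD('p) \<pi>) (\<delta> i)"
    and q_GL: "invertible q"
    and q_symmetric: "transpose q = q"
    and L: "torsion_symbol L"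
  shows "(\<exists>!\<Delta>. levi_civita s \<pi> \<delta> q L \<Delta>) \<and>
    (\<forall>\<Delta>. levi_civita s \<pi> \<delta> q L \<Delta> \<longrightarrow>
      (\<forall>i j k. Gamma1 s q \<Delta> i j k -
         gl_const (- half * (\<delta> i (q $ j $ k) + \<delta> j (q $ i $ k) - \<delta> k (q $ i $ j))
           + half * (L1_at_1 s q L k i j + L1_at_1 s q L i j k - L1_at_1 s q L j k i))
         \<in> ideal_with_P \<pi>)) \<and>
    (\<forall>\<Delta> m. levi_civita s \<pi> \<delta> q L \<Delta> \<longrightarrow> 1 \<le> m \<longrightarrow>
      (\<forall>i j k. \<pi> ^ m dvd L2_at_1 L k i j \<and> \<pi> ^ m dvd \<delta> i (q $ j $ k)) \<longrightarrow>
      (\<forall>i j k. Gamma1 s q \<Delta> i j k \<in> ideal_with_P (\<pi> ^ m)))"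
proof -
  interpret R: R_pi_ring "CARD('p)" av emb \<pi> by (rule R_pi)
  interpret levi_civita_data "TYPE('p)" "TYPE('r)" \<pi> s \<delta> q L
  proof
    show "\<exists>e. of_nat CARD('p) dvd \<pi> ^ e" using R.p_dvd_pi_power by blast
  qed (fact R.p_not_unit R.p_nonzero_R_pi R.padic_complete_R_pi R.prime_p R.odd_p R.pi_dvd_p
      R.two_dvd_1 derivations q_GL q_symmetric L)+
  show ?thesis
    using levi_civita_ex1 Gamma1_mod_pi[unfolded Gamma_value_def] Gamma1_mod_pi_power by blast
qed

end
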